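(* Let $V=(A_1,A_2,H,\Phi,E,\sigma_1,\sigma_2,\gamma^{in},\gamma^{out})$ be a two-operator commutative vessel with irreducible discriminant polynomial and discriminant curve $C$. Let $r_1=p_1/p_0$, $r_2=p_2/p_0$, where $p_0,p_1,p_2$ are real polynomials in two variables, be such that $A'_1=r_1(A_1,A_2)$ and $A'_2=r_2(A_1,A_2)$ are defined (that is, $p_0(A_1,A_2)$ is invertible and $A'_i=p_0(A_1,A_2)^{-1}p_i(A_1,A_2)$), and such that $r=(r_1,r_2)$ is a birational isomorphism of $C$ to an irreducible plane algebraic curve $C'$. Define $E'',\Phi'',\sigma''_1,\sigma''_2,\gamma''^{in},\gamma''^{out}$ as in the context. Then $$V''=(A'_1,A'_2,H,\Phi'',E'',\sigma''_1,\sigma''_2,\gamma''^{in},\gamma''^{out})$$ is a commutative vessel, and its discriminant variety $\{(y_1,y_2):\det(y_1\sigma''_2-y_2\sigma''_1+\gamma''^{in})=0\}$ contains $C'$.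
   Context: **Vessels.** Let $H$ be a Hilbert space (finite- or infinite-dimensional) and $E$ a finite-dimensional Hilbert space. A two-operator commutative vessel is a collection $V=(A_1,A_2,H,\Phi,E,\sigma_1,\sigma_2,\gamma^{in},\gamma^{out})$, where $A_1,A_2$ are commuting bounded linear operators on $H$, $\Phi:H\to E$ is a bounded linear map with adjoint $\Phi^*:E\to H$, and $\sigma_1,\sigma_2,\gamma^{in},\gamma^{out}$ are bounded selfadjoint operators on $E$, such that $$\Phi^*\sigma_k\Phi=\tfrac1i(A_k-A_k^* )\quad(k=1,2),$$ $$\gamma^{in}\Phi=\sigma_1\Phi A_2^*-\sigma_2\Phi A_1^*,\qquad \gamma^{out}\Phi=\sigma_1\Phi A_2-\sigma_2\Phi A_1,$$ $$\gamma^{out}=\gamma^{in}+i(\sigma_1\Phi\Phi^*\sigma_2-\sigma_2\Phi\Phi^*\sigma_1).$$ Its discriminant polynomial is $\Delta(y_1,y_2)=\det(y_1\sigma_2-y_2\sigma_1+\gamma^{in})$, and it equals $\det(y_1\sigma_2-y_2\sigma_1+\gamma^{out})$. The zero set of the discriminant polynomial in $\mathbb{C}^2$ is the discriminant variety, called the discriminant curve $C$ when $\Delta$ is irreducible. Put $m=\dim E$, identify $E$ with $\mathbb{C}^m$, and put $\Delta(x_0,x_1,x_2)=\det(x_0\gamma^{in}+x_1\sigma_2-x_2\sigma_1)$, a homogeneous polynomial of degree $m$. The projective curve $\Delta(x_0,x_1,x_2)=0$ in $\mathbb{P}^2$ is also denoted $C$. It is assumed that $\Delta$ is irreducible (both as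 a polynomial in $y_1,y_2$ and as a homogeneous polynomial in $x_0,x_1,x_2$). **Birational isomorphism.** A rational mapping from $C$ to $C'$ is a birational isomorphism if it has a rational inverse; equivalently, it is one-to-one except at finitely many points. **Homogenization.** Let $n$ be the maximal degree of $p_0,p_1,p_2$, and let $P_k(x_0,x_1,x_2)=x_0^n p_k(x_1/x_0,x_2/x_0)$ be the homogenization of $p_k$ to degree $n$. **Principal subspace.** Let $W_n=\mathbb{C}^{m\,n(n+1)/2}$, whose elements are written $w=(w_{i_1,i_2})_{i_1,i_2\ge 0,\ i_1+i_2\le n-1}$ with $w_{i_1,i_2}\in\mathbb{C}^m=E$. Equivalently the index is $i=(i_0,i_1,i_2)$ with $|i|=i_0+i_1+i_2=n-1$. The principal subspace is $$V_n=\{w\in W_n:\ \sigma_2w_{i_1+1,i_2}-\sigma_1w_{i_1,i_2+1}+\gamma^{in}w_{i_1,i_2}=0\ \text{ for all } i_1,i_2\ge0,\ i_1+i_2\le n-2\}.$$ **Generalized Bezout matrices.** For homogeneous polynomials $p,q$ of degree $n$ in three variables there exist symmetric $\frac{n(n+1)}2\times\frac{n(n+1)}2$ matrices $\beta^{10}=(b^{10}_{ij})$, $\beta^{20}=(b^{20}_{ij})$, $\beta^{12}=(b^{12}_{ij})$, indexed by multi-indices $i,j$ with $|i|=|j|=n-1$, such that $$p(x)q(y)-q(x)p(y)=\sum_{|i|=|j|=n-1}\Big[b^{10}_{ij}x^i(x_1y_0-x_0y_1)y^j+b^{20}_{ij}x^i(x_2y_0-x_0y_2)y^j+b^{12}_{ij}x^i(x_1y_2-x_2y_1)y^j\Big].$$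 Put $B(p,q)=\beta^{12}\otimes\gamma^{in}+\beta^{10}\otimes\sigma_1+\beta^{20}\otimes\sigma_2$ on $W_n$, and let $B'(p,q)=\mathcal{P}_{V_n}B(p,q)\mathcal{P}_{V_n}$, regarded as an operator on $V_n$, where $\mathcal{P}_{V_n}$ is the orthogonal projection of $W_n$ onto $V_n$. **The data of $V'$.** $$E'=V_n,\qquad \Phi'=\mathcal{P}_{E'}\big(\Phi A_1^{*i_1}A_2^{*i_2}\,p_0(A_1^*,A_2^* )^{-1}\big)_{i_1+i_2\le n-1}:H\to E',$$ $$\sigma'_1=B'(P_1,P_0),\quad \sigma'_2=B'(P_2,P_0),\quad \gamma'^{in}=B'(P_1,P_2),$$ $$\gamma'^{out}=\gamma'^{in}+i(\sigma'_1\Phi'\Phi'^*\sigma'_2-\sigma'_2\Phi'\Phi'^*\sigma'_1).$$ **The data of $V''$.** For $x=(x_0,x_1,x_2)\in C\subset\mathbb{P}^2$ and $e\in\ker(x_0\gamma^{in}+x_1\sigma_2-x_2\sigma_1)$, the Vandermonde vector is $V_n(x,e)=(x_0^{i_0}x_1^{i_1}x_2^{i_2}e)_{i_0+i_1+i_2=n-1}\in V_n$. A basepoint of $r$ on $C$ is a point $x\in C$ with $P_0(x)=P_1(x)=P_2(x)=0$. Let $E''$ be the orthogonal complement in $V_n$ of the span of all Vandermonde vectors $V_n(x,e)$ with $x$ a basepoint on $C$ and $e\in\ker(x_0\gamma^{in}+x_1\sigma_2-x_2\sigma_1)$. Let $\mathcal{P}_{E''}$ be the orthogonal projection onto $E''$,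 and define (as operators into, respectively on, $E''$) $$\Phi''=\mathcal{P}_{E''}\Phi',\quad \sigma''_k=\mathcal{P}_{E''}\sigma'_k\mathcal{P}_{E''}\ (k=1,2),\quad \gamma''^{in}=\mathcal{P}_{E''}\gamma'^{in}\mathcal{P}_{E''},\quad \gamma''^{out}=\mathcal{P}_{E''}\gamma'^{out}\mathcal{P}_{E''}.$$ *)

theory Defs
  imports
    Complex_Main
    "HOL-Analysis.L2_Norm"
    "HOL-Computational_Algebra.Polynomial_Factorial"
    "Jordan_Normal_Form.Determinant"
begin

section \<open>Complex inner product spaces and Hilbert spaces\<close>

text \<open>
  The inner product is linear in its first argument. Positive definiteness is a consequence of
  the axiom relating the inner product to the norm.
\<close>

class complex_inner = real_normed_vector +
  fixes scaleC :: "complex \<Rightarrow> 'a \<Rightarrow> 'a"  (infixr \<open>*\<^sub>C\<close> 75)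
    and cinner :: "'a \<Rightarrow> 'a \<Rightarrow> complex"
  assumes scaleC_add_right: "a *\<^sub>C (x + y) = a *\<^sub>C x + a *\<^sub>C y"
    and scaleC_add_left: "(a + b) *\<^sub>C x = a *\<^sub>C x + b *\<^sub>C x"
    and scaleC_scaleC: "a *\<^sub>C (b *\<^sub>C x) = (a * b) *\<^sub>C x"
    and scaleR_scaleC: "scaleR r x = complex_of_real r *\<^sub>C x"
    and cinner_commute: "cinner x y = cnj (cinner y x)"
    and cinner_add_left: "cinner (x + y) z = cinner x z + cinner y z"
    and cinner_scaleC_left: "cinner (a *\<^sub>C x) y = a * cinner x y"
    and norm_eq_sqrt_cinner: "norm x = sqrt (Re (cinner x x))"

class complex_hilbert = complex_inner + complete_space

lemma scaleC_one: "1 *\<^sub>C x = (x :: 'a :: complex_inner)"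
  using scaleR_scaleC[of 1 x] by simp

global_interpretation complex_vector: vector_space "scaleC :: complex \<Rightarrow> 'a \<Rightarrow> 'a :: complex_inner"
  defines csubspace = complex_vector.subspace
    and cspan = complex_vector.span
  by unfold_locales (simp_all add: scaleC_add_right scaleC_add_left scaleC_scaleC scaleC_one)

lemma cinner_zero_left: "cinner 0 (y :: 'a :: complex_inner) = 0"
  using cinner_add_left[of 0 0 y] by simp

lemma cinner_self: "cinner x x = complex_of_real ((norm (x :: 'a :: complex_inner))\<^sup>2)"
proof (rule complex_eqI)
  have "Re (cinner x x) \<ge> 0"
    using norm_ge_zero[of x] by (simp add: norm_eq_sqrt_cinner)
  then show "Re (cinner x x) = Re (complex_of_real ((norm x)\<^sup>2))"
    by (simp add: norm_eq_sqrt_cinner)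
  show "Im (cinner x x) = Im (complex_of_real ((norm x)\<^sup>2))"
    using arg_cong[OF cinner_commute[of x x], of Im] by simp
qed


section \<open>Operators\<close>

definition bounded_clinear :: "('a::complex_inner \<Rightarrow> 'b::complex_inner) \<Rightarrow> bool" where
  "bounded_clinear F \<longleftrightarrow> bounded_linear F \<and> (\<forall>c x. F (c *\<^sub>C x) = c *\<^sub>C F x)"

definition cadjoint :: "('a::complex_inner \<Rightarrow> 'b::complex_inner) \<Rightarrow> 'b \<Rightarrow> 'a" where
  "cadjoint F = (SOME G. \<forall>x y. cinner (F x) y = cinner x (G y))"

definition boundedly_invertible :: "('a::complex_inner \<Rightarrow> 'a) \<Rightarrow> bool" where
  "boundedly_invertible T \<longleftrightarrow> (\<exists>S. bounded_clinear S \<and> S \<circ> T = id \<and> T \<circ> S = id)"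

definition fin_dim :: "'a::complex_inner set \<Rightarrow> bool" where
  "fin_dim S \<longleftrightarrow> csubspace S \<and> (\<exists>B. finite B \<and> cspan B = S)"

definition selfadjoint_on :: "'a::complex_inner set \<Rightarrow> ('a \<Rightarrow> 'a) \<Rightarrow> bool" where
  "selfadjoint_on S T \<longleftrightarrow>
     (\<forall>u\<in>S. T u \<in> S) \<and>
     (\<forall>u\<in>S. \<forall>v\<in>S. T (u + v) = T u + T v) \<and>
     (\<forall>c. \<forall>u\<in>S. T (c *\<^sub>C u) = c *\<^sub>C T u) \<and>
     (\<forall>u\<in>S. \<forall>v\<in>S. cinner (T u) v = cinner u (T v))"

definition proj :: "'a::complex_inner set \<Rightarrow> 'a \<Rightarrow> 'a" where
  "proj S v = (THE u. u \<in> S \<and> (\<forall>s\<in>S. cinner (v - u) s = 0))"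

definition orthonormal_basis :: "'a::complex_inner set \<Rightarrow> 'a list \<Rightarrow> bool" where
  "orthonormal_basis S bs \<longleftrightarrow> cspan (set bs) = S \<and>
     (\<forall>i<length bs. \<forall>j<length bs. cinner (bs ! i) (bs ! j) = (if i = j then 1 else 0))"

text \<open>
  The determinant of an operator on a finite-dimensional space \<open>S\<close> is that of its matrix in any
  orthonormal basis. The basis chosen here depends on \<open>S\<close> only, so operators on the same space
  are represented in the same basis.
\<close>

definition op_matrix :: "'a::complex_inner set \<Rightarrow> ('a \<Rightarrow> 'a) \<Rightarrow> complex mat" where
  "op_matrix S T = (let bs = (SOME bs. orthonormal_basis S bs) in
     mat (length bs) (length bs) (\<lambda>(i, j). cinner (T (bs ! j)) (bs ! i)))"

definition op_det :: "'a::complex_inner set \<Rightarrow> ('a \<Rightarrow> 'a) \<Rightarrow> complex" where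
  "op_det S T = Determinant.det (op_matrix S T)"


section \<open>Vessels\<close>

text \<open>
  The external space is a finite-dimensional subspace \<open>E\<close> of an ambient inner product space.
  The adjoint of \<open>\<Phi> : H \<rightarrow> E\<close> is the restriction to \<open>E\<close> of the adjoint of \<open>\<Phi>\<close> as a map into
  the ambient space, and the operators on \<open>E\<close> only matter through their values on \<open>E\<close>.
\<close>

definition commutative_vessel ::
  "('h::complex_hilbert \<Rightarrow> 'h) \<Rightarrow> ('h \<Rightarrow> 'h) \<Rightarrow> ('h \<Rightarrow> 'e::complex_inner) \<Rightarrow> 'e set \<Rightarrow>
   ('e \<Rightarrow> 'e) \<Rightarrow> ('e \<Rightarrow> 'e) \<Rightarrow> ('e \<Rightarrow> 'e) \<Rightarrow> ('e \<Rightarrow> 'e) \<Rightarrow> bool" where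
  "commutative_vessel A1 A2 \<Phi> E \<sigma>1 \<sigma>2 \<gamma>in \<gamma>out \<longleftrightarrow>
     bounded_clinear A1 \<and> bounded_clinear A2 \<and> A1 \<circ> A2 = A2 \<circ> A1 \<and>
     fin_dim E \<and> bounded_clinear \<Phi> \<and> range \<Phi> \<subseteq> E \<and>
     selfadjoint_on E \<sigma>1 \<and> selfadjoint_on E \<sigma>2 \<and>
     selfadjoint_on E \<gamma>in \<and> selfadjoint_on E \<gamma>out \<and>
     (\<forall>h. cadjoint \<Phi> (\<sigma>1 (\<Phi> h)) = (1 / \<i>) *\<^sub>C (A1 h - cadjoint A1 h)) \<and>
     (\<forall>h. cadjoint \<Phi> (\<sigma>2 (\<Phi> h)) = (1 / \<i>) *\<^sub>C (A2 h - cadjoint A2 h)) \<and>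
     (\<forall>h. \<gamma>in (\<Phi> h) = \<sigma>1 (\<Phi> (cadjoint A2 h)) - \<sigma>2 (\<Phi> (cadjoint A1 h))) \<and>
     (\<forall>h. \<gamma>out (\<Phi> h) = \<sigma>1 (\<Phi> (A2 h)) - \<sigma>2 (\<Phi> (A1 h))) \<and>
     (\<forall>e\<in>E. \<gamma>out e = \<gamma>in e
        + \<i> *\<^sub>C (\<sigma>1 (\<Phi> (cadjoint \<Phi> (\<sigma>2 e))) - \<sigma>2 (\<Phi> (cadjoint \<Phi> (\<sigma>1 e)))))"


section \<open>Polynomials and plane curves\<close>

text \<open>
  A polynomial in \<open>y\<^sub>1, y\<^sub>2\<close> is an element of \<open>R[y\<^sub>1][y\<^sub>2]\<close>: the coefficient of \<open>y\<^sub>1^i y\<^sub>2^j\<close> in \<open>F\<close> is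
  \<open>coeff (coeff F j) i\<close>. Likewise a polynomial in \<open>x\<^sub>0, x\<^sub>1, x\<^sub>2\<close> is an element of
  \<open>R[x\<^sub>0][x\<^sub>1][x\<^sub>2]\<close>.
\<close>

definition eval2 :: "complex poly poly \<Rightarrow> complex \<times> complex \<Rightarrow> complex" where
  "eval2 F = (\<lambda>(y1, y2). poly (poly F [:y2:]) y1)"

definition complexify :: "real poly poly \<Rightarrow> complex poly poly" where
  "complexify p = map_poly (map_poly complex_of_real) p"

definition total_degree :: "real poly poly \<Rightarrow> nat" where
  "total_degree p = Max (insert 0 {i + j | i j. coeff (coeff p j) i \<noteq> 0})"

definition op_poly :: "real poly poly \<Rightarrow> ('h::complex_inner \<Rightarrow> 'h) \<Rightarrow> ('h \<Rightarrow> 'h) \<Rightarrow> 'h \<Rightarrow> 'h" where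
  "op_poly p A1 A2 h =
     (\<Sum>j\<le>degree p. \<Sum>i\<le>degree (coeff p j). coeff (coeff p j) i *\<^sub>R (A1 ^^ i) ((A2 ^^ j) h))"

text \<open>The homogenization of \<open>p\<close> to degree \<open>n\<close>, as a function on \<open>\<complex>\<^sup>3\<close>.\<close>

definition homogenize :: "nat \<Rightarrow> real poly poly \<Rightarrow> complex \<times> complex \<times> complex \<Rightarrow> complex" where
  "homogenize n p = (\<lambda>(x0, x1, x2).
     \<Sum>(i, j)\<in>{(i, j). i + j \<le> n}.
       complex_of_real (coeff (coeff p j) i) * x0 ^ (n - (i + j)) * x1 ^ i * x2 ^ j)"

text \<open>The polynomials \<open>det (y\<^sub>1 \<sigma>\<^sub>2 - y\<^sub>2 \<sigma>\<^sub>1 + \<gamma>)\<close> and \<open>det (x\<^sub>0 \<gamma> + x\<^sub>1 \<sigma>\<^sub>2 - x\<^sub>2 \<sigma>\<^sub>1)\<close>.\<close>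

definition discriminant_poly ::
  "'e::complex_inner set \<Rightarrow> ('e \<Rightarrow> 'e) \<Rightarrow> ('e \<Rightarrow> 'e) \<Rightarrow> ('e \<Rightarrow> 'e) \<Rightarrow> complex poly poly" where
  "discriminant_poly E \<sigma>1 \<sigma>2 \<gamma> =
     (let M = (\<lambda>T. map_mat (\<lambda>c. [:[:c:]:]) (op_matrix E T)) in
      Determinant.det ([:[:0, 1:]:] \<cdot>\<^sub>m M \<sigma>2 - [:0, 1:] \<cdot>\<^sub>m M \<sigma>1 + M \<gamma>))"

definition homogeneous_discriminant_poly ::
  "'e::complex_inner set \<Rightarrow> ('e \<Rightarrow> 'e) \<Rightarrow> ('e \<Rightarrow> 'e) \<Rightarrow> ('e \<Rightarrow> 'e) \<Rightarrow> complex poly poly poly" where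
  "homogeneous_discriminant_poly E \<sigma>1 \<sigma>2 \<gamma> =
     (let M = (\<lambda>T. map_mat (\<lambda>c. [:[:[:c:]:]:]) (op_matrix E T)) in
      Determinant.det ([:[:[:0, 1:]:]:] \<cdot>\<^sub>m M \<gamma> + [:[:0, 1:]:] \<cdot>\<^sub>m M \<sigma>2 - [:0, 1:] \<cdot>\<^sub>m M \<sigma>1))"

definition discriminant_variety ::
  "'e::complex_inner set \<Rightarrow> ('e \<Rightarrow> 'e) \<Rightarrow> ('e \<Rightarrow> 'e) \<Rightarrow> ('e \<Rightarrow> 'e) \<Rightarrow> (complex \<times> complex) set" where
  "discriminant_variety E \<sigma>1 \<sigma>2 \<gamma> =
     {(y1, y2). op_det E (\<lambda>e. y1 *\<^sub>C \<sigma>2 e - y2 *\<^sub>C \<sigma>1 e + \<gamma> e) = 0}"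

definition irreducible_plane_curve :: "(complex \<times> complex) set \<Rightarrow> bool" where
  "irreducible_plane_curve X \<longleftrightarrow>
     (\<exists>F :: complex poly poly. Factorial_Ring.irreducible F \<and> X = {y. eval2 F y = 0})"

text \<open>
  Rational mappings between irreducible affine curves. A polynomial that does not vanish
  identically on such a curve has only finitely many zeros on it, so the mapping
  \<open>(p\<^sub>1 / p\<^sub>0, p\<^sub>2 / p\<^sub>0)\<close> is required to be defined off a finite set, and an inverse is required to
  invert it off a finite set.
\<close>

definition quotient_map ::
  "complex poly poly \<Rightarrow> complex poly poly \<Rightarrow> complex poly poly \<Rightarrow> complex \<times> complex \<Rightarrow> complex \<times> complex"
  where
  "quotient_map p0 p1 p2 y = (eval2 p1 y / eval2 p0 y, eval2 p2 y / eval2 p0 y)"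

definition rational_mapping ::
  "(complex \<times> complex) set \<Rightarrow> (complex \<times> complex) set \<Rightarrow>
   complex poly poly \<Rightarrow> complex poly poly \<Rightarrow> complex poly poly \<Rightarrow> bool" where
  "rational_mapping X Y p0 p1 p2 \<longleftrightarrow>
     finite {x \<in> X. eval2 p0 x = 0} \<and>
     (\<forall>x\<in>X. eval2 p0 x \<noteq> 0 \<longrightarrow> quotient_map p0 p1 p2 x \<in> Y)"

definition rational_left_inverse ::
  "(complex \<times> complex) set \<Rightarrow>
   complex poly poly \<Rightarrow> complex poly poly \<Rightarrow> complex poly poly \<Rightarrow>
   complex poly poly \<Rightarrow> complex poly poly \<Rightarrow> complex poly poly \<Rightarrow> bool" where
  "rational_left_inverse X p0 p1 p2 q0 q1 q2 \<longleftrightarrow>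
     finite {x \<in> X. \<not> (eval2 p0 x \<noteq> 0 \<and> eval2 q0 (quotient_map p0 p1 p2 x) \<noteq> 0 \<and>
                       quotient_map q0 q1 q2 (quotient_map p0 p1 p2 x) = x)}"

definition birational_isomorphism ::
  "(complex \<times> complex) set \<Rightarrow> (complex \<times> complex) set \<Rightarrow>
   complex poly poly \<Rightarrow> complex poly poly \<Rightarrow> complex poly poly \<Rightarrow> bool" where
  "birational_isomorphism X Y p0 p1 p2 \<longleftrightarrow>
     rational_mapping X Y p0 p1 p2 \<and>
     (\<exists>q0 q1 q2. rational_mapping Y X q0 q1 q2 \<and>
        rational_left_inverse X p0 p1 p2 q0 q1 q2 \<and>
        rational_left_inverse Y q0 q1 q2 p0 p1 p2)"


section \<open>Finitely supported families\<close>

text \<open>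
  The ambient space of all the spaces \<open>W\<^sub>n\<close>, with the Euclidean inner product. (Finitely supported
  functions in the library carry the \<open>\<ell>\<^sup>1\<close> norm.)
\<close>

typedef (overloaded) ('i, 'a::zero) family = "{f :: 'i \<Rightarrow> 'a. finite {i. f i \<noteq> 0}}"
  morphisms component family_of
  by (rule exI[of _ "\<lambda>_. 0"]) simp

definition support :: "('i, 'a::zero) family \<Rightarrow> 'i set" where
  "support w = {i. component w i \<noteq> 0}"

lemma finite_support [simp]: "finite (support w)"
  using component[of w] by (simp add: support_def)

lemma finite_nonzero_components [simp]: "finite {i. component w i \<noteq> 0}"
  using component[of w] by simp

lemma component_eq_0: "i \<notin> support w \<Longrightarrow> component w i = 0"
  by (simp add: support_def)

lemma component_family_of: "finite {i. f i \<noteq> 0} \<Longrightarrow> component (family_of f) = f"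
  by (simp add: family_of_inverse)

lemma family_eqI: "(\<And>i. component v i = component w i) \<Longrightarrow> v = w"
  by (simp add: component_inject[symmetric] ext)

instantiation family :: (type, complex_inner) complex_inner
begin

definition zero_family :: "('a, 'b) family" where
  "0 = family_of (\<lambda>_. 0)"
definition plus_family :: "('a, 'b) family \<Rightarrow> ('a, 'b) family \<Rightarrow> ('a, 'b) family" where
  "v + w = family_of (\<lambda>i. component v i + component w i)"
definition minus_family :: "('a, 'b) family \<Rightarrow> ('a, 'b) family \<Rightarrow> ('a, 'b) family" where
  "v - w = family_of (\<lambda>i. component v i - component w i)"
definition uminus_family :: "('a, 'b) family \<Rightarrow> ('a, 'b) family" where
  "- w = family_of (\<lambda>i. - component w i)"
definition scaleR_family :: "real \<Rightarrow> ('a, 'b) family \<Rightarrow> ('a, 'b) family" where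
  "r *\<^sub>R w = family_of (\<lambda>i. r *\<^sub>R component w i)"
definition scaleC_family :: "complex \<Rightarrow> ('a, 'b) family \<Rightarrow> ('a, 'b) family" where
  "c *\<^sub>C w = family_of (\<lambda>i. c *\<^sub>C component w i)"
definition cinner_family :: "('a, 'b) family \<Rightarrow> ('a, 'b) family \<Rightarrow> complex" where
  "cinner v w = (\<Sum>i\<in>support v. cinner (component v i) (component w i))"
definition norm_family :: "('a, 'b) family \<Rightarrow> real" where
  "norm w = L2_set (\<lambda>i. norm (component w i)) (support w)"
definition sgn_family :: "('a, 'b) family \<Rightarrow> ('a, 'b) family" where
  "sgn (w :: ('a, 'b) family) = inverse (norm w) *\<^sub>R w"
definition dist_family :: "('a, 'b) family \<Rightarrow> ('a, 'b) family \<Rightarrow> real" where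
  "dist (v :: ('a, 'b) family) w = norm (v - w)"
definition uniformity_family :: "(('a, 'b) family \<times> ('a, 'b) family) filter" where
  "uniformity = (INF e\<in>{0<..}. principal {(v :: ('a, 'b) family, w). dist v w < e})"
definition open_family :: "('a, 'b) family set \<Rightarrow> bool" where
  "open (U :: ('a, 'b) family set) = (\<forall>w\<in>U. \<forall>\<^sub>F (w', v) in uniformity. w' = w \<longrightarrow> v \<in> U)"

lemma component_add: "component (v + w) i = component v i + component w i"
  for v w :: "('a, 'b) family"
  unfolding plus_family_def
  by (subst component_family_of, rule finite_subset[of _ "support v \<union> support w"])
     (auto simp: support_def)

lemma component_diff: "component (v - w) i = component v i - component w i"
  for v w :: "('a, 'b) family"
  unfolding minus_family_def
  by (subst component_family_of, rule finite_subset[of _ "support v \<union> support w"])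
     (auto simp: support_def)

lemma component_uminus: "component (- w) i = - component w i"
  for w :: "('a, 'b) family"
  unfolding uminus_family_def
  by (subst component_family_of, rule finite_subset[of _ "support w"]) (auto simp: support_def)

lemma component_zero: "component (0 :: ('a, 'b) family) i = 0"
  unfolding zero_family_def by (simp add: component_family_of)

lemma component_scaleR: "component (r *\<^sub>R w) i = r *\<^sub>R component w i"
  for w :: "('a, 'b) family"
  unfolding scaleR_family_def
  by (subst component_family_of, rule finite_subset[of _ "support w"]) (auto simp: support_def)

lemma component_scaleC: "component (c *\<^sub>C w) i = c *\<^sub>C component w i"
  for w :: "('a, 'b) family"
  unfolding scaleC_family_def
  by (subst component_family_of, rule finite_subset[of _ "support w"])
     (auto simp: support_def complex_vector.scale_zero_right)

lemma norm_family_superset: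
  fixes w :: "('a, 'b) family"
  assumes "finite S" "support w \<subseteq> S"
  shows "norm w = L2_set (\<lambda>i. norm (component w i)) S"
  unfolding norm_family_def L2_set_def
  by (intro arg_cong[of _ _ sqrt] sum.mono_neutral_left assms) (auto simp: support_def)

lemma cinner_family_superset:
  fixes v w :: "('a, 'b) family"
  assumes "finite S" "support v \<subseteq> S"
  shows "cinner v w = (\<Sum>i\<in>S. cinner (component v i) (component w i))"
  unfolding cinner_family_def
  by (intro sum.mono_neutral_left assms) (auto simp: support_def cinner_zero_left)

instance
proof
  fix u v w :: "('a, 'b) family" and r s :: real and a b :: complex
  show "u + v + w = u + (v + w)" "v + w = w + v" "0 + w = w" "- w + w = 0" "v - w = v + - w"
    by (rule family_eqI; simp add: component_add component_diff component_uminus component_zero)+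
  show "r *\<^sub>R (v + w) = r *\<^sub>R v + r *\<^sub>R w" "(r + s) *\<^sub>R w = r *\<^sub>R w + s *\<^sub>R w"
    "r *\<^sub>R s *\<^sub>R w = (r * s) *\<^sub>R w" "1 *\<^sub>R w = w"
    by (rule family_eqI; simp add: component_add component_scaleR algebra_simps)+
  show "dist v w = norm (v - w)" "sgn w = inverse (norm w) *\<^sub>R w"
    "uniformity = (INF e\<in>{0<..}. principal {(v :: ('a, 'b) family, w). dist v w < e})"
    by (fact dist_family_def sgn_family_def uniformity_family_def)+
  show "open U = (\<forall>w\<in>U. \<forall>\<^sub>F (w', v) in uniformity. w' = w \<longrightarrow> v \<in> U)"
    for U :: "('a, 'b) family set"
    by (fact open_family_def)
  show "norm w = 0 \<longleftrightarrow> w = 0"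
  proof
    assume "norm w = 0"
    then have "\<forall>i\<in>support w. component w i = 0"
      by (simp add: norm_family_def L2_set_eq_0_iff)
    then show "w = 0"
      by (intro family_eqI) (auto simp: component_zero support_def)
  next
    assume "w = 0"
    then show "norm w = 0"
      by (simp add: norm_family_def support_def component_zero)
  qed
  show "norm (v + w) \<le> norm v + norm w"
  proof -
    let ?S = "support v \<union> support w"
    have sub: "support (v + w) \<subseteq> ?S"
      by (auto simp: support_def component_add)
    have "norm (v + w) = L2_set (\<lambda>i. norm (component v i + component w i)) ?S"
      using sub by (subst norm_family_superset[of ?S]) (auto simp: component_add)
    also have "\<dots> \<le> L2_set (\<lambda>i. norm (component v i) + norm (component w i)) ?S"
      by (rule L2_set_mono) (auto intro: norm_triangle_ineq)
    also have "\<dots> \<le> L2_set (\<lambda>i. norm (component v i)) ?S + L2_set (\<lambda>i. norm (component w i)) ?S"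
      by (rule L2_set_triangle_ineq)
    also have "\<dots> = norm v + norm w"
      by (simp add: norm_family_superset[of ?S])
    finally show ?thesis .
  qed
  show "norm (r *\<^sub>R w) = \<bar>r\<bar> * norm w"
  proof -
    have "norm (r *\<^sub>R w) = L2_set (\<lambda>i. \<bar>r\<bar> * norm (component w i)) (support w)"
      by (subst norm_family_superset[of "support w"])
         (auto simp: support_def component_scaleR[abs_def] component_scaleR finite_support[unfolded support_def])
    then show ?thesis
      by (simp add: norm_family_def L2_set_right_distrib)
  qed
  show "a *\<^sub>C (v + w) = a *\<^sub>C v + a *\<^sub>C w" "(a + b) *\<^sub>C w = a *\<^sub>C w + b *\<^sub>C w"
    "a *\<^sub>C b *\<^sub>C w = (a * b) *\<^sub>C w" "r *\<^sub>R w = complex_of_real r *\<^sub>C w"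
    by (rule family_eqI;
        simp add: component_add component_scaleC component_scaleR scaleC_add_right scaleC_add_left
          scaleC_scaleC scaleR_scaleC)+
  show "cinner v w = cnj (cinner w v)"
  proof -
    let ?S = "support v \<union> support w"
    have "cinner v w = (\<Sum>i\<in>?S. cinner (component v i) (component w i))"
      by (rule cinner_family_superset) auto
    also have "\<dots> = (\<Sum>i\<in>?S. cnj (cinner (component w i) (component v i)))"
      by (rule sum.cong[OF refl]) (rule cinner_commute)
    also have "\<dots> = cnj (\<Sum>i\<in>?S. cinner (component w i) (component v i))"
      by simp
    also have "(\<Sum>i\<in>?S. cinner (component w i) (component v i)) = cinner w v"
      by (rule cinner_family_superset[symmetric]) auto
    finally show ?thesis .
  qed
  show "cinner (u + v) w = cinner u w + cinner v w"
  proof -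
    let ?S = "support u \<union> support v"
    have "support (u + v) \<subseteq> ?S"
      by (auto simp: support_def component_add)
    then show ?thesis
      by (simp add: cinner_family_superset[of ?S] component_add cinner_add_left sum.distrib)
  qed
  show "cinner (a *\<^sub>C v) w = a * cinner v w"
  proof -
    have "support (a *\<^sub>C v) \<subseteq> support v"
      by (auto simp: support_def component_scaleC complex_vector.scale_zero_right)
    then show ?thesis
      by (simp add: cinner_family_superset[of "support v"] component_scaleC cinner_scaleC_left
          sum_distrib_left)
  qed
  show "norm w = sqrt (Re (cinner w w))"
    by (simp add: norm_family_def L2_set_def cinner_family_def cinner_self)
qed

end


section \<open>Principal subspaces and generalized Bezout matrices\<close>

type_synonym multi_index = "nat \<times> nat \<times> nat"

definition multi_indices :: "nat \<Rightarrow> multi_index set" where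
  "multi_indices n = {(i0, i1, i2). i0 + i1 + i2 + 1 = n}"

definition monomial :: "complex \<times> complex \<times> complex \<Rightarrow> multi_index \<Rightarrow> complex" where
  "monomial = (\<lambda>(x0, x1, x2) (i0, i1, i2). x0 ^ i0 * x1 ^ i1 * x2 ^ i2)"

text \<open>
  \<open>W\<^sub>n\<close> consists of the families supported in \<^term>\<open>multi_indices n\<close>. The component written
  \<open>w\<^bsub>i\<^sub>1,i\<^sub>2\<^esub>\<close> in affine notation is the one at \<open>(n - 1 - i\<^sub>1 - i\<^sub>2, i\<^sub>1, i\<^sub>2)\<close>.
\<close>

definition tuple :: "nat \<Rightarrow> (multi_index \<Rightarrow> 'e) \<Rightarrow> (multi_index, 'e::complex_inner) family" where
  "tuple n f = family_of (\<lambda>i. if i \<in> multi_indices n then f i else 0)"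

definition principal_subspace ::
  "nat \<Rightarrow> ('e \<Rightarrow> 'e) \<Rightarrow> ('e \<Rightarrow> 'e) \<Rightarrow> ('e \<Rightarrow> 'e) \<Rightarrow> (multi_index, 'e::complex_inner) family set" where
  "principal_subspace n \<sigma>1 \<sigma>2 \<gamma> = {w. support w \<subseteq> multi_indices n \<and>
     (\<forall>i0 i1 i2. i0 + i1 + i2 + 2 = n \<longrightarrow>
        \<sigma>2 (component w (i0, i1 + 1, i2)) - \<sigma>1 (component w (i0, i1, i2 + 1))
          + \<gamma> (component w (i0 + 1, i1, i2)) = 0)}"

type_synonym bezout_matrices =
  "(multi_index \<Rightarrow> multi_index \<Rightarrow> complex) \<times> (multi_index \<Rightarrow> multi_index \<Rightarrow> complex) \<times>
   (multi_index \<Rightarrow> multi_index \<Rightarrow> complex)"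

text \<open>Such matrices \<open>(\<beta>\<^sup>1\<^sup>0, \<beta>\<^sup>2\<^sup>0, \<beta>\<^sup>1\<^sup>2)\<close> exist but are not uniquely determined by \<open>p\<close> and \<open>q\<close>.\<close>

definition is_bezout_matrices ::
  "nat \<Rightarrow> (complex \<times> complex \<times> complex \<Rightarrow> complex) \<Rightarrow> (complex \<times> complex \<times> complex \<Rightarrow> complex) \<Rightarrow>
   bezout_matrices \<Rightarrow> bool" where
  "is_bezout_matrices n p q = (\<lambda>(b10, b20, b12).
     (\<forall>i\<in>multi_indices n. \<forall>j\<in>multi_indices n.
        b10 i j = b10 j i \<and> b20 i j = b20 j i \<and> b12 i j = b12 j i) \<and>
     (\<forall>x0 x1 x2 y0 y1 y2. let x = (x0, x1, x2); y = (y0, y1, y2) in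
        p x * q y - q x * p y =
        (\<Sum>i\<in>multi_indices n. \<Sum>j\<in>multi_indices n.
           b10 i j * monomial x i * (x1 * y0 - x0 * y1) * monomial y j +
           b20 i j * monomial x i * (x2 * y0 - x0 * y2) * monomial y j +
           b12 i j * monomial x i * (x1 * y2 - x2 * y1) * monomial y j)))"

text \<open>The operator \<open>\<beta>\<^sup>1\<^sup>2 \<otimes> \<gamma> + \<beta>\<^sup>1\<^sup>0 \<otimes> \<sigma>\<^sub>1 + \<beta>\<^sup>2\<^sup>0 \<otimes> \<sigma>\<^sub>2\<close> on \<open>W\<^sub>n\<close>.\<close>

definition bezout_operator ::
  "nat \<Rightarrow> ('e \<Rightarrow> 'e) \<Rightarrow> ('e \<Rightarrow> 'e) \<Rightarrow> ('e \<Rightarrow> 'e) \<Rightarrow> bezout_matrices \<Rightarrow>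
   (multi_index, 'e::complex_inner) family \<Rightarrow> (multi_index, 'e) family" where
  "bezout_operator n \<sigma>1 \<sigma>2 \<gamma> = (\<lambda>(b10, b20, b12) w. tuple n (\<lambda>i.
     \<Sum>j\<in>multi_indices n. b12 i j *\<^sub>C \<gamma> (component w j)
       + b10 i j *\<^sub>C \<sigma>1 (component w j) + b20 i j *\<^sub>C \<sigma>2 (component w j)))"

definition compression :: "'a::complex_inner set \<Rightarrow> ('a \<Rightarrow> 'a) \<Rightarrow> 'a \<Rightarrow> 'a" where
  "compression S T = proj S \<circ> T \<circ> proj S"

definition vandermonde ::
  "nat \<Rightarrow> complex \<times> complex \<times> complex \<Rightarrow> 'e \<Rightarrow> (multi_index, 'e::complex_inner) family" where
  "vandermonde n x e = tuple n (\<lambda>i. monomial x i *\<^sub>C e)"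

definition pencil ::
  "('e \<Rightarrow> 'e) \<Rightarrow> ('e \<Rightarrow> 'e) \<Rightarrow> ('e \<Rightarrow> 'e) \<Rightarrow> complex \<times> complex \<times> complex \<Rightarrow> 'e \<Rightarrow> 'e::complex_inner" where
  "pencil \<sigma>1 \<sigma>2 \<gamma> = (\<lambda>(x0, x1, x2) e. x0 *\<^sub>C \<gamma> e + x1 *\<^sub>C \<sigma>2 e - x2 *\<^sub>C \<sigma>1 e)"

text \<open>
  A point of the projective plane is given by its nonzero coordinate vectors; the conditions below
  and the line spanned by a Vandermonde vector do not depend on the choice of the coordinates.
\<close>

definition projective_curve ::
  "('e \<Rightarrow> 'e) \<Rightarrow> ('e \<Rightarrow> 'e) \<Rightarrow> ('e \<Rightarrow> 'e::complex_inner) \<Rightarrow> (complex \<times> complex \<times> complex) set" where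
  "projective_curve \<sigma>1 \<sigma>2 \<gamma> = {x. x \<noteq> (0, 0, 0) \<and> op_det UNIV (pencil \<sigma>1 \<sigma>2 \<gamma> x) = 0}"

definition basepoint_vectors ::
  "nat \<Rightarrow> ('e \<Rightarrow> 'e) \<Rightarrow> ('e \<Rightarrow> 'e) \<Rightarrow> ('e \<Rightarrow> 'e) \<Rightarrow>
   (complex \<times> complex \<times> complex \<Rightarrow> complex) \<Rightarrow> (complex \<times> complex \<times> complex \<Rightarrow> complex) \<Rightarrow>
   (complex \<times> complex \<times> complex \<Rightarrow> complex) \<Rightarrow> (multi_index, 'e::complex_inner) family set" where
  "basepoint_vectors n \<sigma>1 \<sigma>2 \<gamma> P0 P1 P2 =
     {vandermonde n x e | x e. x \<in> projective_curve \<sigma>1 \<sigma>2 \<gamma> \<and>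
        P0 x = 0 \<and> P1 x = 0 \<and> P2 x = 0 \<and> pencil \<sigma>1 \<sigma>2 \<gamma> x e = 0}"

definition orthogonal_complement_in :: "'a::complex_inner set \<Rightarrow> 'a set \<Rightarrow> 'a set" where
  "orthogonal_complement_in S U = {v \<in> S. \<forall>u\<in>U. cinner v u = 0}"

end

theory Submission
  imports Defs
    "HOL-Computational_Algebra.Field_as_Ring"
    "HOL-Computational_Algebra.Fundamental_Theorem_Algebra"
begin

text \<open>
  Everything is tested against Vandermonde vectors at generic points of the curve \<open>C\<close>. They determine
  the vectors of the principal subspace \<open>V\<^sub>n\<close> (\<open>vandermonde_complete\<close>): if \<open>u\<close> is orthogonal to all of
  them, the row \<open>f\<close> of forms of degree \<open>n - 1\<close> whose coefficients are the conjugate coordinates of \<open>u\<close>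
  vanishes, at each point of the cone over infinitely many points of \<open>C\<close>, on the kernel of the pencil
  \<open>M = x\<^sub>0 \<gamma> + x\<^sub>1 \<sigma>\<^sub>2 - x\<^sub>2 \<sigma>\<^sub>1\<close>. There the columns of the adjugate of \<open>M\<close> lie in that kernel, so the
  irreducible polynomial \<open>\<Delta> = det M\<close> divides \<open>f adj M\<close>, and multiplication by \<open>M\<close> gives \<open>f = g M\<close> with
  a polynomial row \<open>g\<close>. Comparing coefficients, \<open>u\<close> lies in the range of the adjoint of the map whose
  kernel is \<open>V\<^sub>n\<close>; hence \<open>u\<close> is orthogonal to itself. The divisibility is a matter of eliminating one
  variable (\<open>irreducible_dvd_if_vanishes_on_cone\<close>).

  The pairing of the Bezout operator of \<open>p, q\<close> is computable on such vectors. For kernel vectors \<open>e\<close>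
  at \<open>x\<close> and \<open>f\<close> at \<open>y\<close> the triple \<open>(\<langle>\<gamma> e, f\<rangle>, \<langle>\<sigma>\<^sub>2 e, f\<rangle>, - \<langle>\<sigma>\<^sub>1 e, f\<rangle>)\<close> is orthogonal to \<open>x\<close> and to the
  conjugate \<open>w\<close> of \<open>y\<close>, so it is \<open>c\<close> times their cross product, and the pairing of the two
  Vandermonde vectors is \<open>c (p(x) q(w) - q(x) p(w))\<close> (\<open>vandermonde_pairing\<close>). This gives at once that
  the compressions to \<open>V\<^sub>n\<close> are selfadjoint, that they annihilate the Vandermonde vectors at
  basepoints, and that the Vandermonde vectors at \<open>x\<close> are in the kernel of the transformed pencil
  at \<open>r(x)\<close>. The last holds because, with \<open>a\<^sub>k = p\<^sub>k(x)\<close> and \<open>b\<^sub>k = p\<^sub>k(w)\<close>,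
  \<open>a\<^sub>1 (a\<^sub>2 b\<^sub>0 - a\<^sub>0 b\<^sub>2) - a\<^sub>2 (a\<^sub>1 b\<^sub>0 - a\<^sub>0 b\<^sub>1) + a\<^sub>0 (a\<^sub>1 b\<^sub>2 - a\<^sub>2 b\<^sub>1) = 0\<close>.

  The vessel conditions follow in the same way, with one or both of the points replaced by the pair of
  adjoints \<open>T\<^sub>k = A\<^sub>k\<^sup>*\<close>; a polynomial identity between monomials remains true for arbitrary moments in
  their place (\<open>bezout_moments\<close>). For the colligation conditions both points become operators. For
  the input linkage condition, the defect at \<open>h\<close> paired with a Vandermonde vector at \<open>y\<close> is a
  bounded functional of \<open>h\<close> that \<open>T\<^sub>1\<close> and \<open>T\<^sub>2\<close> multiply by the conjugates of \<open>y\<^sub>1\<close> and \<open>y\<^sub>2\<close>, so it is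
  zero when \<open>y\<close> is large; since the affine part of \<open>C\<close> is unbounded, the defect vanishes (\<open>linkage'\<close>).

  The coefficients annihilate the span \<open>U\<close> of the basepoint vectors, and being selfadjoint they
  are reduced by its complement \<open>E''\<close>, so the vessel conditions pass to \<open>E''\<close>. Finally \<open>E''\<close> is
  nonzero, for otherwise all factors \<open>c\<close> would vanish at pairs of points separated by \<open>r\<close>; a nonzero
  vector of \<open>E''\<close> shows that the projected Vandermonde vectors are nonzero at all but finitely many
  points, so the new discriminant polynomial vanishes at infinitely many points of the irreducible
  curve \<open>C'\<close>, hence on \<open>C'\<close> (\<open>curve_subset_discriminant_variety\<close>).
\<close>

section \<open>Complex inner product spaces\<close>

lemma cinner_add_right: "cinner x (y + z) = cinner x y + cinner x (z :: 'a::complex_inner)"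
  by (metis cinner_add_left cinner_commute complex_cnj_add)

lemma cinner_scaleC_right: "cinner x (a *\<^sub>C y) = cnj a * cinner x (y :: 'a::complex_inner)"
  by (metis cinner_scaleC_left cinner_commute complex_cnj_mult)

lemma cinner_zero_right: "cinner x (0 :: 'a::complex_inner) = 0"
  by (metis cinner_zero_left cinner_commute complex_cnj_zero)

lemma cinner_minus_left: "cinner (- x) y = - cinner x (y :: 'a::complex_inner)"
  using cinner_scaleC_left[of "-1" x y] by (simp add: scaleC_one)

lemma cinner_minus_right: "cinner x (- y) = - cinner x (y :: 'a::complex_inner)"
  using cinner_scaleC_right[of x "-1" y] by (simp add: scaleC_one)

lemma cinner_diff_left: "cinner (x - y) z = cinner x z - cinner y (z :: 'a::complex_inner)"
  using cinner_add_left[of x "- y" z] by (simp add: cinner_minus_left)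

lemma cinner_diff_right: "cinner x (y - z) = cinner x y - cinner x (z :: 'a::complex_inner)"
  using cinner_add_right[of x y "- z"] by (simp add: cinner_minus_right)

lemma cinner_sum_left: "cinner (\<Sum>i\<in>I. f i) (y :: 'a::complex_inner) = (\<Sum>i\<in>I. cinner (f i) y)"
  by (induction I rule: infinite_finite_induct) (simp_all add: cinner_add_left cinner_zero_left)

lemma cinner_sum_right: "cinner (y :: 'a::complex_inner) (\<Sum>i\<in>I. f i) = (\<Sum>i\<in>I. cinner y (f i))"
  by (induction I rule: infinite_finite_induct) (simp_all add: cinner_add_right cinner_zero_right)

lemma cinner_scaleR_left: "cinner (r *\<^sub>R x) y = complex_of_real r * cinner x (y :: 'a::complex_inner)"
  by (simp add: scaleR_scaleC cinner_scaleC_left)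

lemma cinner_scaleR_right: "cinner x (r *\<^sub>R y) = complex_of_real r * cinner x (y :: 'a::complex_inner)"
  by (simp add: scaleR_scaleC cinner_scaleC_right)

lemmas cinner_linear_simps = cinner_add_left cinner_add_right cinner_scaleC_left cinner_scaleC_right
  cinner_zero_left cinner_zero_right cinner_minus_left cinner_minus_right
  cinner_diff_left cinner_diff_right cinner_sum_left cinner_sum_right

lemma cinner_self_eq_0_iff: "cinner x x = 0 \<longleftrightarrow> x = (0 :: 'a::complex_inner)"
  by (simp add: cinner_self)

lemma cinner_ext:
  fixes x y :: "'a::complex_inner"
  assumes "\<And>z. cinner x z = cinner y z" shows "x = y"
  using assms[of "x - y"] by (metis cinner_diff_left cinner_self_eq_0_iff eq_iff_diff_eq_0)

lemma cinner_ext_right: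
  fixes x y :: "'a::complex_inner"
  assumes "\<And>z. cinner z x = cinner z y" shows "x = y"
  by (rule cinner_ext) (metis assms cinner_commute)

lemma norm_add_squared:
  "(norm (x + y))\<^sup>2 = (norm x)\<^sup>2 + 2 * Re (cinner x y) + (norm (y :: 'a::complex_inner))\<^sup>2"
proof -
  have "Re (cinner y x) = Re (cinner x y)"
    by (subst cinner_commute) simp
  moreover have "Re (cinner (x + y) (x + y)) = (norm (x + y))\<^sup>2"
    by (simp add: cinner_self)
  ultimately show ?thesis
    by (simp add: cinner_add_left cinner_add_right cinner_self[of x] cinner_self[of y])
qed

lemma norm_scaleC: "norm (a *\<^sub>C x) = cmod a * norm (x :: 'a::complex_inner)"
proof -
  have "complex_of_real ((norm (a *\<^sub>C x))\<^sup>2) = complex_of_real ((cmod a * norm x)\<^sup>2)"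
  proof -
    have "complex_of_real ((norm (a *\<^sub>C x))\<^sup>2) = (a * cnj a) * cinner x x"
      unfolding cinner_self[symmetric] by (simp add: cinner_scaleC_left cinner_scaleC_right)
    then show ?thesis
      by (simp add: complex_norm_square[symmetric] cinner_self power_mult_distrib)
  qed
  then show ?thesis
    by (simp only: of_real_eq_iff) (simp add: power2_eq_iff_nonneg)
qed

text \<open>The triangle inequality, which is part of the definition of a norm, already bounds the real
  part of an inner product; a rotation of one argument gives the modulus.\<close>

lemma cauchy_schwarz: "cmod (cinner x y) \<le> norm x * norm (y :: 'a::complex_inner)"
proof -
  have re: "Re (cinner u v) \<le> norm u * norm v" for u v :: 'a
  proof -
    have "(norm (u + v))\<^sup>2 \<le> (norm u + norm v)\<^sup>2"
      by (simp add: norm_triangle_ineq power_mono)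
    then show ?thesis
      unfolding norm_add_squared by (simp add: power2_sum)
  qed
  show ?thesis
  proof (cases "cinner x y = 0")
    case False
    define a where "a = cnj (cinner x y) / complex_of_real (cmod (cinner x y))"
    have a1: "cmod a = 1"
      using False by (simp add: a_def norm_divide)
    have "cinner (a *\<^sub>C x) y = complex_of_real (cmod (cinner x y))"
    proof -
      have "cinner (a *\<^sub>C x) y = (cinner x y * cnj (cinner x y)) / complex_of_real (cmod (cinner x y))"
        by (simp add: a_def cinner_scaleC_left)
      also have "\<dots> = complex_of_real (cmod (cinner x y))"
        using False by (simp add: complex_norm_square[symmetric] power2_eq_square)
      finally show ?thesis .
    qed
    then have "cmod (cinner x y) \<le> norm (a *\<^sub>C x) * norm y"
      using re[of "a *\<^sub>C x" y] by simp
    then show ?thesis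
      by (simp add: norm_scaleC a1)
  qed simp
qed

subsection \<open>Linear maps\<close>

definition clinear :: "('a::complex_inner \<Rightarrow> 'b::complex_inner) \<Rightarrow> bool" where
  "clinear F \<longleftrightarrow> (\<forall>x y. F (x + y) = F x + F y) \<and> (\<forall>c x. F (c *\<^sub>C x) = c *\<^sub>C F x)"

lemma clinear_add: "clinear F \<Longrightarrow> F (x + y) = F x + F y"
  and clinear_scaleC: "clinear F \<Longrightarrow> F (c *\<^sub>C x) = c *\<^sub>C F x"
  by (simp_all add: clinear_def)

lemma clinear_zero: "clinear F \<Longrightarrow> F 0 = 0"
  by (metis clinear_scaleC complex_vector.scale_zero_left)

lemma clinear_minus: "clinear F \<Longrightarrow> F (- x) = - F x"
  using clinear_scaleC[of F "-1" x] by (simp add: scaleC_one)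

lemma clinear_diff: "clinear F \<Longrightarrow> F (x - y) = F x - F y"
  using clinear_add[of F x "- y"] by (simp add: clinear_minus)

lemma clinear_sum: "clinear F \<Longrightarrow> F (\<Sum>i\<in>I. f i) = (\<Sum>i\<in>I. F (f i))"
  by (induction I rule: infinite_finite_induct) (simp_all add: clinear_zero clinear_add)

lemma clinear_scaleR: "clinear F \<Longrightarrow> F (r *\<^sub>R x) = r *\<^sub>R F x"
  by (simp add: scaleR_scaleC clinear_scaleC)

lemma clinear_compose: "clinear F \<Longrightarrow> clinear G \<Longrightarrow> clinear (F \<circ> G)"
  by (simp add: clinear_def)

lemma clinear_funpow: "clinear F \<Longrightarrow> clinear (F ^^ k)" for F :: "'a::complex_inner \<Rightarrow> 'a"
  by (induction k) (simp_all add: clinear_def)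

lemma bounded_clinear_clinear: "bounded_clinear F \<Longrightarrow> clinear F"
  by (simp add: bounded_clinear_def clinear_def bounded_linear.linear linear_add)

lemma bounded_clinearI:
  assumes "clinear F" "\<And>x. norm (F x) \<le> norm x * K"
  shows "bounded_clinear F"
  unfolding bounded_clinear_def
proof (intro conjI allI)
  show "bounded_linear F"
    by (rule bounded_linear_intro[where K = K])
       (use assms in \<open>simp_all add: clinear_add clinear_scaleR\<close>)
qed (simp add: assms clinear_scaleC)

lemma bounded_clinear_bound:
  assumes "bounded_clinear F" obtains K where "K > 0" "\<And>x. norm (F x) \<le> norm x * K"
  using assms bounded_linear.pos_bounded[of F] unfolding bounded_clinear_def by blast

lemma bounded_clinear_compose: "bounded_clinear F \<Longrightarrow> bounded_clinear G \<Longrightarrow> bounded_clinear (F \<circ> G)"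
  unfolding bounded_clinear_def o_def by (auto intro: bounded_linear_compose)

lemma bounded_clinear_funpow: "bounded_clinear F \<Longrightarrow> bounded_clinear (F ^^ k)"
  for F :: "'a::complex_inner \<Rightarrow> 'a"
proof (induction k)
  case 0
  then show ?case by (intro bounded_clinearI[where K = 1]) (simp_all add: clinear_def)
next
  case (Suc k)
  then show ?case using bounded_clinear_compose[of F "F ^^ k"] by (simp add: o_def)
qed

lemma bounded_clinear_add: "bounded_clinear F \<Longrightarrow> bounded_clinear G \<Longrightarrow> bounded_clinear (\<lambda>x. F x + G x)"
  unfolding bounded_clinear_def by (auto intro: bounded_linear_add simp: scaleC_add_right)

lemma bounded_clinear_diff: "bounded_clinear F \<Longrightarrow> bounded_clinear G \<Longrightarrow> bounded_clinear (\<lambda>x. F x - G x)"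
  unfolding bounded_clinear_def
  by (auto intro: bounded_linear_sub simp: complex_vector.scale_right_diff_distrib)

lemma bounded_clinear_zero: "bounded_clinear (\<lambda>x. 0)"
  unfolding bounded_clinear_def by (simp add: complex_vector.scale_zero_right)

lemma bounded_clinear_sum: "(\<And>i. i \<in> I \<Longrightarrow> bounded_clinear (F i)) \<Longrightarrow> bounded_clinear (\<lambda>x. \<Sum>i\<in>I. F i x)"
  by (induction I rule: infinite_finite_induct) (simp_all add: bounded_clinear_zero bounded_clinear_add)

lemma bounded_clinear_scaleC: "bounded_clinear F \<Longrightarrow> bounded_clinear (\<lambda>x. c *\<^sub>C F x)"
proof -
  assume F: "bounded_clinear F"
  obtain K where K: "\<And>x. norm (F x) \<le> norm x * K"
    using bounded_clinear_bound[OF F] by metis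
  show ?thesis
  proof (rule bounded_clinearI[where K = "cmod c * K"])
    show "clinear (\<lambda>x. c *\<^sub>C F x)"
      using bounded_clinear_clinear[OF F]
      by (simp add: clinear_def scaleC_add_right scaleC_scaleC mult.commute)
    show "norm (c *\<^sub>C F x) \<le> norm x * (cmod c * K)" for x
      using mult_left_mono[OF K[of x], of "cmod c"] by (simp add: norm_scaleC mult_ac)
  qed
qed

lemma bounded_clinear_scaleR: "bounded_clinear F \<Longrightarrow> bounded_clinear (\<lambda>x. r *\<^sub>R F x)"
  unfolding scaleR_scaleC by (rule bounded_clinear_scaleC)

section \<open>Riesz representation and adjoints\<close>

text \<open>The representing vector of a bounded functional \<open>f\<close> minimizes
  \<open>J x = \<parallel>x\<parallel>\<^sup>2 - 2 Re (f x)\<close>: by the parallelogram law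
  \<open>\<parallel>x - y\<parallel>\<^sup>2 = 2 J x + 2 J y - 4 J ((x + y) / 2)\<close>, so every minimizing sequence is Cauchy, and the
  vanishing of the first variation of \<open>J\<close> at the limit is the claimed identity.\<close>

lemma riesz_representation:
  fixes f :: "'h::complex_hilbert \<Rightarrow> complex"
  assumes add: "\<And>x y. f (x + y) = f x + f y"
    and scale: "\<And>c x. f (c *\<^sub>C x) = c * f x"
    and bound: "\<And>x. cmod (f x) \<le> norm x * K"
  obtains z where "\<And>x. f x = cinner x z"
proof -
  have scaleR: "f (r *\<^sub>R x) = complex_of_real r * f x" for r x
    by (simp add: scaleR_scaleC scale)
  have bl: "bounded_linear f"
    by (rule bounded_linear_intro[where K = K]) (simp_all add: add scaleR bound scaleR_conv_of_real)
  define J where "J x = (norm x)\<^sup>2 - 2 * Re (f x)" for x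
  have below: "- K\<^sup>2 \<le> J x" for x
  proof -
    have "Re (f x) \<le> norm x * K"
      using bound[of x] complex_Re_le_cmod[of "f x"] by linarith
    moreover have "0 \<le> (norm x - K)\<^sup>2" by simp
    ultimately show ?thesis
      by (simp add: J_def power2_diff)
  qed
  define m where "m = Inf (range J)"
  have bdd: "bdd_below (range J)"
    using below by (auto intro: bdd_belowI[of _ "- K\<^sup>2"])
  have m_le: "m \<le> J x" for x
    unfolding m_def by (rule cInf_lower[OF rangeI bdd])
  have "\<exists>x. J x < m + 1 / real (Suc k)" for k
  proof -
    have "Inf (range J) < m + 1 / real (Suc k)" by (simp add: m_def)
    then show ?thesis
      by (subst (asm) cInf_less_iff) (use bdd in auto)
  qed
  then obtain X where X: "J (X k) < m + 1 / real (Suc k)" for k by metis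
  have par: "(norm (x - y))\<^sup>2 \<le> 2 * (J x - m) + 2 * (J y - m)" for x y
  proof -
    have "(norm ((1/2) *\<^sub>R (x + y)))\<^sup>2 = (norm (x + y))\<^sup>2 / 4"
      by (simp add: power_divide)
    moreover have "Re (f ((1/2) *\<^sub>R (x + y))) = (Re (f x) + Re (f y)) / 2"
      by (simp only: scaleR) (simp add: add)
    ultimately have "4 * J ((1/2) *\<^sub>R (x + y)) = (norm (x + y))\<^sup>2 - 4 * Re (f x) - 4 * Re (f y)"
      unfolding J_def by (simp only:) (simp add: field_simps)
    moreover have "(norm (x - y))\<^sup>2 = 2 * (norm x)\<^sup>2 + 2 * (norm y)\<^sup>2 - (norm (x + y))\<^sup>2"
      using norm_add_squared[of x y] norm_add_squared[of x "- y"] by (simp add: cinner_minus_right)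
    ultimately show ?thesis
      using m_le[of "(1/2) *\<^sub>R (x + y)"] by (simp add: J_def)
  qed
  have "Cauchy X"
  proof (rule metric_CauchyI)
    fix e :: real assume e: "e > 0"
    obtain N where N: "1 / real (Suc N) < e\<^sup>2 / 4"
      using e by (metis nat_approx_posE zero_less_divide_iff zero_less_numeral zero_less_power)
    have small: "J (X k) - m < e\<^sup>2 / 4" if "k \<ge> N" for k
    proof -
      have "1 / real (Suc k) \<le> 1 / real (Suc N)"
        using that by (simp add: field_simps)
      then show ?thesis using X[of k] N by linarith
    qed
    have "dist (X k) (X l) < e" if "k \<ge> N" "l \<ge> N" for k l
    proof -
      have "(norm (X k - X l))\<^sup>2 < e\<^sup>2"
        using par[of "X k" "X l"] small[OF that(1)] small[OF that(2)] by simp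
      then show ?thesis
        using e by (simp add: dist_norm power_less_imp_less_base)
    qed
    then show "\<exists>M. \<forall>k\<ge>M. \<forall>l\<ge>M. dist (X k) (X l) < e" by blast
  qed
  then obtain z where z: "X \<longlonglongrightarrow> z"
    by (auto simp: Cauchy_convergent_iff convergent_def)
  have "(\<lambda>k. J (X k)) \<longlonglongrightarrow> J z"
    unfolding J_def by (intro tendsto_intros z bounded_linear.tendsto[OF bl z])
  moreover have "(\<lambda>k. J (X k)) \<longlonglongrightarrow> m"
  proof (rule tendsto_sandwich[of "\<lambda>_. m" _ _ "\<lambda>k. m + 1 / real (Suc k)"])
    have "(\<lambda>k. m + 1 / real (Suc k)) \<longlonglongrightarrow> m + 0"
      by (intro tendsto_intros LIMSEQ_inverse_real_of_nat[unfolded inverse_eq_divide])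
    then show "(\<lambda>k. m + 1 / real (Suc k)) \<longlonglongrightarrow> m" by simp
  qed (use m_le X less_imp_le in \<open>auto intro!: always_eventually\<close>)
  ultimately have Jz: "J z = m" by (rule LIMSEQ_unique)
  have re: "Re (f x) = Re (cinner x z)" for x
  proof -
    define d where "d = Re (cinner z x) - Re (f x)"
    have ineq: "0 \<le> t\<^sup>2 * (norm x)\<^sup>2 + 2 * t * d" for t
    proof -
      have "J (z + t *\<^sub>R x) = J z + t\<^sup>2 * (norm x)\<^sup>2 + 2 * t * d"
        unfolding J_def norm_add_squared d_def
        by (simp add: add scaleR cinner_scaleR_right power_mult_distrib algebra_simps)
      then show ?thesis using m_le[of "z + t *\<^sub>R x"] Jz by linarith
    qed
    have "d = 0"
    proof (rule ccontr)
      assume "d \<noteq> 0"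
      \<comment> \<open>a step at which the linear term outweighs the quadratic one\<close>
      define t where "t = - d / ((norm x)\<^sup>2 + 1)"
      have "(norm x)\<^sup>2 + 1 > 0" by (simp add: add_nonneg_pos)
      then have "(norm x)\<^sup>2 + 1 \<noteq> 0" by linarith
      then have d: "d = - (t * ((norm x)\<^sup>2 + 1))" unfolding t_def by simp
      then have "t \<noteq> 0" using \<open>d \<noteq> 0\<close> by auto
      have "t\<^sup>2 * (norm x)\<^sup>2 + 2 * t * d = - (t\<^sup>2 * ((norm x)\<^sup>2 + 2))"
        unfolding d by (simp add: power2_eq_square algebra_simps)
      moreover have "t\<^sup>2 * ((norm x)\<^sup>2 + 2) > 0"
        using \<open>t \<noteq> 0\<close> by (simp add: add_nonneg_pos)
      ultimately show False using ineq[of t] by linarith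
    qed
    then show ?thesis
      unfolding d_def by (subst cinner_commute) simp
  qed
  have "f x = cinner x z" for x
  proof (rule complex_eqI[OF re])
    have "Re (f (\<i> *\<^sub>C x)) = Re (cinner (\<i> *\<^sub>C x) z)" by (rule re)
    then show "Im (f x) = Im (cinner x z)"
      by (simp add: scale cinner_scaleC_left)
  qed
  then show thesis by (rule that)
qed

lemma cinner_cadjoint:
  fixes F :: "'h::complex_hilbert \<Rightarrow> 'b::complex_inner"
  assumes "bounded_clinear F"
  shows "cinner (F x) y = cinner x (cadjoint F y)"
proof -
  obtain K where K: "\<And>x. norm (F x) \<le> norm x * K"
    using bounded_clinear_bound[OF assms] by metis
  have "\<exists>z. \<forall>x. cinner (F x) y = cinner x z" for y
  proof -
    have "cmod (cinner (F x) y) \<le> norm x * (K * norm y)" for x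
    proof -
      have "cmod (cinner (F x) y) \<le> norm (F x) * norm y" by (rule cauchy_schwarz)
      also have "\<dots> \<le> (norm x * K) * norm y" by (intro mult_right_mono K) simp
      finally show ?thesis by (simp add: mult_ac)
    qed
    then show ?thesis
      using riesz_representation[of "\<lambda>x. cinner (F x) y" "K * norm y"] bounded_clinear_clinear[OF assms]
      by (metis cinner_add_left cinner_scaleC_left clinear_def)
  qed
  then have "\<exists>G. \<forall>x y. cinner (F x) y = cinner x (G y)" by metis
  then show ?thesis
    unfolding cadjoint_def by (rule someI2_ex) blast
qed

lemma cinner_cadjoint':
  fixes F :: "'h::complex_hilbert \<Rightarrow> 'b::complex_inner"
  assumes "bounded_clinear F"
  shows "cinner (cadjoint F y) x = cinner y (F x)"
  by (metis assms cinner_cadjoint cinner_commute)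

lemma cadjoint_eqI:
  fixes F :: "'h::complex_hilbert \<Rightarrow> 'b::complex_inner"
  assumes "bounded_clinear F" "\<And>x. cinner (F x) y = cinner x z"
  shows "cadjoint F y = z"
  by (rule cinner_ext_right) (metis assms cinner_cadjoint)

lemma bounded_clinear_cadjoint:
  fixes F :: "'h::complex_hilbert \<Rightarrow> 'b::complex_inner"
  assumes "bounded_clinear F"
  shows "bounded_clinear (cadjoint F)"
proof -
  obtain K where K: "K > 0" "\<And>x. norm (F x) \<le> norm x * K"
    using bounded_clinear_bound[OF assms] by metis
  show ?thesis
  proof (rule bounded_clinearI[where K = K])
    show "clinear (cadjoint F)"
      unfolding clinear_def
      by (intro conjI allI cadjoint_eqI[OF assms])
         (simp_all add: cinner_linear_simps cinner_cadjoint[OF assms])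
    fix y
    have "(norm (cadjoint F y))\<^sup>2 = cmod (cinner (F (cadjoint F y)) y)"
      by (simp add: cinner_cadjoint[OF assms] cinner_self norm_power)
    also have "\<dots> \<le> norm (F (cadjoint F y)) * norm y" by (rule cauchy_schwarz)
    also have "\<dots> \<le> (norm (cadjoint F y) * K) * norm y" by (intro mult_right_mono K) simp
    finally have "norm (cadjoint F y) * norm (cadjoint F y) \<le> norm (cadjoint F y) * (norm y * K)"
      by (simp add: power2_eq_square mult_ac)
    then show "norm (cadjoint F y) \<le> norm y * K"
      using K(1) by (cases "norm (cadjoint F y) = 0") (auto simp: mult_le_cancel_left)
  qed
qed

section \<open>Orthonormal bases, projections and determinants\<close>

lemma csubspace_orthogonal: "csubspace {x. cinner r x = (0::complex)}"
  by (rule complex_vector.subspaceI) (simp_all add: cinner_linear_simps)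

lemma cinner_cspan_eq_0:
  assumes "\<And>b. b \<in> B \<Longrightarrow> cinner r b = 0" "x \<in> cspan B" shows "cinner r x = 0"
  using complex_vector.span_minimal[OF _ csubspace_orthogonal, of B r] assms by auto

lemma fin_dim_csubspace: "fin_dim S \<Longrightarrow> csubspace S"
  by (simp add: fin_dim_def)

text \<open>A maximal independent subset of \<open>U\<close> spans it and is no larger than a finite spanning set of
  \<open>S\<close>.\<close>

lemma fin_dim_subset:
  assumes "fin_dim S" "csubspace U" "U \<subseteq> S" shows "fin_dim U"
proof -
  obtain B where B: "finite B" "cspan B = S" using assms(1) by (auto simp: fin_dim_def)
  obtain D where D: "D \<subseteq> U" "\<not> complex_vector.dependent D" "U \<subseteq> cspan D"
    using complex_vector.maximal_independent_subset[of U] by blast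
  have "finite D"
    using complex_vector.independent_span_bound[OF B(1) D(2)] D(1) assms(3) B(2) by blast
  moreover have "cspan D = U"
    using D(1,3) assms(2) complex_vector.span_minimal by blast
  ultimately show ?thesis using assms(2) by (auto simp: fin_dim_def)
qed

lemma orthonormal_basis_nth:
  assumes "orthonormal_basis S bs" "i < length bs" "j < length bs"
  shows "cinner (bs ! i) (bs ! j) = (if i = j then 1 else 0)"
  using assms by (simp add: orthonormal_basis_def)

lemma orthonormal_basis_in: "orthonormal_basis S bs \<Longrightarrow> i < length bs \<Longrightarrow> bs ! i \<in> S"
  unfolding orthonormal_basis_def by (metis complex_vector.span_base nth_mem)

lemma orthonormal_basis_residual:
  assumes "orthonormal_basis S bs" "s \<in> S"
  shows "cinner (v - (\<Sum>i<length bs. cinner v (bs ! i) *\<^sub>C bs ! i)) s = 0"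
proof (rule cinner_cspan_eq_0)
  show "s \<in> cspan (set bs)" using assms by (simp add: orthonormal_basis_def)
  fix b assume "b \<in> set bs"
  then obtain j where j: "j < length bs" "b = bs ! j" by (auto simp: in_set_conv_nth)
  have "(\<Sum>i<length bs. cinner v (bs ! i) * cinner (bs ! i) (bs ! j)) =
        (\<Sum>i<length bs. if i = j then cinner v (bs ! i) else 0)"
    by (intro sum.cong) (simp_all add: orthonormal_basis_nth[OF assms(1)] j)
  then show "cinner (v - (\<Sum>i<length bs. cinner v (bs ! i) *\<^sub>C bs ! i)) b = 0"
    by (simp add: cinner_linear_simps j)
qed

lemma orthonormal_basis_sum_in:
  assumes "orthonormal_basis S bs"
  shows "(\<Sum>i<length bs. c i *\<^sub>C bs ! i) \<in> S"
proof -
  have "csubspace S" using assms unfolding orthonormal_basis_def by auto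
  then show ?thesis
    by (intro complex_vector.subspace_sum complex_vector.subspace_scale)
       (simp_all add: orthonormal_basis_in[OF assms])
qed

lemma orthonormal_basis_expand:
  assumes "orthonormal_basis S bs" "v \<in> S"
  shows "(\<Sum>i<length bs. cinner v (bs ! i) *\<^sub>C bs ! i) = v"
proof -
  let ?r = "v - (\<Sum>i<length bs. cinner v (bs ! i) *\<^sub>C bs ! i)"
  have "csubspace S" using assms unfolding orthonormal_basis_def by auto
  then have "?r \<in> S"
    by (intro complex_vector.subspace_diff assms orthonormal_basis_sum_in)
  then have "cinner ?r ?r = 0" by (rule orthonormal_basis_residual[OF assms(1)])
  then show ?thesis by (simp add: cinner_self_eq_0_iff)
qed

text \<open>Gram--Schmidt orthogonalization, one vector at a time.\<close>

lemma orthonormal_basis_cspan_exists: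
  assumes "finite (B :: 'a::complex_inner set)"
  shows "\<exists>bs. orthonormal_basis (cspan B) bs"
  using assms
proof (induction B)
  case empty
  have "orthonormal_basis (cspan {} :: 'a set) []"
    by (simp add: orthonormal_basis_def)
  then show ?case by blast
next
  case (insert b B)
  then obtain bs where bs: "orthonormal_basis (cspan B) bs" by blast
  define s where "s = (\<Sum>i<length bs. cinner b (bs ! i) *\<^sub>C bs ! i)"
  define r where "r = b - s"
  have s: "s \<in> cspan B" unfolding s_def by (rule orthonormal_basis_sum_in[OF bs])
  have orth: "cinner r x = 0" if "x \<in> cspan B" for x
    unfolding r_def s_def by (rule orthonormal_basis_residual[OF bs that])
  show ?case
  proof (cases "r = 0")
    case True
    then have "b \<in> cspan B" using s by (simp add: r_def)
    then have "cspan (insert b B) = cspan B" by (rule complex_vector.span_redundant)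
    then show ?thesis using bs by auto
  next
    case False
    define q where "q = (1 / complex_of_real (norm r)) *\<^sub>C r"
    have rq: "r = complex_of_real (norm r) *\<^sub>C q"
      using False by (simp add: q_def scaleC_scaleC scaleC_one)
    have qq: "cinner q q = 1"
      using False unfolding q_def cinner_scaleC_left cinner_scaleC_right cinner_self[of r]
      by (simp add: power2_eq_square)
    have orthq: "cinner q x = 0" "cinner x q = 0" if "x \<in> cspan B" for x
      using orth[OF that] cinner_commute[of x r] by (simp_all add: q_def cinner_linear_simps)
    have spanB: "cspan (set bs) = cspan B" using bs by (simp add: orthonormal_basis_def)
    have sub: "cspan B \<subseteq> cspan (insert b B)" "cspan (set bs) \<subseteq> cspan (insert q (set bs))"
      by (intro complex_vector.span_mono; blast)+
    have "r \<in> cspan (insert b B)"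
      unfolding r_def using s sub(1)
      by (intro complex_vector.span_diff) (auto intro: complex_vector.span_base)
    then have "q \<in> cspan (insert b B)" unfolding q_def by (rule complex_vector.span_scale)
    moreover have "set bs \<subseteq> cspan (insert b B)"
      using spanB sub(1) complex_vector.span_superset by blast
    ultimately have 1: "cspan (insert q (set bs)) \<subseteq> cspan (insert b B)"
      by (intro complex_vector.span_minimal) auto
    have "q \<in> cspan (insert q (set bs))" by (rule complex_vector.span_base) simp
    then have "r \<in> cspan (insert q (set bs))" by (subst rq) (rule complex_vector.span_scale)
    moreover have "s \<in> cspan (insert q (set bs))" using s sub(2) spanB by blast
    ultimately have "r + s \<in> cspan (insert q (set bs))" by (rule complex_vector.span_add)
    then have "b \<in> cspan (insert q (set bs))" by (simp add: r_def)
    moreover have "B \<subseteq> cspan (insert q (set bs))"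
      using spanB sub(2) complex_vector.span_superset by blast
    ultimately have 2: "cspan (insert b B) \<subseteq> cspan (insert q (set bs))"
      by (intro complex_vector.span_minimal) auto
    have "orthonormal_basis (cspan (insert b B)) (bs @ [q])"
      unfolding orthonormal_basis_def
    proof (intro conjI allI impI)
      show "cspan (set (bs @ [q])) = cspan (insert b B)" using 1 2 by simp
      fix i j assume "i < length (bs @ [q])" "j < length (bs @ [q])"
      then show "cinner ((bs @ [q]) ! i) ((bs @ [q]) ! j) = (if i = j then 1 else 0)"
        using orthonormal_basis_nth[OF bs] orthq orthonormal_basis_in[OF bs] qq
        by (auto simp: nth_append less_Suc_eq)
    qed
    then show ?thesis by blast
  qed
qed

definition onb :: "'a::complex_inner set \<Rightarrow> 'a list" where
  "onb S = (SOME bs. orthonormal_basis S bs)"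

lemma onb: "fin_dim S \<Longrightarrow> orthonormal_basis S (onb S)"
  unfolding onb_def fin_dim_def using orthonormal_basis_cspan_exists by (metis someI_ex)

lemma proj_eqI:
  assumes "csubspace S" "u \<in> S" "\<And>s. s \<in> S \<Longrightarrow> cinner (v - u) s = 0"
  shows "proj S v = u"
  unfolding proj_def
proof (rule the_equality)
  show "u \<in> S \<and> (\<forall>s\<in>S. cinner (v - u) s = 0)" using assms by blast
  fix w assume w: "w \<in> S \<and> (\<forall>s\<in>S. cinner (v - w) s = 0)"
  then have "w - u \<in> S" using assms(1,2) complex_vector.subspace_diff by blast
  then have "cinner (v - u) (w - u) - cinner (v - w) (w - u) = 0" using w assms(3) by simp
  then have "cinner (w - u) (w - u) = 0" by (simp add: cinner_diff_left[symmetric])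
  then show "w = u" by (simp add: cinner_self_eq_0_iff)
qed

context
  fixes S :: "'a::complex_inner set"
  assumes S: "fin_dim S"
begin

lemma proj_expand: "proj S v = (\<Sum>i<length (onb S). cinner v (onb S ! i) *\<^sub>C onb S ! i)"
  by (intro proj_eqI fin_dim_csubspace S orthonormal_basis_sum_in orthonormal_basis_residual[OF onb] onb)

lemma proj_in: "proj S v \<in> S"
  unfolding proj_expand by (rule orthonormal_basis_sum_in[OF onb[OF S]])

lemma cinner_proj_left: "s \<in> S \<Longrightarrow> cinner (proj S v) s = cinner v s"
  using orthonormal_basis_residual[OF onb[OF S], of s v]
  by (simp add: proj_expand cinner_diff_left)

lemma cinner_proj_right: "s \<in> S \<Longrightarrow> cinner s (proj S v) = cinner s v"
  by (metis cinner_commute cinner_proj_left)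

lemma proj_fixed: "s \<in> S \<Longrightarrow> proj S s = s"
  by (intro proj_eqI fin_dim_csubspace S) (simp_all add: cinner_zero_left)

lemma clinear_proj: "clinear (proj S)"
  unfolding clinear_def proj_expand
  by (simp add: cinner_linear_simps scaleC_add_left scaleC_scaleC sum.distrib
      complex_vector.scale_sum_right)

lemma norm_proj_le: "norm (proj S v) \<le> norm v"
proof -
  have "(norm (proj S v))\<^sup>2 = cmod (cinner v (proj S v))"
    by (metis cinner_proj_left cinner_self norm_of_real abs_power2 proj_in)
  also have "\<dots> \<le> norm v * norm (proj S v)" by (rule cauchy_schwarz)
  finally show ?thesis
    by (cases "norm (proj S v) = 0") (auto simp: power2_eq_square mult_le_cancel_right)
qed

lemma bounded_clinear_proj: "bounded_clinear (proj S)"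
  by (rule bounded_clinearI[where K = 1]) (simp_all add: clinear_proj norm_proj_le)

end

lemma op_matrix_onb:
  "op_matrix S T = mat (length (onb S)) (length (onb S)) (\<lambda>(i, j). cinner (T (onb S ! j)) (onb S ! i))"
  by (simp add: op_matrix_def onb_def Let_def)

lemma op_matrix_carrier: "op_matrix S T \<in> carrier_mat (length (onb S)) (length (onb S))"
  by (simp add: op_matrix_onb)

lemma op_matrix_dim [simp]:
  "dim_row (op_matrix S T) = length (onb S)" "dim_col (op_matrix S T) = length (onb S)"
  by (simp_all add: op_matrix_onb)

definition of_coords :: "'a::complex_inner set \<Rightarrow> complex vec \<Rightarrow> 'a" where
  "of_coords S x = (\<Sum>j<length (onb S). x $ j *\<^sub>C onb S ! j)"

lemma op_matrix_mult_vec: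
  assumes "clinear T" "x \<in> carrier_vec (length (onb S))" "i < length (onb S)"
  shows "(op_matrix S T *\<^sub>v x) $ i = cinner (T (of_coords S x)) (onb S ! i)"
  using assms
  by (simp add: op_matrix_onb of_coords_def clinear_sum clinear_scaleC cinner_linear_simps
      scalar_prod_def lessThan_atLeast0 mult.commute)

lemma of_coords_in: "fin_dim S \<Longrightarrow> of_coords S x \<in> S"
  unfolding of_coords_def by (intro orthonormal_basis_sum_in onb)

lemma cinner_of_coords:
  assumes "fin_dim S" "i < length (onb S)"
  shows "cinner (of_coords S x) (onb S ! i) = x $ i"
proof -
  have "cinner (of_coords S x) (onb S ! i) = (\<Sum>j<length (onb S). if j = i then x $ j else 0)"
    unfolding of_coords_def cinner_sum_left cinner_scaleC_left
    by (intro sum.cong) (simp_all add: orthonormal_basis_nth[OF onb[OF assms(1)]] assms(2))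
  then show ?thesis using assms(2) by simp
qed

lemma eq_0_if_orthogonal_onb:
  assumes "fin_dim S" "v \<in> S" "\<And>i. i < length (onb S) \<Longrightarrow> cinner v (onb S ! i) = 0"
  shows "v = 0"
  using orthonormal_basis_expand[OF onb[OF assms(1)] assms(2)] assms(3) by simp

text \<open>For an orthonormal basis the matrix product computes the coordinates of the image, so a kernel
  vector of the matrix and a kernel vector of the operator are the same thing in coordinates.\<close>

lemma op_det_eq_0_iff:
  assumes S: "fin_dim S" and T: "clinear T" and TS: "\<And>s. s \<in> S \<Longrightarrow> T s \<in> S"
  shows "op_det S T = 0 \<longleftrightarrow> (\<exists>e\<in>S. e \<noteq> 0 \<and> T e = 0)"
proof
  let ?m = "length (onb S)"
  assume "op_det S T = 0"
  then obtain x where x: "x \<in> carrier_vec ?m" "x \<noteq> 0\<^sub>v ?m" "op_matrix S T *\<^sub>v x = 0\<^sub>v ?m"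
    unfolding op_det_def using det_0_iff_vec_prod_zero_field[OF op_matrix_carrier] by blast
  have "T (of_coords S x) = 0"
  proof (rule eq_0_if_orthogonal_onb[OF S])
    show "T (of_coords S x) \<in> S" by (intro TS of_coords_in S)
    fix i assume i: "i < ?m"
    show "cinner (T (of_coords S x)) (onb S ! i) = 0"
      using op_matrix_mult_vec[OF T x(1) i] x(3) i by simp
  qed
  moreover have "of_coords S x \<noteq> 0"
  proof
    assume "of_coords S x = 0"
    then have "x $ i = 0" if "i < ?m" for i
      using cinner_of_coords[OF S that, of x] by (simp add: cinner_zero_left)
    then have "x = 0\<^sub>v ?m" using x(1) by (intro eq_vecI) auto
    then show False using x(2) by simp
  qed
  ultimately show "\<exists>e\<in>S. e \<noteq> 0 \<and> T e = 0" using of_coords_in[OF S] by blast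
next
  let ?m = "length (onb S)"
  assume "\<exists>e\<in>S. e \<noteq> 0 \<and> T e = 0"
  then obtain e where e: "e \<in> S" "e \<noteq> 0" "T e = 0" by blast
  define x where "x = vec ?m (\<lambda>j. cinner e (onb S ! j))"
  have ex: "of_coords S x = e"
    unfolding of_coords_def x_def
    by (subst (2) orthonormal_basis_expand[OF onb[OF S] e(1), symmetric]) (intro sum.cong, auto)
  have x: "x \<in> carrier_vec ?m" by (simp add: x_def)
  have "op_matrix S T *\<^sub>v x = 0\<^sub>v ?m"
    using op_matrix_mult_vec[OF T x] ex e(3) by (intro eq_vecI) (simp_all add: cinner_zero_left)
  moreover have "x \<noteq> 0\<^sub>v ?m"
    using ex e(2) by (auto simp: of_coords_def)
  ultimately show "op_det S T = 0"
    unfolding op_det_def using det_0_iff_vec_prod_zero_field[OF op_matrix_carrier] x by blast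
qed

lemma op_det_adjoint:
  assumes S: "fin_dim S" and adj: "\<And>u v. u \<in> S \<Longrightarrow> v \<in> S \<Longrightarrow> cinner (T u) v = cinner u (T' v)"
  shows "op_det S T' = cnj (op_det S T)"
proof -
  interpret cnj: comm_ring_hom cnj by standard simp_all
  have "op_matrix S T' = map_mat cnj (transpose_mat (op_matrix S T))"
  proof (rule eq_matI)
    fix i j assume "i < dim_row (map_mat cnj (transpose_mat (op_matrix S T)))"
      "j < dim_col (map_mat cnj (transpose_mat (op_matrix S T)))"
    then have ij: "i < length (onb S)" "j < length (onb S)" by simp_all
    have "cinner (T' (onb S ! j)) (onb S ! i) = cnj (cinner (T (onb S ! i)) (onb S ! j))"
      using adj[of "onb S ! i" "onb S ! j"] orthonormal_basis_in[OF onb[OF S]] ij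
      by (metis cinner_commute)
    then show "op_matrix S T' $$ (i, j) = map_mat cnj (transpose_mat (op_matrix S T)) $$ (i, j)"
      using ij by (simp add: op_matrix_onb)
  qed simp_all
  then show ?thesis
    unfolding op_det_def by (simp add: det_transpose[OF op_matrix_carrier])
qed

section \<open>Polynomials vanishing on infinite subsets of plane curves\<close>

text \<open>Pseudo-division is enough to eliminate a variable: a nonzero element of minimal degree in the ideal
  generated by \<open>F\<close> and \<open>G\<close> divides nonzero scalar multiples of both, so it has
  degree zero if the prime \<open>F\<close> does not divide \<open>G\<close>.\<close>

lemma elimination:
  fixes F G :: "'a::{factorial_ring_gcd, semiring_gcd_mult_normalize} poly"
  assumes F: "prime_elem F" "degree F > 0" and ndvd: "\<not> F dvd G"
  shows "\<exists>a b r. r \<noteq> 0 \<and> a * F + b * G = [:r:]"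
proof -
  define I where "I = {a * F + b * G | a b. True}"
  have I_lin: "u * D - v * D' \<in> I" if D: "D \<in> I" "D' \<in> I" for D D' u v
  proof -
    obtain a b a' b' where "D = a * F + b * G" "D' = a' * F + b' * G"
      using D by (auto simp: I_def)
    then have "u * D - v * D' = (u * a - v * a') * F + (u * b - v * b') * G"
      by (simp add: algebra_simps)
    then show ?thesis unfolding I_def by blast
  qed
  have "F = 1 * F + 0 * G" by simp
  then have FI: "F \<in> I" unfolding I_def by blast
  have "G = 0 * F + 1 * G" by simp
  then have GI: "G \<in> I" unfolding I_def by blast
  have F0: "F \<noteq> 0" using F(2) by auto
  define D where "D = arg_min degree (\<lambda>D. D \<in> I \<and> D \<noteq> 0)"
  have D: "D \<in> I" "D \<noteq> 0" and min: "\<And>D'. D' \<in> I \<Longrightarrow> D' \<noteq> 0 \<Longrightarrow> degree D \<le> degree D'"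
    using arg_min_natI[of "\<lambda>D. D \<in> I \<and> D \<noteq> 0" F degree] FI F0
      arg_min_nat_le[of "\<lambda>D. D \<in> I \<and> D \<noteq> 0" _ degree]
    unfolding D_def by auto
  have divides: "\<exists>c. c \<noteq> 0 \<and> D dvd smult c P" if P: "P \<in> I" for P
  proof -
    obtain c q where c: "c \<noteq> 0" "smult c P = D * q + pseudo_mod P D"
      using pseudo_mod(1)[OF D(2)] by blast
    have "pseudo_mod P D = [:c:] * P - q * D" using c(2) by (simp add: algebra_simps)
    then have "pseudo_mod P D \<in> I" using I_lin[OF P D(1)] by metis
    then have "pseudo_mod P D = 0" using pseudo_mod(2)[OF D(2), of P] min by force
    then show ?thesis using c by auto
  qed
  obtain c where c: "c \<noteq> 0" "D dvd smult c F" using divides[OF FI] by blast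
  obtain c' where c': "c' \<noteq> 0" "D dvd smult c' G" using divides[OF GI] by blast
  have const: "\<not> F dvd [:k:]" if "k \<noteq> 0" for k
    using dvd_imp_degree_le[of F "[:k:]"] that F(2) by auto
  obtain q where q: "smult c F = D * q" using c(2) by (elim dvdE)
  have "F dvd D * q" unfolding q[symmetric] by (simp add: dvd_smult)
  then have "F dvd D \<or> F dvd q" using F(1) by (simp add: prime_elem_dvd_mult_iff)
  then have "degree D = 0"
  proof
    assume "F dvd D"
    then have "F dvd [:c':] * G" using c'(2) dvd_trans by auto
    then show ?thesis using F(1) const[OF c'(1)] ndvd by (metis prime_elem_dvd_mult_iff)
  next
    assume "F dvd q"
    then obtain q' where "q = F * q'" by (elim dvdE)
    then have "F * [:c:] = F * (D * q')" using q by (simp add: mult_ac)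
    then have "[:c:] = D * q'" using F0 by (metis mult_cancel_left)
    then have "D dvd [:c:]" by simp
    then show ?thesis using dvd_imp_degree_le[of D "[:c:]"] c(1) by simp
  qed
  then obtain r where "D = [:r:]" by (elim degree_eq_zeroE)
  moreover obtain a b where "D = a * F + b * G" using D(1) by (auto simp: I_def)
  ultimately show ?thesis using D(2) by (metis pCons_0_0)
qed

lemma poly_eq_0_if_infinite_roots:
  fixes p :: "complex poly"
  assumes "infinite A" "\<And>x. x \<in> A \<Longrightarrow> poly p x = 0" shows "p = 0"
proof (rule ccontr)
  assume "p \<noteq> 0"
  then show False
    using poly_roots_finite[of p] assms finite_subset[of A "{x. poly p x = 0}"] by blast
qed

lemma infinite_nonzero_complex: "infinite {t :: complex. t \<noteq> 0}"
  using infinite_UNIV_char_0[where 'a = complex] by (simp add: Collect_neg_eq)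

lemma poly_poly_eq: "poly (poly P q) t = poly (map_poly (\<lambda>c. poly c t) P) (poly q t)"
  by (induction P) (simp_all add: map_poly_pCons)

lemma infinite_fiber:
  assumes "infinite Z" "finite (fst ` Z)"
  obtains a where "infinite {b. (a, b) \<in> Z}"
proof -
  obtain a where a: "infinite {z \<in> Z. fst z = a}"
    using pigeonhole_infinite[OF assms] by metis
  have "{z \<in> Z. fst z = a} \<subseteq> Pair a ` {b. (a, b) \<in> Z}" by force
  then have "infinite {b. (a, b) \<in> Z}" using a finite_surj by blast
  then show thesis by (rule that)
qed

lemma eval2_conv_map_poly: "eval2 F (y1, y2) = poly (map_poly (\<lambda>c. poly c y1) F) y2"
  by (simp add: eval2_def poly_poly_eq)

lemma irreducible_dvd_transfer:
  assumes "Factorial_Ring.irreducible F" "L dvd F" "\<not> is_unit L" "L dvd G"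
  shows "F dvd G"
  using assms by (metis dvd_trans irreducibleD')

text \<open>If infinitely many first coordinates occur on \<open>Z\<close>, elimination of the second variable gives a
  contradiction; otherwise \<open>Z\<close> meets a vertical line in infinitely many points, so that line is the
  whole curve and \<open>G\<close> vanishes on it.\<close>

lemma irreducible_dvd_if_vanishes:
  fixes F G :: "complex poly poly"
  assumes F: "Factorial_Ring.irreducible F"
    and Z: "infinite Z" "\<And>y. y \<in> Z \<Longrightarrow> eval2 F y = 0" "\<And>y. y \<in> Z \<Longrightarrow> eval2 G y = 0"
  shows "F dvd G"
proof (cases "infinite (fst ` Z)")
  case True
  have F0: "F \<noteq> 0" using F by auto
  have no_const: "r = 0" if "\<And>y. y \<in> Z \<Longrightarrow> eval2 [:r:] y = 0" for r
  proof (rule poly_eq_0_if_infinite_roots[OF True])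
    fix y1 assume "y1 \<in> fst ` Z"
    then obtain y where "y \<in> Z" "y1 = fst y" by blast
    then show "poly r y1 = 0" using that[of y] by (simp add: eval2_def split: prod.splits)
  qed
  show ?thesis
  proof (rule ccontr)
    assume ndvd: "\<not> F dvd G"
    have "degree F > 0"
    proof (rule ccontr)
      assume "\<not> degree F > 0"
      then obtain f where "F = [:f:]" by (auto elim: degree_eq_zeroE)
      then show False using no_const[of f] Z(2) F0 by simp
    qed
    then obtain a b r where r: "r \<noteq> 0" "a * F + b * G = [:r:]"
      using elimination[OF _ _ ndvd] F by (metis prime_elem_iff_irreducible)
    have "eval2 [:r:] y = 0" if "y \<in> Z" for y
      unfolding r(2)[symmetric] using Z(2,3)[OF that] by (cases y) (simp add: eval2_def)
    then show False using no_const[of r] r(1) by simp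
  qed
next
  case False
  then obtain a where a: "infinite {b. (a, b) \<in> Z}" using infinite_fiber[OF Z(1)] by auto
  define L where "L = [:[:-a, 1:]:]"
  have L: "L dvd P" if "\<And>y. y \<in> Z \<Longrightarrow> eval2 P y = 0" for P
  proof -
    have "map_poly (\<lambda>c. poly c a) P = 0"
      using that by (intro poly_eq_0_if_infinite_roots[OF a]) (simp add: eval2_conv_map_poly[symmetric])
    then have "coeff (map_poly (\<lambda>c. poly c a) P) k = 0" for k by simp
    then show ?thesis
      unfolding L_def by (simp add: const_poly_dvd_iff coeff_map_poly poly_eq_0_iff_dvd)
  qed
  have "\<not> is_unit L" by (simp add: L_def is_unit_poly_iff)
  then show ?thesis using irreducible_dvd_transfer[OF F] L Z by blast
qed

definition eval3 :: "complex poly poly poly \<Rightarrow> complex \<times> complex \<times> complex \<Rightarrow> complex" where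
  "eval3 G = (\<lambda>(x0, x1, x2). poly (poly (poly G [:[:x2:]:]) [:x1:]) x0)"

lemma poly_poly_const_eq:
  "poly (poly (poly G [:[:x2:]:]) [:x1:]) x0 = poly (map_poly (\<lambda>c. poly (poly c [:x1:]) x0) G) x2"
  by (induction G) (simp_all add: map_poly_pCons)

lemma poly_poly_eq': "poly (poly c p) t = poly (poly c [:poly p t:]) t"
  by (simp add: poly_poly_eq)

text \<open>The same argument for the cone over \<open>Z\<close> in \<open>\<complex>\<^sup>3\<close>: elimination leaves a polynomial in \<open>x\<^sub>0, x\<^sub>1\<close>
  that vanishes on infinitely many lines through the origin, and in the second case the plane
  \<open>x\<^sub>1 = a x\<^sub>0\<close> takes the place of the vertical line.\<close>

lemma irreducible_dvd_if_vanishes_on_cone: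
  fixes F G :: "complex poly poly poly"
  assumes F: "Factorial_Ring.irreducible F"
    and Z: "infinite Z" "\<And>t y1 y2. t \<noteq> 0 \<Longrightarrow> (y1, y2) \<in> Z \<Longrightarrow> eval3 F (t, t * y1, t * y2) = 0"
      "\<And>t y1 y2. t \<noteq> 0 \<Longrightarrow> (y1, y2) \<in> Z \<Longrightarrow> eval3 G (t, t * y1, t * y2) = 0"
  shows "F dvd G"
proof (cases "infinite (fst ` Z)")
  case True
  have F0: "F \<noteq> 0" using F by auto
  have no_const: "r = 0"
    if r: "\<And>t y1 y2. t \<noteq> 0 \<Longrightarrow> (y1, y2) \<in> Z \<Longrightarrow> eval3 [:r:] (t, t * y1, t * y2) = 0" for r
  proof (rule poly_eqI)
    fix k
    have "poly (coeff r k) t = 0" if t: "t \<noteq> 0" for t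
    proof -
      have "map_poly (\<lambda>c. poly c t) r = 0"
      proof (rule poly_eq_0_if_infinite_roots)
        show "infinite ((\<lambda>y. t * y) ` fst ` Z)"
          using True t by (subst finite_image_iff) (auto simp: inj_on_def)
        fix x assume "x \<in> (\<lambda>y. t * y) ` fst ` Z"
        then obtain y1 y2 where y: "(y1, y2) \<in> Z" "x = t * y1" by auto
        then show "poly (map_poly (\<lambda>c. poly c t) r) x = 0"
          using r[OF t y(1)] by (simp add: eval3_def poly_poly_eq)
      qed
      then have "coeff (map_poly (\<lambda>c. poly c t) r) k = 0" by simp
      then show ?thesis by (simp add: coeff_map_poly)
    qed
    then show "coeff r k = coeff 0 k"
      using poly_eq_0_if_infinite_roots[OF infinite_nonzero_complex] by simp
  qed
  show ?thesis
  proof (rule ccontr)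
    assume ndvd: "\<not> F dvd G"
    have "degree F > 0"
    proof (rule ccontr)
      assume "\<not> degree F > 0"
      then obtain f where "F = [:f:]" by (auto elim: degree_eq_zeroE)
      then show False using no_const[of f] Z(2) F0 by simp
    qed
    then obtain a b r where r: "r \<noteq> 0" "a * F + b * G = [:r:]"
      using elimination[OF _ _ ndvd] F by (metis prime_elem_iff_irreducible)
    have "eval3 [:r:] (t, t * y1, t * y2) = 0" if "t \<noteq> 0" "(y1, y2) \<in> Z" for t y1 y2
      unfolding r(2)[symmetric] using Z(2,3)[OF that] by (simp add: eval3_def)
    then show False using no_const[of r] r(1) by simp
  qed
next
  case False
  then obtain a where a: "infinite {b. (a, b) \<in> Z}" using infinite_fiber[OF Z(1)] by auto
  define L where "L = [:[:[:0, -a:], 1:]:]"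
  have L: "L dvd P"
    if P: "\<And>t y1 y2. t \<noteq> 0 \<Longrightarrow> (y1, y2) \<in> Z \<Longrightarrow> eval3 P (t, t * y1, t * y2) = 0" for P
  proof -
    have "poly (poly (coeff P k) [:0, a:]) t = 0" if t: "t \<noteq> 0" for k t
    proof -
      have "map_poly (\<lambda>c. poly (poly c [:t * a:]) t) P = 0"
      proof (rule poly_eq_0_if_infinite_roots)
        show "infinite ((\<lambda>y. t * y) ` {b. (a, b) \<in> Z})"
          using a t by (subst finite_image_iff) (auto simp: inj_on_def)
        fix x assume "x \<in> (\<lambda>y. t * y) ` {b. (a, b) \<in> Z}"
        then obtain y2 where y: "(a, y2) \<in> Z" "x = t * y2" by auto
        then show "poly (map_poly (\<lambda>c. poly (poly c [:t * a:]) t) P) x = 0"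
          using P[OF t y(1)] by (simp add: eval3_def poly_poly_const_eq)
      qed
      then have "coeff (map_poly (\<lambda>c. poly (poly c [:t * a:]) t) P) k = 0" by simp
      then have "poly (poly (coeff P k) [:t * a:]) t = 0" by (simp add: coeff_map_poly)
      then show ?thesis by (subst poly_poly_eq') simp
    qed
    then have "poly (coeff P k) [:0, a:] = 0" for k
      using poly_eq_0_if_infinite_roots[OF infinite_nonzero_complex, of "poly (coeff P k) [:0, a:]"]
      by blast
    then show ?thesis
      unfolding L_def by (simp add: const_poly_dvd_iff poly_eq_0_iff_dvd)
  qed
  have "\<not> is_unit L" by (simp add: L_def is_unit_poly_iff)
  then show ?thesis using irreducible_dvd_transfer[OF F] L Z by blast
qed

lemma infinite_cmod_greater: "infinite {z :: complex. R < cmod z}"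
proof
  assume "finite {z :: complex. R < cmod z}"
  moreover have "complex_of_real ` {max R 0<..} \<subseteq> {z. R < cmod z}" by auto
  ultimately have "finite (complex_of_real ` {max R 0<..})" using finite_subset by blast
  then have "finite {max R 0<..}" by (rule finite_imageD) (simp add: inj_on_def)
  then show False by (simp add: infinite_Ioi)
qed

text \<open>Over all but finitely many values of \<open>y\<^sub>1\<close> the leading coefficient in \<open>y\<^sub>2\<close> is nonzero and the
  fundamental theorem of algebra gives a point, unless \<open>y\<^sub>2\<close> does not occur; then the curve contains
  a vertical line.\<close>

lemma affine_curve_unbounded:
  assumes F: "Factorial_Ring.irreducible F"
  shows "infinite {(y1, y2). eval2 F (y1, y2) = 0 \<and> (R < cmod y1 \<or> R < cmod y2)}"
    (is "infinite ?X")
proof (cases "degree F = 0")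
  case True
  then obtain f where f: "F = [:f:]" by (elim degree_eq_zeroE)
  have "degree f \<noteq> 0"
  proof
    assume "degree f = 0"
    then obtain c where "f = [:c:]" by (elim degree_eq_zeroE)
    then show False using F f
      by (cases "c = 0") (auto simp: Factorial_Ring.irreducible_def is_unit_const_poly_iff dvd_field_iff)
  qed
  then obtain a where a: "poly f a = 0"
    using fundamental_theorem_of_algebra_alt[of f] by fastforce
  have "Pair a ` {z. R < cmod z} \<subseteq> ?X" using a by (auto simp: f eval2_def)
  moreover have "infinite (Pair a ` {z. R < cmod z})"
    using infinite_cmod_greater by (subst finite_image_iff) (auto simp: inj_on_def)
  ultimately show ?thesis using finite_subset by blast
next
  case False
  then have F0: "lead_coeff F \<noteq> 0" by auto
  define Y where "Y = {y1. R < cmod y1} - {y1. poly (lead_coeff F) y1 = 0}"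
  have "infinite Y"
    unfolding Y_def using infinite_cmod_greater poly_roots_finite[OF F0] by (rule Diff_infinite_finite[rotated])
  moreover have "Y \<subseteq> fst ` ?X"
  proof
    fix y1 assume y1: "y1 \<in> Y"
    let ?p = "map_poly (\<lambda>c. poly c y1) F"
    have "coeff ?p (degree F) \<noteq> 0" using y1 by (simp add: Y_def coeff_map_poly)
    then have "degree ?p \<noteq> 0" using le_degree[of ?p "degree F"] False by auto
    then obtain y2 where "poly ?p y2 = 0"
      using fundamental_theorem_of_algebra_alt[of ?p] by fastforce
    then have "(y1, y2) \<in> ?X" using y1 by (simp add: eval2_conv_map_poly Y_def)
    then show "y1 \<in> fst ` ?X" by force
  qed
  ultimately show ?thesis using finite_surj by blast
qed

section \<open>Discriminant polynomials\<close>

lemma eval3_comm_ring_hom: "comm_ring_hom (\<lambda>G. eval3 G x)"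
  by standard (simp_all add: eval3_def split: prod.splits)

lemma eval2_comm_ring_hom: "comm_ring_hom (\<lambda>F. eval2 F y)"
  by standard (simp_all add: eval2_def split: prod.splits)

lemma clinear_pencil:
  assumes "clinear \<sigma>1" "clinear \<sigma>2" "clinear \<gamma>" shows "clinear (pencil \<sigma>1 \<sigma>2 \<gamma> x)"
  using assms
  by (cases x) (simp add: pencil_def clinear_def scaleC_add_right scaleC_scaleC
      complex_vector.scale_right_diff_distrib mult.commute)

lemma pencil_1: "pencil \<sigma>1 \<sigma>2 \<gamma> (1, y1, y2) = (\<lambda>e. y1 *\<^sub>C \<sigma>2 e - y2 *\<^sub>C \<sigma>1 e + \<gamma> e)"
  by (auto simp: pencil_def scaleC_one fun_eq_iff algebra_simps)

lemma eval2_discriminant_poly: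
  "eval2 (discriminant_poly S \<sigma>1 \<sigma>2 \<gamma>) (y1, y2) = op_det S (pencil \<sigma>1 \<sigma>2 \<gamma> (1, y1, y2))"
proof -
  interpret comm_ring_hom "\<lambda>F. eval2 F (y1, y2)" by (rule eval2_comm_ring_hom)
  show ?thesis
    unfolding discriminant_poly_def Let_def hom_det[symmetric] op_det_def
    by (intro arg_cong[of _ _ Determinant.det] eq_matI)
       (simp_all add: op_matrix_onb eval2_def pencil_def cinner_linear_simps scaleC_one)
qed

lemma discriminant_variety_eq:
  "discriminant_variety S \<sigma>1 \<sigma>2 \<gamma> = {y. eval2 (discriminant_poly S \<sigma>1 \<sigma>2 \<gamma>) y = 0}"
  by (auto simp: discriminant_variety_def eval2_discriminant_poly pencil_1)

definition pencil_matrix ::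
  "('e::complex_inner \<Rightarrow> 'e) \<Rightarrow> ('e \<Rightarrow> 'e) \<Rightarrow> ('e \<Rightarrow> 'e) \<Rightarrow> complex poly poly poly mat" where
  "pencil_matrix \<sigma>1 \<sigma>2 \<gamma> =
     (let M = (\<lambda>T. map_mat (\<lambda>c. [:[:[:c:]:]:]) (op_matrix UNIV T)) in
      [:[:[:0, 1:]:]:] \<cdot>\<^sub>m M \<gamma> + [:[:0, 1:]:] \<cdot>\<^sub>m M \<sigma>2 - [:0, 1:] \<cdot>\<^sub>m M \<sigma>1)"

lemma homogeneous_discriminant_poly_eq:
  "homogeneous_discriminant_poly UNIV \<sigma>1 \<sigma>2 \<gamma> = Determinant.det (pencil_matrix \<sigma>1 \<sigma>2 \<gamma>)"
  by (simp add: homogeneous_discriminant_poly_def pencil_matrix_def Let_def)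

lemma pencil_matrix_carrier:
  fixes \<sigma>1 :: "'e::complex_inner \<Rightarrow> 'e"
  shows "pencil_matrix \<sigma>1 \<sigma>2 \<gamma> \<in> carrier_mat (length (onb (UNIV :: 'e set))) (length (onb (UNIV :: 'e set)))"
  by (rule carrier_matI) (simp_all add: pencil_matrix_def Let_def)

lemma eval3_pencil_matrix:
  "map_mat (\<lambda>G. eval3 G x) (pencil_matrix \<sigma>1 \<sigma>2 \<gamma>) = op_matrix UNIV (pencil \<sigma>1 \<sigma>2 \<gamma> x)"
  by (cases x, intro eq_matI)
     (simp_all add: pencil_matrix_def Let_def op_matrix_onb eval3_def pencil_def cinner_linear_simps)

lemma eval3_homogeneous_discriminant_poly:
  "eval3 (homogeneous_discriminant_poly UNIV \<sigma>1 \<sigma>2 \<gamma>) x = op_det UNIV (pencil \<sigma>1 \<sigma>2 \<gamma> x)"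
proof -
  interpret comm_ring_hom "\<lambda>G. eval3 G x" by (rule eval3_comm_ring_hom)
  show ?thesis
    unfolding homogeneous_discriminant_poly_eq op_det_def eval3_pencil_matrix[symmetric] by simp
qed

section \<open>Families indexed by multi-indices\<close>

lemma finite_multi_indices [simp]: "finite (multi_indices n)"
  by (rule finite_subset[of _ "{..n} \<times> {..n} \<times> {..n}"]) (auto simp: multi_indices_def)

lemma component_tuple: "component (tuple n f) i = (if i \<in> multi_indices n then f i else 0)"
  unfolding tuple_def
  by (subst component_family_of) (auto intro: finite_subset[OF _ finite_multi_indices[of n]])

lemma support_tuple: "support (tuple n f) \<subseteq> multi_indices n"
  by (auto simp: support_def component_tuple)

lemma component_sum: "component (\<Sum>k\<in>K. w k) i = (\<Sum>k\<in>K. component (w k) i)"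
  by (induction K rule: infinite_finite_induct) (simp_all add: component_add component_zero)

lemma cinner_eq_sum_left:
  "support v \<subseteq> multi_indices n \<Longrightarrow>
    cinner v w = (\<Sum>i\<in>multi_indices n. cinner (component v i) (component w i))"
  by (rule cinner_family_superset) simp_all

lemma cinner_tuple_left:
  "cinner (tuple n f) w = (\<Sum>i\<in>multi_indices n. cinner (f i) (component w i))"
  by (simp add: cinner_eq_sum_left[OF support_tuple] component_tuple)

lemma fin_dim_families:
  assumes "fin_dim (UNIV :: 'e::complex_inner set)"
  shows "fin_dim {w :: (multi_index, 'e) family. support w \<subseteq> multi_indices n}" (is "fin_dim ?W")
proof -
  let ?b = "\<lambda>k. onb (UNIV :: 'e set) ! k" and ?m = "length (onb (UNIV :: 'e set))"
  define \<delta> where "\<delta> = (\<lambda>(i, k). tuple n (\<lambda>j. if j = i then ?b k else 0))"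
  define B where "B = \<delta> ` (multi_indices n \<times> {..<?m})"
  have W: "?W = {w. \<forall>i. i \<notin> multi_indices n \<longrightarrow> component w i = 0}"
    by (auto simp: support_def)
  have sub: "csubspace ?W"
    unfolding W
    by (rule complex_vector.subspaceI)
       (simp_all add: component_add component_zero component_scaleC complex_vector.scale_zero_right)
  have "w \<in> cspan B" if w: "w \<in> ?W" for w
  proof -
    have "w = (\<Sum>i\<in>multi_indices n. \<Sum>k<?m. cinner (component w i) (?b k) *\<^sub>C \<delta> (i, k))"
      (is "_ = ?s")
    proof (rule family_eqI)
      fix j
      show "component w j = component ?s j"
      proof (cases "j \<in> multi_indices n")
        case True
        have "component ?s j = (\<Sum>i\<in>multi_indices n. if i = j then \<Sum>k<?m. cinner (component w i) (?b k) *\<^sub>C ?b k else 0)"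
          unfolding component_sum
          by (intro sum.cong)
             (auto simp: component_scaleC \<delta>_def component_tuple True complex_vector.scale_zero_right)
        also have "\<dots> = component w j"
          using orthonormal_basis_expand[OF onb[OF assms], of "component w j"] True by simp
        finally show ?thesis by simp
      next
        case False
        then have "component w j = 0" using w by (auto simp: support_def)
        moreover have "component ?s j = 0"
          using False
          by (simp add: component_sum component_scaleC \<delta>_def component_tuple complex_vector.scale_zero_right)
        ultimately show ?thesis by simp
      qed
    qed
    also have "?s \<in> cspan B"
      unfolding B_def
      by (intro complex_vector.span_sum complex_vector.span_scale complex_vector.span_base) auto
    finally show ?thesis .
  qed
  moreover have "cspan B \<subseteq> ?W"
    by (rule complex_vector.span_minimal[OF _ sub]) (auto simp: B_def \<delta>_def dest: subsetD[OF support_tuple])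
  ultimately have "cspan B = ?W" by blast
  moreover have "finite B" by (simp add: B_def)
  ultimately show ?thesis using sub by (auto simp: fin_dim_def)
qed

section \<open>Completeness of the Vandermonde vectors\<close>

definition poly_monomial :: "multi_index \<Rightarrow> complex \<Rightarrow> complex poly poly poly" where
  "poly_monomial = (\<lambda>(i0, i1, i2) c. monom (monom (monom c i0) i1) i2)"

definition coeff3 :: "complex poly poly poly \<Rightarrow> multi_index \<Rightarrow> complex" where
  "coeff3 G = (\<lambda>(i0, i1, i2). coeff (coeff (coeff G i2) i1) i0)"

lemma eval3_poly_monomial: "eval3 (poly_monomial i c) x = c * monomial x i"
  by (cases x; cases i) (simp add: poly_monomial_def eval3_def monomial_def poly_monom)

lemma coeff3_poly_monomial: "coeff3 (poly_monomial i c) j = (if i = j then c else 0)"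
  by (cases i; cases j) (auto simp: poly_monomial_def coeff3_def)

lemma coeff3_add: "coeff3 (F + G) i = coeff3 F i + coeff3 G i"
  and coeff3_diff: "coeff3 (F - G) i = coeff3 F i - coeff3 G i"
  by (auto simp: coeff3_def split: prod.splits)

lemma coeff3_sum: "coeff3 (\<Sum>k\<in>K. F k) i = (\<Sum>k\<in>K. coeff3 (F k) i)"
  by (auto simp: coeff3_def coeff_sum split: prod.splits)

lemma coeff3_const_mult: "coeff3 ([:[:[:c:]:]:] * G) i = c * coeff3 G i"
  by (auto simp: coeff3_def split: prod.splits)

definition shift0 :: "(multi_index \<Rightarrow> complex) \<Rightarrow> multi_index \<Rightarrow> complex" where
  "shift0 g = (\<lambda>(i0, i1, i2). case i0 of 0 \<Rightarrow> 0 | Suc k \<Rightarrow> g (k, i1, i2))"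

definition shift1 :: "(multi_index \<Rightarrow> complex) \<Rightarrow> multi_index \<Rightarrow> complex" where
  "shift1 g = (\<lambda>(i0, i1, i2). case i1 of 0 \<Rightarrow> 0 | Suc k \<Rightarrow> g (i0, k, i2))"

definition shift2 :: "(multi_index \<Rightarrow> complex) \<Rightarrow> multi_index \<Rightarrow> complex" where
  "shift2 g = (\<lambda>(i0, i1, i2). case i2 of 0 \<Rightarrow> 0 | Suc k \<Rightarrow> g (i0, i1, k))"

lemma coeff3_shift:
  "coeff3 ([:[:[:0, 1:]:]:] * G) i = shift0 (coeff3 G) i"
  "coeff3 ([:[:0, 1:]:] * G) i = shift1 (coeff3 G) i"
  "coeff3 ([:0, 1:] * G) i = shift2 (coeff3 G) i"
  by (auto simp: coeff3_def shift0_def shift1_def shift2_def coeff_pCons split: prod.splits nat.splits)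

lemma multi_indices_Suc:
  "(Suc k0, k1, k2) \<in> multi_indices n \<longleftrightarrow> (k0, k1, k2) \<in> multi_indices (n - 1)"
  "(k0, Suc k1, k2) \<in> multi_indices n \<longleftrightarrow> (k0, k1, k2) \<in> multi_indices (n - 1)"
  "(k0, k1, Suc k2) \<in> multi_indices n \<longleftrightarrow> (k0, k1, k2) \<in> multi_indices (n - 1)"
  by (auto simp: multi_indices_def)

lemma sum_shift:
  "(\<Sum>i\<in>multi_indices n. F i * shift0 g i) =
     (\<Sum>(k0, k1, k2)\<in>multi_indices (n - 1). F (Suc k0, k1, k2) * g (k0, k1, k2))"
  "(\<Sum>i\<in>multi_indices n. F i * shift1 g i) =
     (\<Sum>(k0, k1, k2)\<in>multi_indices (n - 1). F (k0, Suc k1, k2) * g (k0, k1, k2))"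
  "(\<Sum>i\<in>multi_indices n. F i * shift2 g i) =
     (\<Sum>(k0, k1, k2)\<in>multi_indices (n - 1). F (k0, k1, Suc k2) * g (k0, k1, k2))"
proof -
  have *: "(\<Sum>i\<in>multi_indices n. H i) = (\<Sum>k\<in>multi_indices (n - 1). H (s k))"
    if "\<And>i. i \<in> multi_indices n - s ` multi_indices (n - 1) \<Longrightarrow> H i = 0"
      "inj_on s (multi_indices (n - 1))" "s ` multi_indices (n - 1) \<subseteq> multi_indices n"
    for s :: "multi_index \<Rightarrow> multi_index" and H :: "multi_index \<Rightarrow> complex"
    using sum.mono_neutral_right[OF finite_multi_indices that(3), of H] that(1)
      sum.reindex[OF that(2), of H] by (simp add: o_def)
  show "(\<Sum>i\<in>multi_indices n. F i * shift0 g i) =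
     (\<Sum>(k0, k1, k2)\<in>multi_indices (n - 1). F (Suc k0, k1, k2) * g (k0, k1, k2))"
  proof -
    let ?s = "\<lambda>(k0, k1, k2). (Suc k0, k1, k2)"
    have "(\<Sum>i\<in>multi_indices n. F i * shift0 g i) = (\<Sum>k\<in>multi_indices (n - 1). F (?s k) * shift0 g (?s k))"
    proof (rule *)
      fix i assume i: "i \<in> multi_indices n - ?s ` multi_indices (n - 1)"
      obtain i0 i1 i2 where "i = (i0, i1, i2)" by (cases i)
      with i show "F i * shift0 g i = 0"
        by (cases i0) (auto simp: shift0_def multi_indices_Suc image_iff)
    qed (auto simp: inj_on_def multi_indices_Suc)
    then show ?thesis by (simp add: shift0_def case_prod_beta)
  qed
  show "(\<Sum>i\<in>multi_indices n. F i * shift1 g i) =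
     (\<Sum>(k0, k1, k2)\<in>multi_indices (n - 1). F (k0, Suc k1, k2) * g (k0, k1, k2))"
  proof -
    let ?s = "\<lambda>(k0, k1, k2). (k0, Suc k1, k2)"
    have "(\<Sum>i\<in>multi_indices n. F i * shift1 g i) = (\<Sum>k\<in>multi_indices (n - 1). F (?s k) * shift1 g (?s k))"
    proof (rule *)
      fix i assume i: "i \<in> multi_indices n - ?s ` multi_indices (n - 1)"
      obtain i0 i1 i2 where "i = (i0, i1, i2)" by (cases i)
      with i show "F i * shift1 g i = 0"
        by (cases i1) (auto simp: shift1_def multi_indices_Suc image_iff)
    qed (auto simp: inj_on_def multi_indices_Suc)
    then show ?thesis by (simp add: shift1_def case_prod_beta)
  qed
  show "(\<Sum>i\<in>multi_indices n. F i * shift2 g i) =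
     (\<Sum>(k0, k1, k2)\<in>multi_indices (n - 1). F (k0, k1, Suc k2) * g (k0, k1, k2))"
  proof -
    let ?s = "\<lambda>(k0, k1, k2). (k0, k1, Suc k2)"
    have "(\<Sum>i\<in>multi_indices n. F i * shift2 g i) = (\<Sum>k\<in>multi_indices (n - 1). F (?s k) * shift2 g (?s k))"
    proof (rule *)
      fix i assume i: "i \<in> multi_indices n - ?s ` multi_indices (n - 1)"
      obtain i0 i1 i2 where "i = (i0, i1, i2)" by (cases i)
      with i show "F i * shift2 g i = 0"
        by (cases i2) (auto simp: shift2_def multi_indices_Suc image_iff)
    qed (auto simp: inj_on_def multi_indices_Suc)
    then show ?thesis by (simp add: shift2_def case_prod_beta)
  qed
qed

lemma monomial_scale:
  assumes "i \<in> multi_indices n"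
  shows "monomial (t * x0, t * x1, t * x2) i = t ^ (n - 1) * monomial (x0, x1, x2) i"
proof -
  obtain i0 i1 i2 where i: "i = (i0, i1, i2)" by (cases i)
  then have "n - 1 = i0 + i1 + i2" using assms by (auto simp: multi_indices_def)
  then show ?thesis by (simp add: i monomial_def power_mult_distrib power_add mult_ac)
qed

locale irreducible_pencil =
  fixes \<sigma>1 \<sigma>2 \<gamma> :: "'e::complex_inner \<Rightarrow> 'e"
  assumes fin_dim_E: "fin_dim (UNIV :: 'e set)"
    and selfadjoint: "selfadjoint_on UNIV \<sigma>1" "selfadjoint_on UNIV \<sigma>2" "selfadjoint_on UNIV \<gamma>"
    and irreducible_affine: "Factorial_Ring.irreducible (discriminant_poly UNIV \<sigma>1 \<sigma>2 \<gamma>)"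
    and irreducible_homogeneous:
      "Factorial_Ring.irreducible (homogeneous_discriminant_poly UNIV \<sigma>1 \<sigma>2 \<gamma>)"
begin

abbreviation "P x \<equiv> pencil \<sigma>1 \<sigma>2 \<gamma> x"
abbreviation "V n \<equiv> principal_subspace n \<sigma>1 \<sigma>2 \<gamma>"

definition curve :: "(complex \<times> complex) set" where
  "curve = {(y1, y2). op_det UNIV (P (1, y1, y2)) = 0}"

lemma clinear_coeffs: "clinear \<sigma>1" "clinear \<sigma>2" "clinear \<gamma>"
  using selfadjoint by (simp_all add: selfadjoint_on_def clinear_def)

lemma cinner_coeffs:
  "cinner (\<sigma>1 u) v = cinner u (\<sigma>1 v)" "cinner (\<sigma>2 u) v = cinner u (\<sigma>2 v)"
  "cinner (\<gamma> u) v = cinner u (\<gamma> v)"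
  using selfadjoint by (simp_all add: selfadjoint_on_def)

lemmas coeffs_linear = clinear_coeffs[THEN clinear_add] clinear_coeffs[THEN clinear_diff]
  clinear_coeffs[THEN clinear_scaleC] clinear_coeffs[THEN clinear_zero]

lemma clinear_P: "clinear (P x)"
  by (intro clinear_pencil clinear_coeffs)

lemma P_scale: "P (t * x0, t * x1, t * x2) e = t *\<^sub>C P (x0, x1, x2) e"
  by (simp add: pencil_def complex_vector.scale_right_diff_distrib scaleC_add_right scaleC_scaleC)

lemma curve_iff: "(y1, y2) \<in> curve \<longleftrightarrow> (\<exists>e. e \<noteq> 0 \<and> P (1, y1, y2) e = 0)"
  unfolding curve_def using op_det_eq_0_iff[OF fin_dim_E clinear_P] by auto

lemma curve_eq: "curve = {y. eval2 (discriminant_poly UNIV \<sigma>1 \<sigma>2 \<gamma>) y = 0}"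
  by (auto simp: curve_def eval2_discriminant_poly)

text \<open>The map whose kernel in the space of all families is the principal subspace.\<close>

definition relation :: "(multi_index, 'e) family \<Rightarrow> multi_index \<Rightarrow> 'e" where
  "relation w = (\<lambda>(k0, k1, k2). \<sigma>2 (component w (k0, Suc k1, k2)) - \<sigma>1 (component w (k0, k1, Suc k2))
     + \<gamma> (component w (Suc k0, k1, k2)))"

lemma in_V_iff:
  "w \<in> V n \<longleftrightarrow> support w \<subseteq> multi_indices n \<and> (\<forall>k\<in>multi_indices (n - 1). relation w k = 0)"
proof -
  have "(k0, k1, k2) \<in> multi_indices (n - 1) \<longleftrightarrow> k0 + k1 + k2 + 2 = n" for k0 k1 k2
    by (auto simp: multi_indices_def)
  then show ?thesis by (simp add: principal_subspace_def relation_def Ball_def)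
qed

lemma relation_linear: "relation 0 k = 0" "relation (v + w) k = relation v k + relation w k"
  "relation (c *\<^sub>C w) k = c *\<^sub>C relation w k"
  by (auto simp: relation_def component_zero component_add component_scaleC coeffs_linear
      scaleC_add_right complex_vector.scale_right_diff_distrib split: prod.splits)

lemma V_support: "w \<in> V n \<Longrightarrow> support w \<subseteq> multi_indices n"
  by (simp add: in_V_iff)

lemma fin_dim_V: "fin_dim (V n)"
proof (rule fin_dim_subset[OF fin_dim_families[OF fin_dim_E, of n]])
  have W: "csubspace {w :: (multi_index, 'e) family. support w \<subseteq> multi_indices n}"
    using fin_dim_families[OF fin_dim_E] by (rule fin_dim_csubspace)
  show "csubspace (V n)"
    using complex_vector.subspace_0[OF W] complex_vector.subspace_add[OF W]
      complex_vector.subspace_scale[OF W]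
    by (intro complex_vector.subspaceI)
       (simp_all add: in_V_iff relation_linear complex_vector.scale_zero_right)
qed (auto simp: in_V_iff)

lemma csubspace_V: "csubspace (V n)"
  using fin_dim_V by (rule fin_dim_csubspace)

lemma component_vandermonde:
  "component (vandermonde n x e) i = (if i \<in> multi_indices n then monomial x i *\<^sub>C e else 0)"
  by (simp add: vandermonde_def component_tuple)

lemma vandermonde_in_V:
  assumes "P x e = 0" shows "vandermonde n x e \<in> V n"
  unfolding in_V_iff
proof (intro conjI ballI)
  show "support (vandermonde n x e) \<subseteq> multi_indices n"
    unfolding vandermonde_def by (rule support_tuple)
  fix k assume k: "k \<in> multi_indices (n - 1)"
  obtain x0 x1 x2 k0 k1 k2 where xk: "x = (x0, x1, x2)" "k = (k0, k1, k2)" by (cases x; cases k)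
  have "relation (vandermonde n x e) k = monomial x k *\<^sub>C P x e"
    using k
    by (simp add: relation_def component_vandermonde multi_indices_def coeffs_linear xk monomial_def
        pencil_def scaleC_scaleC scaleC_add_right complex_vector.scale_right_diff_distrib mult_ac)
  then show "relation (vandermonde n x e) k = 0"
    using assms by (simp add: complex_vector.scale_zero_right)
qed

text \<open>The factorization \<open>f = g M\<close> is obtained in three variables, where homogeneity makes coefficient
  comparison respect degrees: the coefficients of \<open>g\<close> in degree \<open>n - 2\<close>, paired with the defining
  equations of the principal subspace, give \<open>\<langle>u, u\<rangle>\<close>.\<close>

lemma vandermonde_complete:
  assumes u: "u \<in> V n" and Z: "infinite Z" "Z \<subseteq> curve"
    and orth: "\<And>y1 y2 e. (y1, y2) \<in> Z \<Longrightarrow> P (1, y1, y2) e = 0 \<Longrightarrow>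
      cinner u (vandermonde n (1, y1, y2) e) = 0"
  shows "u = 0"
proof -
  define m where "m = length (onb (UNIV :: 'e set))"
  define b where "b k = onb (UNIV :: 'e set) ! k" for k
  define M where "M = pencil_matrix \<sigma>1 \<sigma>2 \<gamma>"
  define \<Delta> where "\<Delta> = homogeneous_discriminant_poly UNIV \<sigma>1 \<sigma>2 \<gamma>"
  define N where "N = adj_mat M"
  have \<Delta>: "\<Delta> = Determinant.det M" by (simp add: \<Delta>_def M_def homogeneous_discriminant_poly_eq)
  have M: "M \<in> carrier_mat m m" unfolding M_def m_def by (rule pencil_matrix_carrier)
  note N = adj_mat[OF M, folded N_def \<Delta>]
  \<comment> \<open>the row vector \<open>f\<close>: on the coordinates of \<open>e\<close> it takes the value \<open>\<langle>vandermonde n x e, u\<rangle>\<close>\<close>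
  define f where "f k = (\<Sum>i\<in>multi_indices n. poly_monomial i (cinner (b k) (component u i)))" for k
  define r where "r j = (\<Sum>k<m. f k * N $$ (k, j))" for j
  have vanish: "eval3 (r j) (t, t * y1, t * y2) = 0"
    if j: "j < m" and t: "t \<noteq> 0" and y: "(y1, y2) \<in> Z" for j t y1 y2
  proof -
    let ?x = "(t, t * y1, t * y2)"
    interpret ev: comm_ring_hom "\<lambda>G. eval3 G ?x" by (rule eval3_comm_ring_hom)
    \<comment> \<open>a column of the adjugate is a kernel vector, since \<open>M N = \<Delta>\<close> vanishes at the point\<close>
    define c where "c = vec m (\<lambda>k. eval3 (N $$ (k, j)) ?x)"
    define e :: 'e where "e = of_coords UNIV c"
    have "op_det UNIV (P (1, y1, y2)) = 0" using y Z(2) by (auto simp: curve_def)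
    then obtain e0 where e0: "e0 \<noteq> 0" "P (1, y1, y2) e0 = 0"
      using op_det_eq_0_iff[OF fin_dim_E clinear_P] by auto
    then have "P ?x e0 = 0" using P_scale[of t 1 y1 y2 e0] by (simp add: complex_vector.scale_zero_right)
    then have "op_det UNIV (P ?x) = 0"
      using e0(1) op_det_eq_0_iff[OF fin_dim_E clinear_P] by auto
    then have \<Delta>0: "eval3 \<Delta> ?x = 0"
      unfolding \<Delta>_def eval3_homogeneous_discriminant_poly .
    have "P ?x e = 0"
    proof (rule eq_0_if_orthogonal_onb[OF fin_dim_E])
      fix i assume "i < length (onb (UNIV :: 'e set))"
      then have i: "i < m" by (simp add: m_def)
      have "cinner (P ?x e) (onb UNIV ! i) = (op_matrix UNIV (P ?x) *\<^sub>v c) $ i"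
        unfolding e_def using i by (subst op_matrix_mult_vec[OF clinear_P]) (simp_all add: c_def m_def)
      also have "\<dots> = (\<Sum>k<m. eval3 (M $$ (i, k)) ?x * eval3 (N $$ (k, j)) ?x)"
        unfolding eval3_pencil_matrix[symmetric] M_def[symmetric] using M i
        by (simp add: scalar_prod_def c_def lessThan_atLeast0)
      also have "\<dots> = eval3 ((M * N) $$ (i, j)) ?x"
        using M N(1) i j by (simp add: scalar_prod_def lessThan_atLeast0 ev.hom_sum ev.hom_mult)
      also have "\<dots> = 0"
        using i j \<Delta>0 by (simp add: N(2) ev.hom_mult)
      finally show "cinner (P ?x e) (onb UNIV ! i) = 0" .
    qed simp
    then have Pe: "P (1, y1, y2) e = 0"
      using P_scale[of t 1 y1 y2 e] t by (simp add: complex_vector.scale_eq_0_iff)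
    have "eval3 (r j) ?x = (\<Sum>k<m. (\<Sum>i\<in>multi_indices n. cinner (b k) (component u i) * monomial ?x i) * c $ k)"
      by (simp add: r_def f_def ev.hom_sum ev.hom_mult eval3_poly_monomial c_def)
    also have "\<dots> = (\<Sum>i\<in>multi_indices n. monomial ?x i * (\<Sum>k<m. c $ k * cinner (b k) (component u i)))"
      unfolding sum_distrib_right sum_distrib_left
      by (subst sum.swap) (simp add: mult_ac)
    also have "\<dots> = (\<Sum>i\<in>multi_indices n. monomial ?x i * cinner e (component u i))"
      by (simp add: e_def of_coords_def cinner_linear_simps m_def b_def)
    also have "\<dots> = t ^ (n - 1) * cinner (vandermonde n (1, y1, y2) e) u"
      using monomial_scale[of _ n t 1 y1 y2]
      by (simp add: vandermonde_def cinner_tuple_left cinner_scaleC_left sum_distrib_left mult.assoc)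
    also have "cinner (vandermonde n (1, y1, y2) e) u = 0"
      using orth[OF y Pe] by (subst cinner_commute) simp
    finally show ?thesis by simp
  qed
  have "\<Delta> dvd r j" if j: "j < m" for j
  proof (rule irreducible_dvd_if_vanishes_on_cone[OF _ Z(1)])
    show "Factorial_Ring.irreducible \<Delta>" unfolding \<Delta>_def by (rule irreducible_homogeneous)
  next
    fix t y1 y2 :: complex assume t: "t \<noteq> 0" and y: "(y1, y2) \<in> Z"
    show "eval3 (r j) (t, t * y1, t * y2) = 0" by (rule vanish[OF j t y])
    obtain e where "e \<noteq> 0" "P (1, y1, y2) e = 0" using y Z(2) curve_iff by blast
    then have "op_det UNIV (P (t, t * y1, t * y2)) = 0"
      using P_scale[of t 1 y1 y2 e] op_det_eq_0_iff[OF fin_dim_E clinear_P]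
      by (auto simp: complex_vector.scale_zero_right)
    then show "eval3 \<Delta> (t, t * y1, t * y2) = 0"
      unfolding \<Delta>_def eval3_homogeneous_discriminant_poly .
  qed
  then have "\<forall>j\<in>{..<m}. \<exists>q. r j = \<Delta> * q" by (simp add: dvd_def)
  then obtain g where g: "\<And>j. j < m \<Longrightarrow> r j = \<Delta> * g j"
    using bchoice[of "{..<m}" "\<lambda>j q. r j = \<Delta> * q"] by auto
  \<comment> \<open>multiply \<open>f N = \<Delta> g\<close> by \<open>M\<close> from the right, use \<open>N M = \<Delta>\<close> and cancel \<open>\<Delta>\<close>\<close>
  have f: "f l = (\<Sum>j<m. g j * M $$ (j, l))" if l: "l < m" for l
  proof -
    have "\<Delta> * (\<Sum>j<m. g j * M $$ (j, l)) = (\<Sum>j<m. r j * M $$ (j, l))"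
      by (simp add: g sum_distrib_left mult.assoc)
    also have "\<dots> = (\<Sum>k<m. f k * (\<Sum>j<m. N $$ (k, j) * M $$ (j, l)))"
      unfolding r_def sum_distrib_right sum_distrib_left by (subst sum.swap) (simp add: mult.assoc)
    also have "\<dots> = (\<Sum>k<m. f k * (N * M) $$ (k, l))"
      using M N(1) l by (intro sum.cong) (simp_all add: scalar_prod_def lessThan_atLeast0)
    also have "\<dots> = (\<Sum>k<m. if k = l then f k * \<Delta> else 0)"
      unfolding N(3) using l by (intro sum.cong) auto
    also have "\<dots> = \<Delta> * f l" using l by (simp add: mult.commute)
    finally show ?thesis using irreducible_homogeneous by (auto simp: \<Delta>_def)
  qed
  have coeff_f: "cinner (b l) (component u i) =
      (\<Sum>j<m. cinner (\<gamma> (b l)) (b j) * shift0 (coeff3 (g j)) i + cinner (\<sigma>2 (b l)) (b j) * shift1 (coeff3 (g j)) i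
        - cinner (\<sigma>1 (b l)) (b j) * shift2 (coeff3 (g j)) i)"
    if i: "i \<in> multi_indices n" and l: "l < m" for i l
  proof -
    have "cinner (b l) (component u i) = coeff3 (f l) i"
      unfolding f_def coeff3_sum coeff3_poly_monomial using i by simp
    also have "\<dots> = (\<Sum>j<m. coeff3 (g j * M $$ (j, l)) i)"
      by (simp only: f[OF l] coeff3_sum)
    also have "\<dots> = (\<Sum>j<m. cinner (\<gamma> (b l)) (b j) * shift0 (coeff3 (g j)) i + cinner (\<sigma>2 (b l)) (b j) * shift1 (coeff3 (g j)) i
        - cinner (\<sigma>1 (b l)) (b j) * shift2 (coeff3 (g j)) i)"
    proof (rule sum.cong[OF refl])
      fix j assume "j \<in> {..<m}"
      then have j: "j < m" by simp
      have "g j * M $$ (j, l) =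
          [:[:[:cinner (\<gamma> (b l)) (b j):]:]:] * ([:[:[:0, 1:]:]:] * g j)
          + [:[:[:cinner (\<sigma>2 (b l)) (b j):]:]:] * ([:[:0, 1:]:] * g j)
          - [:[:[:cinner (\<sigma>1 (b l)) (b j):]:]:] * ([:0, 1:] * g j)"
      proof -
        have "M $$ (j, l) = [:[:[:0, 1:]:]:] * [:[:[:cinner (\<gamma> (b l)) (b j):]:]:]
          + [:[:0, 1:]:] * [:[:[:cinner (\<sigma>2 (b l)) (b j):]:]:]
          - [:0, 1:] * [:[:[:cinner (\<sigma>1 (b l)) (b j):]:]:]"
          using j l unfolding M_def pencil_matrix_def Let_def m_def b_def
          by (simp add: op_matrix_onb del: mult_pCons_left mult_pCons_right)
        then show ?thesis by (simp only:) (simp only: algebra_simps)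
      qed
      then show "coeff3 (g j * M $$ (j, l)) i =
          cinner (\<gamma> (b l)) (b j) * shift0 (coeff3 (g j)) i + cinner (\<sigma>2 (b l)) (b j) * shift1 (coeff3 (g j)) i
            - cinner (\<sigma>1 (b l)) (b j) * shift2 (coeff3 (g j)) i"
        by (simp only: coeff3_add coeff3_diff coeff3_const_mult coeff3_shift)
    qed
    finally show ?thesis .
  qed
  have expand: "(\<Sum>l<m. cinner v (b l) * cinner (T (b l)) w) = cinner (T v) w"
    if "clinear T" for T :: "'e \<Rightarrow> 'e" and v w
  proof -
    have "cinner (T (\<Sum>l<m. cinner v (b l) *\<^sub>C b l)) w = (\<Sum>l<m. cinner v (b l) * cinner (T (b l)) w)"
      by (simp add: clinear_sum[OF that] clinear_scaleC[OF that] cinner_linear_simps)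
    then show ?thesis
      using orthonormal_basis_expand[OF onb[OF fin_dim_E], of v] by (simp add: m_def b_def)
  qed
  have "cinner u u = (\<Sum>i\<in>multi_indices n. cinner (component u i) (component u i))"
    by (rule cinner_eq_sum_left[OF V_support[OF u]])
  also have "\<dots> = (\<Sum>i\<in>multi_indices n. \<Sum>l<m. cinner (component u i) (b l) * cinner (b l) (component u i))"
    using expand[of "\<lambda>x. x"] by (simp add: clinear_def)
  also have "\<dots> = (\<Sum>i\<in>multi_indices n. \<Sum>j<m.
      cinner (\<gamma> (component u i)) (b j) * shift0 (coeff3 (g j)) i
      + cinner (\<sigma>2 (component u i)) (b j) * shift1 (coeff3 (g j)) i
      - cinner (\<sigma>1 (component u i)) (b j) * shift2 (coeff3 (g j)) i)"
  proof (rule sum.cong[OF refl])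
    fix i assume i: "i \<in> multi_indices n"
    have "(\<Sum>l<m. cinner (component u i) (b l) * cinner (b l) (component u i)) =
      (\<Sum>l<m. \<Sum>j<m. cinner (component u i) (b l) * cinner (\<gamma> (b l)) (b j) * shift0 (coeff3 (g j)) i
        + cinner (component u i) (b l) * cinner (\<sigma>2 (b l)) (b j) * shift1 (coeff3 (g j)) i
        - cinner (component u i) (b l) * cinner (\<sigma>1 (b l)) (b j) * shift2 (coeff3 (g j)) i)"
      by (intro sum.cong refl) (simp add: coeff_f[OF i] sum_distrib_left algebra_simps)
    also have "\<dots> = (\<Sum>j<m. (\<Sum>l<m. cinner (component u i) (b l) * cinner (\<gamma> (b l)) (b j)) * shift0 (coeff3 (g j)) i
        + (\<Sum>l<m. cinner (component u i) (b l) * cinner (\<sigma>2 (b l)) (b j)) * shift1 (coeff3 (g j)) i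
        - (\<Sum>l<m. cinner (component u i) (b l) * cinner (\<sigma>1 (b l)) (b j)) * shift2 (coeff3 (g j)) i)"
      by (subst sum.swap) (simp add: sum_distrib_right sum.distrib sum_subtractf)
    finally show "(\<Sum>l<m. cinner (component u i) (b l) * cinner (b l) (component u i)) =
      (\<Sum>j<m. cinner (\<gamma> (component u i)) (b j) * shift0 (coeff3 (g j)) i
      + cinner (\<sigma>2 (component u i)) (b j) * shift1 (coeff3 (g j)) i
      - cinner (\<sigma>1 (component u i)) (b j) * shift2 (coeff3 (g j)) i)"
      by (simp only: expand[OF clinear_coeffs(1)] expand[OF clinear_coeffs(2)] expand[OF clinear_coeffs(3)])
  qed
  also have "\<dots> = (\<Sum>j<m. (\<Sum>i\<in>multi_indices n. cinner (\<gamma> (component u i)) (b j) * shift0 (coeff3 (g j)) i)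
      + (\<Sum>i\<in>multi_indices n. cinner (\<sigma>2 (component u i)) (b j) * shift1 (coeff3 (g j)) i)
      - (\<Sum>i\<in>multi_indices n. cinner (\<sigma>1 (component u i)) (b j) * shift2 (coeff3 (g j)) i))"
    by (subst sum.swap) (simp add: sum.distrib sum_subtractf)
  \<comment> \<open>shifting the summation moves the adjoint of the defining map onto \<open>u\<close>\<close>
  also have "\<dots> = (\<Sum>j<m. \<Sum>k\<in>multi_indices (n - 1). coeff3 (g j) k * cinner (relation u k) (b j))"
    unfolding sum_shift sum.distrib[symmetric] sum_subtractf[symmetric]
    by (intro sum.cong refl) (auto simp: relation_def cinner_linear_simps algebra_simps)
  also have "\<dots> = 0"
    using u by (intro sum.neutral ballI) (auto simp: in_V_iff cinner_zero_left)
  finally show ?thesis by (simp add: cinner_self_eq_0_iff)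
qed

end

section \<open>Bezout operators on Vandermonde vectors\<close>

lemma cross_product_multiple:
  fixes g s1 s2 x0 x1 x2 w1 w2 :: complex
  assumes x: "x0 * g + x1 * s2 - x2 * s1 = 0" and w: "g + w1 * s2 - w2 * s1 = 0"
    and independent: "x1 \<noteq> x0 * w1 \<or> x2 \<noteq> x0 * w2"
  obtains c where "g = c * (x1 * w2 - x2 * w1)" "s2 = c * (x2 - x0 * w2)" "s1 = c * (x1 - x0 * w1)"
proof -
  have g: "g = w2 * s1 - w1 * s2" using w by (simp add: algebra_simps)
  have eq: "s1 * (x2 - x0 * w2) = s2 * (x1 - x0 * w1)"
    using x unfolding g by (simp add: algebra_simps)
  have g': "g = c * (x1 * w2 - x2 * w1)"
    if "s2 = c * (x2 - x0 * w2)" "s1 = c * (x1 - x0 * w1)" for c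
    unfolding g that by (simp add: algebra_simps)
  have "\<exists>c. s2 = c * (x2 - x0 * w2) \<and> s1 = c * (x1 - x0 * w1)"
  proof (cases "x1 = x0 * w1")
    case False
    then show ?thesis
      using eq by (intro exI[of _ "s1 / (x1 - x0 * w1)"]) (simp add: field_simps)
  next
    case True
    then show ?thesis
      using eq independent by (intro exI[of _ "s2 / (x2 - x0 * w2)"]) (simp add: field_simps)
  qed
  then show thesis using that g' by blast
qed

lemma is_bezout_matrices_identity:
  assumes "is_bezout_matrices n p q (b10, b20, b12)"
  shows "p (x0, x1, x2) * q (y0, y1, y2) - q (x0, x1, x2) * p (y0, y1, y2) =
    (\<Sum>i\<in>multi_indices n. \<Sum>j\<in>multi_indices n. monomial (x0, x1, x2) i * monomial (y0, y1, y2) j *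
      (b12 i j * (x1 * y2 - x2 * y1) + b10 i j * (x1 * y0 - x0 * y1) + b20 i j * (x2 * y0 - x0 * y2)))"
proof -
  have "p (x0, x1, x2) * q (y0, y1, y2) - q (x0, x1, x2) * p (y0, y1, y2) =
        (\<Sum>i\<in>multi_indices n. \<Sum>j\<in>multi_indices n.
           b10 i j * monomial (x0, x1, x2) i * (x1 * y0 - x0 * y1) * monomial (y0, y1, y2) j +
           b20 i j * monomial (x0, x1, x2) i * (x2 * y0 - x0 * y2) * monomial (y0, y1, y2) j +
           b12 i j * monomial (x0, x1, x2) i * (x1 * y2 - x2 * y1) * monomial (y0, y1, y2) j)"
    using assms unfolding is_bezout_matrices_def Let_def by blast
  also have "\<dots> = (\<Sum>i\<in>multi_indices n. \<Sum>j\<in>multi_indices n. monomial (x0, x1, x2) i * monomial (y0, y1, y2) j *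
      (b12 i j * (x1 * y2 - x2 * y1) + b10 i j * (x1 * y0 - x0 * y1) + b20 i j * (x2 * y0 - x0 * y2)))"
    by (intro sum.cong refl) (simp only: distrib_left mult_ac add_ac)
  finally show ?thesis .
qed

lemma cnj_monomial: "cnj (monomial (x0, x1, x2) i) = monomial (cnj x0, cnj x1, cnj x2) i"
  by (cases i) (simp add: monomial_def)

context irreducible_pencil
begin

abbreviation "B n \<beta> \<equiv> bezout_operator n \<sigma>1 \<sigma>2 \<gamma> \<beta>"

text \<open>The symmetry of the three matrices is used to let the first index go with the first argument of
  the inner product, as in the defining identity.\<close>

lemma cinner_bezout_operator:
  assumes "is_bezout_matrices n p q (b10, b20, b12)"
  shows "cinner (B n (b10, b20, b12) w) v = (\<Sum>i\<in>multi_indices n. \<Sum>j\<in>multi_indices n.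
    b12 i j * cinner (\<gamma> (component w i)) (component v j) + b10 i j * cinner (\<sigma>1 (component w i)) (component v j)
    + b20 i j * cinner (\<sigma>2 (component w i)) (component v j))"
proof -
  have sym: "b10 i j = b10 j i \<and> b20 i j = b20 j i \<and> b12 i j = b12 j i"
    if "i \<in> multi_indices n" "j \<in> multi_indices n" for i j
    using assms that unfolding is_bezout_matrices_def by blast
  have "cinner (B n (b10, b20, b12) w) v = (\<Sum>i\<in>multi_indices n. \<Sum>j\<in>multi_indices n.
    b12 i j * cinner (\<gamma> (component w j)) (component v i) + b10 i j * cinner (\<sigma>1 (component w j)) (component v i)
    + b20 i j * cinner (\<sigma>2 (component w j)) (component v i))"
    by (simp add: bezout_operator_def cinner_tuple_left cinner_linear_simps)
  also have "\<dots> = (\<Sum>j\<in>multi_indices n. \<Sum>i\<in>multi_indices n.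
    b12 j i * cinner (\<gamma> (component w j)) (component v i) + b10 j i * cinner (\<sigma>1 (component w j)) (component v i)
    + b20 j i * cinner (\<sigma>2 (component w j)) (component v i))"
    by (subst sum.swap) (intro sum.cong refl, metis sym)
  finally show ?thesis .
qed

lemma clinear_bezout_operator: "clinear (B n \<beta>)"
proof -
  obtain b10 b20 b12 where \<beta>: "\<beta> = (b10, b20, b12)" by (cases \<beta>)
  show ?thesis
    unfolding clinear_def
    by (intro conjI allI family_eqI)
       (simp_all add: \<beta> bezout_operator_def component_tuple component_add component_scaleC coeffs_linear
         scaleC_add_right sum.distrib[symmetric] complex_vector.scale_sum_right scaleC_scaleC
         complex_vector.scale_zero_right add_ac mult_ac)
qed

text \<open>The defining relations of the kernels say that \<open>(\<langle>\<gamma> e, f\<rangle>, \<langle>\<sigma>\<^sub>2 e, f\<rangle>, - \<langle>\<sigma>\<^sub>1 e, f\<rangle>)\<close> is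
  orthogonal to \<open>x\<close> and to the conjugate of \<open>y\<close>, so it is a multiple \<open>c\<close> of their cross product, and
  the cross product is what the matrices of a Bezout identity are contracted with.\<close>

lemma vandermonde_pairing:
  assumes e: "P (x0, x1, x2) e = 0" and f: "P (1, y1, y2) f = 0"
    and independent: "x1 \<noteq> x0 * cnj y1 \<or> x2 \<noteq> x0 * cnj y2"
  obtains c where
    "cinner (\<gamma> e) f = c * (x1 * cnj y2 - x2 * cnj y1)"
    "cinner (\<sigma>2 e) f = c * (x2 - x0 * cnj y2)"
    "cinner (\<sigma>1 e) f = c * (x1 - x0 * cnj y1)"
    "\<And>n p q \<beta>. is_bezout_matrices n p q \<beta> \<Longrightarrow>
      cinner (B n \<beta> (vandermonde n (x0, x1, x2) e)) (vandermonde n (1, y1, y2) f) =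
        c * (p (x0, x1, x2) * q (1, cnj y1, cnj y2) - q (x0, x1, x2) * p (1, cnj y1, cnj y2))"
proof -
  have "cinner (P (x0, x1, x2) e) f = 0" using e by (simp add: cinner_zero_left)
  then have 1: "x0 * cinner (\<gamma> e) f + x1 * cinner (\<sigma>2 e) f - x2 * cinner (\<sigma>1 e) f = 0"
    by (simp add: pencil_def cinner_linear_simps)
  have "cinner e (P (1, y1, y2) f) = 0" using f by (simp add: cinner_zero_right)
  then have 2: "cinner (\<gamma> e) f + cnj y1 * cinner (\<sigma>2 e) f - cnj y2 * cinner (\<sigma>1 e) f = 0"
    by (simp add: pencil_def cinner_linear_simps cinner_coeffs)
  obtain c where c: "cinner (\<gamma> e) f = c * (x1 * cnj y2 - x2 * cnj y1)"
    "cinner (\<sigma>2 e) f = c * (x2 - x0 * cnj y2)" "cinner (\<sigma>1 e) f = c * (x1 - x0 * cnj y1)"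
    using cross_product_multiple[OF 1 2 independent] by blast
  show thesis
  proof (rule that[OF c])
    fix n p q and \<beta> :: bezout_matrices
    assume bez: "is_bezout_matrices n p q \<beta>"
    obtain b10 b20 b12 where \<beta>: "\<beta> = (b10, b20, b12)" by (cases \<beta>)
    note bez' = bez[unfolded \<beta>]
    show "cinner (B n \<beta> (vandermonde n (x0, x1, x2) e)) (vandermonde n (1, y1, y2) f) =
        c * (p (x0, x1, x2) * q (1, cnj y1, cnj y2) - q (x0, x1, x2) * p (1, cnj y1, cnj y2))"
      unfolding \<beta> cinner_bezout_operator[OF bez'] is_bezout_matrices_identity[OF bez']
        sum_distrib_left
      by (intro sum.cong refl)
         (simp add: component_vandermonde coeffs_linear cinner_scaleC_left cinner_scaleC_right
           cnj_monomial c algebra_simps)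
  qed
qed

lemma infinite_curve: "infinite curve"
proof -
  have "{(y1, y2). eval2 (discriminant_poly UNIV \<sigma>1 \<sigma>2 \<gamma>) (y1, y2) = 0 \<and> (0 < cmod y1 \<or> 0 < cmod y2)} \<subseteq> curve"
    by (auto simp: curve_eq)
  then show ?thesis
    using affine_curve_unbounded[OF irreducible_affine, of 0] finite_subset by blast
qed

text \<open>The pencil at the conjugate point is the adjoint of the pencil.\<close>

lemma cnj_curve: "(y1, y2) \<in> curve \<Longrightarrow> (cnj y1, cnj y2) \<in> curve"
proof -
  have "cinner (P (1, y1, y2) u) v = cinner u (P (1, cnj y1, cnj y2) v)" for u v
    by (simp add: pencil_def cinner_linear_simps cinner_coeffs)
  then have "op_det UNIV (P (1, cnj y1, cnj y2)) = cnj (op_det UNIV (P (1, y1, y2)))"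
    using op_det_adjoint[OF fin_dim_E] by blast
  then show "(y1, y2) \<in> curve \<Longrightarrow> (cnj y1, cnj y2) \<in> curve"
    by (simp add: curve_def)
qed

lemma compression_V:
  assumes "clinear T"
  shows "clinear (compression (V n) T)" "compression (V n) T u \<in> V n"
    "u \<in> V n \<Longrightarrow> v \<in> V n \<Longrightarrow> cinner (compression (V n) T u) v = cinner (T u) v"
  using assms fin_dim_V[of n]
  by (simp_all add: compression_def clinear_compose clinear_proj proj_in cinner_proj_left proj_fixed)

text \<open>Vectors of the principal subspace are determined by their pairings with generic Vandermonde
  vectors. A given point of the plane is collinear with the conjugate of at most one affine point,
  so the pairing formula is available for generic \<open>y\<close>.\<close>

lemma vandermonde_complete_generic:
  assumes u: "u \<in> V n" and Z: "infinite Z" "Z \<subseteq> curve" and x: "(x0, x1, x2) \<noteq> (0, 0, 0)"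
    and orth: "\<And>y1 y2 f. (y1, y2) \<in> Z \<Longrightarrow> P (1, y1, y2) f = 0 \<Longrightarrow>
      x1 \<noteq> x0 * cnj y1 \<or> x2 \<noteq> x0 * cnj y2 \<Longrightarrow> cinner u (vandermonde n (1, y1, y2) f) = 0"
  shows "u = 0"
proof (rule vandermonde_complete[OF u])
  \<comment> \<open>for \<open>x0 = 0\<close> no affine point is bad, and division by zero makes this the origin, which does no
    harm\<close>
  let ?bad = "(cnj (x1 / x0), cnj (x2 / x0))"
  show "infinite (Z - {?bad})" using Z(1) by simp
  show "Z - {?bad} \<subseteq> curve" using Z(2) by blast
  fix y1 y2 f assume y: "(y1, y2) \<in> Z - {?bad}" and f: "P (1, y1, y2) f = 0"
  have "x1 \<noteq> x0 * cnj y1 \<or> x2 \<noteq> x0 * cnj y2"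
  proof (rule ccontr)
    assume *: "\<not> (x1 \<noteq> x0 * cnj y1 \<or> x2 \<noteq> x0 * cnj y2)"
    then have "x0 \<noteq> 0" using x by auto
    with * have "(y1, y2) = ?bad" by simp
    then show False using y by blast
  qed
  then show "cinner u (vandermonde n (1, y1, y2) f) = 0" using orth y f by blast
qed

text \<open>The matrices of a Bezout identity need not be real, so \<open>B n \<beta>\<close> itself need not be selfadjoint;
  its compression is, because the value of its form on generic Vandermonde vectors depends only on
  the polynomials, and these are real.\<close>

lemma selfadjoint_compression:
  assumes bez: "is_bezout_matrices n p q \<beta>"
    and real: "\<And>x0 x1 x2. p (cnj x0, cnj x1, cnj x2) = cnj (p (x0, x1, x2))"
      "\<And>x0 x1 x2. q (cnj x0, cnj x1, cnj x2) = cnj (q (x0, x1, x2))"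
  shows "selfadjoint_on (V n) (compression (V n) (B n \<beta>))"
proof -
  let ?b = "onb (V n)"
  define D where "D u v = cinner (B n \<beta> u) v - cinner u (B n \<beta> v)" for u v
  have D_commute: "D v u = - cnj (D u v)" for u v
    using cinner_commute[of "B n \<beta> v" u] cinner_commute[of v "B n \<beta> u"] by (simp add: D_def)
  \<comment> \<open>\<open>S\<close> is the adjoint of \<open>B n \<beta>\<close> as a form on the principal subspace, and \<open>R\<close> represents \<open>D\<close>\<close>
  define S where "S u = (\<Sum>k<length ?b. cinner u (B n \<beta> (?b ! k)) *\<^sub>C ?b ! k)" for u
  define R where "R u = proj (V n) (B n \<beta> u) - S u" for u
  have R_in: "R u \<in> V n" for u
    unfolding R_def S_def
    by (intro complex_vector.subspace_diff csubspace_V proj_in fin_dim_V orthonormal_basis_sum_in onb)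
  have R: "cinner (R u) v = D u v" if v: "v \<in> V n" for u v
  proof -
    have "cinner u (B n \<beta> (\<Sum>k<length ?b. cinner v (?b ! k) *\<^sub>C ?b ! k)) = cinner (S u) v"
      unfolding S_def clinear_sum[OF clinear_bezout_operator] cinner_sum_right cinner_sum_left
        clinear_scaleC[OF clinear_bezout_operator] cinner_scaleC_right cinner_scaleC_left
      by (intro sum.cong refl) (simp add: cinner_commute[symmetric] mult.commute)
    then have "cinner u (B n \<beta> v) = cinner (S u) v"
      by (simp add: orthonormal_basis_expand[OF onb[OF fin_dim_V] v])
    then show ?thesis
      using v by (simp add: R_def D_def cinner_diff_left cinner_proj_left[OF fin_dim_V])
  qed
  have D_vandermonde: "D (vandermonde n (1, x1, x2) e) v = 0"
    if v: "v \<in> V n" and e: "P (1, x1, x2) e = 0" for x1 x2 e v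
  proof -
    let ?a = "vandermonde n (1, x1, x2) e"
    have "R ?a = 0"
    proof (rule vandermonde_complete_generic[OF R_in infinite_curve order_refl, of 1 x1 x2])
      fix y1 y2 f
      assume f: "P (1, y1, y2) f = 0" and indep: "x1 \<noteq> 1 * cnj y1 \<or> x2 \<noteq> 1 * cnj y2"
      then have indep': "y1 \<noteq> 1 * cnj x1 \<or> y2 \<noteq> 1 * cnj x2" by auto
      let ?a' = "vandermonde n (1, y1, y2) f"
      obtain c where c: "cinner (\<sigma>2 e) f = c * (x2 - 1 * cnj y2)" "cinner (\<sigma>1 e) f = c * (x1 - 1 * cnj y1)"
        "cinner (B n \<beta> ?a) ?a' = c * (p (1, x1, x2) * q (1, cnj y1, cnj y2) - q (1, x1, x2) * p (1, cnj y1, cnj y2))"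
        using vandermonde_pairing[OF e f indep] bez by metis
      obtain c' where c': "cinner (\<sigma>2 f) e = c' * (y2 - 1 * cnj x2)" "cinner (\<sigma>1 f) e = c' * (y1 - 1 * cnj x1)"
        "cinner (B n \<beta> ?a') ?a = c' * (p (1, y1, y2) * q (1, cnj x1, cnj x2) - q (1, y1, y2) * p (1, cnj x1, cnj x2))"
        using vandermonde_pairing[OF f e indep'] bez by metis
      have "cinner (\<sigma>2 e) f = cnj (cinner (\<sigma>2 f) e)" "cinner (\<sigma>1 e) f = cnj (cinner (\<sigma>1 f) e)"
        by (metis cinner_coeffs cinner_commute)+
      then have "c * (x2 - cnj y2) = - cnj c' * (x2 - cnj y2)" "c * (x1 - cnj y1) = - cnj c' * (x1 - cnj y1)"
        unfolding c c' by (simp_all add: algebra_simps)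
      then have cc: "c = - cnj c'" using indep by (metis mult_1 mult_right_cancel right_minus_eq)
      have "cinner ?a (B n \<beta> ?a') = cnj (cinner (B n \<beta> ?a') ?a)" by (rule cinner_commute)
      also have "\<dots> = cinner (B n \<beta> ?a) ?a'"
        using real(1)[of 1 x1 x2] real(1)[of 1 y1 y2] real(2)[of 1 x1 x2] real(2)[of 1 y1 y2]
        unfolding c(3) c'(3) cc by (simp add: algebra_simps)
      finally have "D ?a ?a' = 0" by (simp add: D_def)
      then show "cinner (R ?a) ?a' = 0" by (simp add: R vandermonde_in_V[OF f])
    qed simp
    then show ?thesis using R[OF v, of ?a] by (simp add: cinner_zero_left)
  qed
  have "D u v = 0" if u: "u \<in> V n" and v: "v \<in> V n" for u v
  proof -
    have "R u = 0"
    proof (rule vandermonde_complete[OF R_in infinite_curve order_refl])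
      fix y1 y2 e assume e: "P (1, y1, y2) e = 0"
      show "cinner (R u) (vandermonde n (1, y1, y2) e) = 0"
        using D_vandermonde[OF u e] D_commute[of u "vandermonde n (1, y1, y2) e"]
        by (simp add: R vandermonde_in_V[OF e])
    qed
    then show ?thesis using R[OF v, of u] by (simp add: cinner_zero_left)
  qed
  then have sym: "cinner (B n \<beta> u) v = cinner u (B n \<beta> v)" if "u \<in> V n" "v \<in> V n" for u v
    using that by (simp add: D_def)
  note C = compression_V[OF clinear_bezout_operator[where n = n and \<beta> = \<beta>], where n = n]
  show ?thesis
    unfolding selfadjoint_on_def
  proof (intro conjI ballI allI)
    fix u v assume uv: "u \<in> V n" "v \<in> V n"
    have "cinner (compression (V n) (B n \<beta>) u) v = cinner u (B n \<beta> v)"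
      using C(3)[OF uv] sym[OF uv] by simp
    also have "\<dots> = cnj (cinner (compression (V n) (B n \<beta>) v) u)"
      using C(3)[OF uv(2,1)] by (subst cinner_commute) simp
    also have "\<dots> = cinner u (compression (V n) (B n \<beta>) v)"
      by (rule cinner_commute[symmetric])
    finally show "cinner (compression (V n) (B n \<beta>) u) v = cinner u (compression (V n) (B n \<beta>) v)" .
  qed (simp_all add: C(2) clinear_add[OF C(1)] clinear_scaleC[OF C(1)])
qed

end

section \<open>Substituting moments for monomials in a Bezout identity\<close>

text \<open>A polynomial that vanishes identically has zero coefficients, also when its exponents are listed
  with repetitions.\<close>

lemma coefficient_sums_eq_0:
  fixes c :: "'s \<Rightarrow> complex" and d :: "'s \<Rightarrow> nat"
  assumes "finite S" "\<And>x. (\<Sum>s\<in>S. c s * x ^ d s) = 0"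
  shows "(\<Sum>s\<in>{s\<in>S. d s = k}. c s) = 0"
proof -
  define p where "p = (\<Sum>s\<in>S. monom (c s) (d s))"
  have "poly p x = 0" for x using assms(2) by (simp add: p_def poly_sum poly_monom)
  then have "p = 0" using poly_all_0_iff_0 by blast
  then have "coeff p k = 0" by simp
  moreover have "coeff p k = (\<Sum>s\<in>S. if d s = k then c s else 0)"
    by (simp add: p_def coeff_sum)
  ultimately show ?thesis
    using assms(1) by (simp add: sum.If_cases Collect_conj_eq[symmetric] Int_def)
qed

text \<open>Comparing coefficients in one variable after the other, the terms with equal exponents cancel
  among themselves, whatever numbers replace the monomials.\<close>

lemma moments_eq_0:
  fixes c :: "'s \<Rightarrow> complex" and d1 d2 d3 d4 :: "'s \<Rightarrow> nat"
  assumes fin: "finite S"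
    and zero: "\<And>x1 x2 y1 y2. (\<Sum>s\<in>S. c s * (x1 ^ d1 s * x2 ^ d2 s * y1 ^ d3 s * y2 ^ d4 s)) = 0"
  shows "(\<Sum>s\<in>S. c s * \<mu> (d1 s) (d2 s) (d3 s) (d4 s)) = 0"
proof -
  have 1: "(\<Sum>s\<in>{s\<in>S. d1 s = k1}. c s * (x2 ^ d2 s * y1 ^ d3 s * y2 ^ d4 s)) = 0" for k1 x2 y1 y2
    by (rule coefficient_sums_eq_0[OF fin]) (use zero[of _ x2 y1 y2] in \<open>simp add: mult_ac\<close>)
  have 2: "(\<Sum>s\<in>{s\<in>{s\<in>S. d1 s = k1}. d2 s = k2}. c s * (y1 ^ d3 s * y2 ^ d4 s)) = 0" for k1 k2 y1 y2
    by (rule coefficient_sums_eq_0) (use fin 1[of _ y1 y2] in \<open>simp_all add: mult_ac\<close>)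
  have 3: "(\<Sum>s\<in>{s\<in>{s\<in>{s\<in>S. d1 s = k1}. d2 s = k2}. d3 s = k3}. c s * y2 ^ d4 s) = 0" for k1 k2 k3 y2
    by (rule coefficient_sums_eq_0) (use fin 2[of _ y2] in \<open>simp_all add: mult_ac\<close>)
  have 4: "(\<Sum>s\<in>{s\<in>{s\<in>{s\<in>{s\<in>S. d1 s = k1}. d2 s = k2}. d3 s = k3}. d4 s = k4}. c s) = 0" for k1 k2 k3 k4
    by (rule coefficient_sums_eq_0) (use fin 3 in simp_all)
  define d where "d s = (d1 s, d2 s, d3 s, d4 s)" for s
  have "(\<Sum>s\<in>S. c s * \<mu> (d1 s) (d2 s) (d3 s) (d4 s)) =
      (\<Sum>k\<in>d ` S. \<Sum>s\<in>{s. s \<in> S \<and> d s = k}. c s * \<mu> (d1 s) (d2 s) (d3 s) (d4 s))"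
    by (rule sum.image_gen[OF fin])
  also have "\<dots> = 0"
  proof (rule sum.neutral, rule ballI)
    fix k assume "k \<in> d ` S"
    obtain k1 k2 k3 k4 where k: "k = (k1, k2, k3, k4)" by (cases k)
    have "(\<Sum>s\<in>{s. s \<in> S \<and> d s = k}. c s * \<mu> (d1 s) (d2 s) (d3 s) (d4 s)) =
        (\<Sum>s\<in>{s. s \<in> S \<and> d s = k}. c s) * \<mu> k1 k2 k3 k4"
      unfolding sum_distrib_right by (intro sum.cong) (auto simp: d_def k)
    moreover have "{s. s \<in> S \<and> d s = k} = {s\<in>{s\<in>{s\<in>{s\<in>S. d1 s = k1}. d2 s = k2}. d3 s = k3}. d4 s = k4}"
      by (auto simp: d_def k)
    ultimately show "(\<Sum>s\<in>{s. s \<in> S \<and> d s = k}. c s * \<mu> (d1 s) (d2 s) (d3 s) (d4 s)) = 0"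
      by (simp only: 4 mult_zero_left)
  qed
  finally show ?thesis .
qed

definition triangle :: "nat \<Rightarrow> (nat \<times> nat) set" where
  "triangle n = {(i, j). i + j \<le> n}"

lemma finite_triangle [simp]: "finite (triangle n)"
  by (rule finite_subset[of _ "{..n} \<times> {..n}"]) (auto simp: triangle_def)

abbreviation coeff2 :: "real poly poly \<Rightarrow> nat \<times> nat \<Rightarrow> real" where
  "coeff2 p a \<equiv> coeff (coeff p (snd a)) (fst a)"

lemma homogenize_1:
  "homogenize n p (1, x1, x2) = (\<Sum>a\<in>triangle n. complex_of_real (coeff2 p a) * (x1 ^ fst a * x2 ^ snd a))"
  unfolding homogenize_def triangle_def by (simp add: case_prod_beta mult.assoc)

text \<open>The substitution sends \<open>x\<^sub>1\<^sup>i x\<^sub>2\<^sup>j y\<^sub>1\<^sup>k y\<^sub>2\<^sup>l\<close> to \<open>\<mu> i j k l\<close> in the Bezout identity at \<open>x\<^sub>0 = y\<^sub>0 = 1\<close>. With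
  operators in place of \<open>x\<close> or \<open>y\<close>, the moments are inner products.\<close>

lemma bezout_moments:
  assumes bez: "is_bezout_matrices n (homogenize n p) (homogenize n q) (b10, b20, b12)"
  shows "(\<Sum>i\<in>multi_indices n. \<Sum>j\<in>multi_indices n. case (i, j) of ((_, i1, i2), (_, j1, j2)) \<Rightarrow>
      b12 i j * (\<mu> (Suc i1) i2 j1 (Suc j2) - \<mu> i1 (Suc i2) (Suc j1) j2)
      + b10 i j * (\<mu> (Suc i1) i2 j1 j2 - \<mu> i1 i2 (Suc j1) j2)
      + b20 i j * (\<mu> i1 (Suc i2) j1 j2 - \<mu> i1 i2 j1 (Suc j2))) =
    (\<Sum>a\<in>triangle n. \<Sum>b\<in>triangle n.
      complex_of_real (coeff2 p a * coeff2 q b - coeff2 q a * coeff2 p b) *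
        \<mu> (fst a) (snd a) (fst b) (snd b))"
    (is "?L \<mu> = ?R \<mu>")
proof -
  let ?M = "multi_indices n"
  \<comment> \<open>one list of terms for the difference of the two sides: six for each entry of the matrices on the
    left, one for each pair of coefficients on the right\<close>
  define S :: "(multi_index \<times> multi_index \<times> nat + (nat \<times> nat) \<times> (nat \<times> nat)) set"
    where "S = (?M \<times> ?M \<times> {..<6::nat}) <+> (triangle n \<times> triangle n)"
  define c where "c = case_sum
    (\<lambda>(i, j, k). [b12 i j, - b12 i j, b10 i j, - b10 i j, b20 i j, - b20 i j] ! k)
    (\<lambda>(a, b). - complex_of_real (coeff2 p a * coeff2 q b - coeff2 q a * coeff2 p b))"
  define d1 :: "multi_index \<times> multi_index \<times> nat + (nat \<times> nat) \<times> (nat \<times> nat) \<Rightarrow> nat"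
    where "d1 = case_sum
    (\<lambda>((_ :: nat, i1, i2), (_ :: nat, j1, j2), k). [Suc i1, i1, Suc i1, i1, i1, i1] ! k)
    (\<lambda>(a :: nat \<times> nat, b :: nat \<times> nat). fst a)"
  define d2 :: "multi_index \<times> multi_index \<times> nat + (nat \<times> nat) \<times> (nat \<times> nat) \<Rightarrow> nat"
    where "d2 = case_sum
    (\<lambda>((_ :: nat, i1, i2), (_ :: nat, j1, j2), k). [i2, Suc i2, i2, i2, Suc i2, i2] ! k)
    (\<lambda>(a :: nat \<times> nat, b :: nat \<times> nat). snd a)"
  define d3 :: "multi_index \<times> multi_index \<times> nat + (nat \<times> nat) \<times> (nat \<times> nat) \<Rightarrow> nat"
    where "d3 = case_sum
    (\<lambda>((_ :: nat, i1, i2), (_ :: nat, j1, j2), k). [j1, Suc j1, j1, Suc j1, j1, j1] ! k)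
    (\<lambda>(a :: nat \<times> nat, b :: nat \<times> nat). fst b)"
  define d4 :: "multi_index \<times> multi_index \<times> nat + (nat \<times> nat) \<times> (nat \<times> nat) \<Rightarrow> nat"
    where "d4 = case_sum
    (\<lambda>((_ :: nat, i1, i2), (_ :: nat, j1, j2), k). [Suc j2, j2, j2, j2, j2, Suc j2] ! k)
    (\<lambda>(a :: nat \<times> nat, b :: nat \<times> nat). snd b)"
  have fin: "finite S" unfolding S_def by (intro finite_Plus finite_cartesian_product) simp_all
  have expand: "(\<Sum>s\<in>S. c s * m (d1 s) (d2 s) (d3 s) (d4 s)) = ?L m - ?R m"
    for m :: "nat \<Rightarrow> nat \<Rightarrow> nat \<Rightarrow> nat \<Rightarrow> complex"
  proof -
    let ?F = "\<lambda>s. c s * m (d1 s) (d2 s) (d3 s) (d4 s)"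
    have "(\<Sum>s\<in>S. ?F s) = (\<Sum>s\<in>?M \<times> ?M \<times> {..<6}. ?F (Inl s)) + (\<Sum>s\<in>triangle n \<times> triangle n. ?F (Inr s))"
      unfolding S_def by (subst sum.Plus) (simp_all add: o_def)
    also have "(\<Sum>s\<in>?M \<times> ?M \<times> {..<6}. ?F (Inl s)) = (\<Sum>i\<in>?M. \<Sum>j\<in>?M. \<Sum>k<6. ?F (Inl (i, j, k)))"
      by (simp add: sum.cartesian_product case_prod_beta)
    also have "\<dots> = ?L m"
    proof (intro sum.cong refl)
      fix i j :: multi_index
      have six: "{..<6::nat} = {0, 1, 2, 3, 4, 5}" by auto
      show "(\<Sum>k<6. ?F (Inl (i, j, k))) = (case (i, j) of ((_, i1, i2), (_, j1, j2)) \<Rightarrow>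
        b12 i j * (m (Suc i1) i2 j1 (Suc j2) - m i1 (Suc i2) (Suc j1) j2)
        + b10 i j * (m (Suc i1) i2 j1 j2 - m i1 i2 (Suc j1) j2)
        + b20 i j * (m i1 (Suc i2) j1 j2 - m i1 i2 j1 (Suc j2)))"
        unfolding six
        by (cases i; cases j) (simp add: c_def d1_def d2_def d3_def d4_def algebra_simps)
    qed
    also have "(\<Sum>s\<in>triangle n \<times> triangle n. ?F (Inr s)) = - ?R m"
      unfolding sum.cartesian_product sum_negf[symmetric]
      by (intro sum.cong refl) (auto simp: c_def d1_def d2_def d3_def d4_def algebra_simps)
    finally show ?thesis by simp
  qed
  have "(\<Sum>s\<in>S. c s * (x1 ^ d1 s * x2 ^ d2 s * y1 ^ d3 s * y2 ^ d4 s)) = 0" for x1 x2 y1 y2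
  proof -
    have R: "?R (\<lambda>k1 k2 k3 k4. x1 ^ k1 * x2 ^ k2 * y1 ^ k3 * y2 ^ k4) =
      homogenize n p (1, x1, x2) * homogenize n q (1, y1, y2) - homogenize n q (1, x1, x2) * homogenize n p (1, y1, y2)"
      unfolding homogenize_1 sum_product sum_subtractf[symmetric]
      by (intro sum.cong refl) (simp add: algebra_simps)
    have L: "?L (\<lambda>k1 k2 k3 k4. x1 ^ k1 * x2 ^ k2 * y1 ^ k3 * y2 ^ k4) =
      homogenize n p (1, x1, x2) * homogenize n q (1, y1, y2) - homogenize n q (1, x1, x2) * homogenize n p (1, y1, y2)"
      unfolding is_bezout_matrices_identity[OF bez]
      by (intro sum.cong refl) (auto simp: monomial_def algebra_simps)
    show ?thesis
      using expand[of "\<lambda>k1 k2 k3 k4. x1 ^ k1 * x2 ^ k2 * y1 ^ k3 * y2 ^ k4"] unfolding L R by simp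
  qed
  then have "(\<Sum>s\<in>S. c s * \<mu> (d1 s) (d2 s) (d3 s) (d4 s)) = 0"
    by (rule moments_eq_0[OF fin])
  then show ?thesis unfolding expand by simp
qed

section \<open>Polynomials of commuting operators\<close>

lemma coeff2_support:
  "{a. coeff2 p a \<noteq> 0} \<subseteq> (\<lambda>(j, i). (i, j)) ` (SIGMA j:{..degree p}. {..degree (coeff p j)})"
proof
  fix a assume "a \<in> {a. coeff2 p a \<noteq> 0}"
  then have a: "coeff (coeff p (snd a)) (fst a) \<noteq> 0" by simp
  then have "coeff p (snd a) \<noteq> 0" by auto
  then have "snd a \<le> degree p" by (rule le_degree)
  moreover have "fst a \<le> degree (coeff p (snd a))" using a by (rule le_degree)
  ultimately show "a \<in> (\<lambda>(j, i). (i, j)) ` (SIGMA j:{..degree p}. {..degree (coeff p j)})"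
    by (intro image_eqI[of _ _ "(snd a, fst a)"]) auto
qed

lemma coeff2_support_triangle:
  assumes "total_degree p \<le> n" shows "{a. coeff2 p a \<noteq> 0} \<subseteq> triangle n"
proof
  fix a assume a: "a \<in> {a. coeff2 p a \<noteq> 0}"
  have "finite {a. coeff2 p a \<noteq> 0}"
    by (rule finite_subset[OF coeff2_support]) auto
  moreover have "{i + j | i j. coeff (coeff p j) i \<noteq> 0} \<subseteq> (\<lambda>(i, j). i + j) ` {a. coeff2 p a \<noteq> 0}"
    by auto
  ultimately have "finite {i + j | i j. coeff (coeff p j) i \<noteq> 0}" by (rule finite_surj)
  then have "fst a + snd a \<le> total_degree p"
    unfolding total_degree_def using a by (intro Max_ge) auto
  then show "a \<in> triangle n" using assms by (auto simp: triangle_def split: prod.splits)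
qed

text \<open>Both index sets contain the support of the coefficients.\<close>

lemma sum_coeff_triangle:
  fixes G :: "nat \<Rightarrow> nat \<Rightarrow> 'b::real_vector"
  assumes "total_degree p \<le> n"
  shows "(\<Sum>j\<le>degree p. \<Sum>i\<le>degree (coeff p j). coeff (coeff p j) i *\<^sub>R G i j) =
    (\<Sum>a\<in>triangle n. coeff2 p a *\<^sub>R G (fst a) (snd a))"
proof -
  let ?S = "SIGMA j:{..degree p}. {..degree (coeff p j)}" and ?s = "\<lambda>(j, i). (i, j)"
  let ?H = "\<lambda>a. coeff2 p a *\<^sub>R G (fst a) (snd a)"
  have "(\<Sum>j\<le>degree p. \<Sum>i\<le>degree (coeff p j). coeff (coeff p j) i *\<^sub>R G i j) = (\<Sum>a\<in>?S. ?H (?s a))"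
    by (subst sum.Sigma) (auto intro!: sum.cong)
  also have "\<dots> = (\<Sum>a\<in>?s ` ?S. ?H a)"
    by (subst sum.reindex) (auto simp: inj_on_def intro!: sum.cong)
  also have "\<dots> = (\<Sum>a | coeff2 p a \<noteq> 0. ?H a)"
    by (rule sum.mono_neutral_right[OF _ coeff2_support]) auto
  also have "\<dots> = (\<Sum>a\<in>triangle n. ?H a)"
    by (rule sum.mono_neutral_left[OF _ coeff2_support_triangle[OF assms]]) auto
  finally show ?thesis .
qed

lemma poly_map_poly_sum:
  fixes f :: "'b::zero \<Rightarrow> complex"
  assumes "f 0 = 0" shows "poly (map_poly f p) x = (\<Sum>i\<le>degree p. f (coeff p i) * x ^ i)"
proof -
  have "poly (map_poly f p) x = (\<Sum>i\<le>degree (map_poly f p). coeff (map_poly f p) i * x ^ i)"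
    by (rule poly_altdef)
  also have "\<dots> = (\<Sum>i\<le>degree p. coeff (map_poly f p) i * x ^ i)"
    by (intro sum.mono_neutral_left) (auto simp: coeff_eq_0 intro: order_trans map_poly_degree_leq)
  finally show ?thesis by (simp add: coeff_map_poly assms)
qed

text \<open>The total degree may be smaller than \<open>n\<close>; the extra powers of \<open>x\<^sub>0\<close> are invisible at \<open>x\<^sub>0 = 1\<close>.\<close>

lemma eval2_complexify:
  assumes "total_degree p \<le> n"
  shows "eval2 (complexify p) (y1, y2) = homogenize n p (1, y1, y2)"
proof -
  have "eval2 (complexify p) (y1, y2) =
      poly (map_poly (\<lambda>c. poly (map_poly complex_of_real c) y1) p) y2"
    unfolding eval2_conv_map_poly complexify_def by (subst map_poly_map_poly) (simp_all add: o_def)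
  also have "\<dots> = (\<Sum>j\<le>degree p. (\<Sum>i\<le>degree (coeff p j). complex_of_real (coeff (coeff p j) i) * y1 ^ i) * y2 ^ j)"
    by (simp add: poly_map_poly_sum)
  also have "\<dots> = (\<Sum>j\<le>degree p. \<Sum>i\<le>degree (coeff p j). coeff (coeff p j) i *\<^sub>R (y1 ^ i * y2 ^ j))"
    by (simp add: sum_distrib_right scaleR_conv_of_real mult.assoc)
  also have "\<dots> = homogenize n p (1, y1, y2)"
    unfolding sum_coeff_triangle[OF assms] homogenize_1 by (simp add: scaleR_conv_of_real)
  finally show ?thesis .
qed

lemma homogenize_cnj:
  "homogenize n p (cnj x0, cnj x1, cnj x2) = cnj (homogenize n p (x0, x1, x2))"
  by (simp add: homogenize_def case_prod_beta)

lemma op_poly_triangle: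
  assumes "total_degree p \<le> n"
  shows "op_poly p T1 T2 h = (\<Sum>a\<in>triangle n. coeff2 p a *\<^sub>R (T1 ^^ fst a) ((T2 ^^ snd a) h))"
  unfolding op_poly_def by (rule sum_coeff_triangle[OF assms])

lemma funpow_commute:
  assumes "\<And>h. S (T h) = T (S h)" shows "S ((T ^^ k) h) = (T ^^ k) (S h)"
  by (induction k) (simp_all add: assms)

lemma op_poly_commute:
  assumes "clinear S" "\<And>h. S (T1 h) = T1 (S h)" "\<And>h. S (T2 h) = T2 (S h)"
  shows "S (op_poly p T1 T2 h) = op_poly p T1 T2 (S h)"
  unfolding op_poly_def
  by (simp add: clinear_sum[OF assms(1)] clinear_scaleR[OF assms(1)]
      funpow_commute[of S T1, OF assms(2)] funpow_commute[of S T2, OF assms(3)])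

lemma bounded_clinear_op_poly:
  assumes "bounded_clinear T1" "bounded_clinear T2"
  shows "bounded_clinear (op_poly p T1 T2)"
proof -
  have "bounded_clinear (\<lambda>h. (T1 ^^ i) ((T2 ^^ j) h))" for i j
    using bounded_clinear_compose[OF bounded_clinear_funpow[OF assms(1)] bounded_clinear_funpow[OF assms(2)]]
    by (simp add: o_def)
  then show ?thesis
    unfolding op_poly_def[abs_def] by (intro bounded_clinear_sum bounded_clinear_scaleR)
qed

lemma cinner_funpow_cadjoint:
  fixes A :: "'h::complex_hilbert \<Rightarrow> 'h"
  assumes "bounded_clinear A"
  shows "cinner ((A ^^ k) u) v = cinner u ((cadjoint A ^^ k) v)"
proof (induction k arbitrary: v)
  case (Suc k)
  then show ?case
    by (simp add: cinner_cadjoint[OF assms] funpow_commute[of "cadjoint A" "cadjoint A"])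
qed simp

lemma cadjoint_commute:
  fixes A B :: "'h::complex_hilbert \<Rightarrow> 'h"
  assumes "bounded_clinear A" "bounded_clinear B" "\<And>h. A (B h) = B (A h)"
  shows "cadjoint A (cadjoint B h) = cadjoint B (cadjoint A h)"
  by (rule cinner_ext_right) (metis assms cinner_cadjoint)

lemma cinner_op_poly_cadjoint:
  fixes A1 A2 :: "'h::complex_hilbert \<Rightarrow> 'h"
  assumes "bounded_clinear A1" "bounded_clinear A2" and comm: "\<And>h. A1 (A2 h) = A2 (A1 h)"
  shows "cinner (op_poly p A1 A2 u) v = cinner u (op_poly p (cadjoint A1) (cadjoint A2) v)"
proof -
  have "cinner ((A1 ^^ i) ((A2 ^^ j) u)) v = cinner u ((cadjoint A1 ^^ i) ((cadjoint A2 ^^ j) v))" for i j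
  proof -
    have "(cadjoint A1 ^^ i) ((cadjoint A2 ^^ j) v) = (cadjoint A2 ^^ j) ((cadjoint A1 ^^ i) v)"
      by (intro funpow_commute funpow_commute[symmetric] cadjoint_commute assms)
    then show ?thesis by (simp add: cinner_funpow_cadjoint assms)
  qed
  then show ?thesis
    unfolding op_poly_def
    by (simp add: cinner_sum_left cinner_sum_right cinner_scaleR_left cinner_scaleR_right)
qed

lemma the_inv_eqI: "S \<circ> T = id \<Longrightarrow> T \<circ> S = id \<Longrightarrow> the_inv T = S"
proof
  fix x assume "S \<circ> T = id" "T \<circ> S = id"
  then have "inj T" "T (S x) = x" by (auto intro: inj_on_inverseI simp: fun_eq_iff)
  then show "the_inv T x = S x" by (metis the_inv_f_f)
qed

text \<open>Iterating the eigenvalue equation, \<open>\<bar>w\<bar>\<^sup>k \<bar>D h\<bar> = \<bar>D (T\<^sup>k h)\<bar>\<close> grows at most like \<open>L\<^sup>k\<close>.\<close>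

lemma functional_eq_0:
  fixes D :: "'h::real_normed_vector \<Rightarrow> complex" and T :: "'h \<Rightarrow> 'h"
  assumes bound: "\<And>h. cmod (D h) \<le> norm h * K" and T: "\<And>h. norm (T h) \<le> norm h * L" "L \<ge> 0"
    and eigen: "\<And>h. D (T h) = w * D h" and w: "cmod w > L"
  shows "D h = 0"
proof -
  have K: "0 \<le> norm h * K" using order_trans[OF norm_ge_zero bound] .
  have Tk: "norm ((T ^^ k) h) \<le> norm h * L ^ k" for k
  proof (induction k)
    case (Suc k)
    have "norm (T ((T ^^ k) h)) \<le> norm ((T ^^ k) h) * L" by (rule T)
    also have "\<dots> \<le> (norm h * L ^ k) * L" using Suc T(2) by (rule mult_right_mono)
    finally show ?case by (simp add: mult_ac)
  qed simp
  have Dk: "D ((T ^^ k) h) = w ^ k * D h" for k by (induction k) (simp_all add: eigen)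
  have "cmod (D h) \<le> norm h * \<bar>K\<bar> * (L / cmod w) ^ k" for k
  proof -
    have "cmod w ^ k * cmod (D h) = cmod (D ((T ^^ k) h))" by (simp add: Dk norm_mult norm_power)
    also have "\<dots> \<le> norm ((T ^^ k) h) * \<bar>K\<bar>"
      by (rule order_trans[OF bound]) (simp add: mult_left_mono)
    also have "\<dots> \<le> (norm h * L ^ k) * \<bar>K\<bar>" by (intro mult_right_mono Tk) simp
    finally have "cmod w ^ k * cmod (D h) \<le> (norm h * L ^ k) * \<bar>K\<bar>" .
    moreover have "cmod w ^ k > 0" using le_less_trans[OF T(2) w] by simp
    ultimately show ?thesis by (simp add: power_divide field_simps)
  qed
  moreover have "(\<lambda>k. norm h * \<bar>K\<bar> * (L / cmod w) ^ k) \<longlonglongrightarrow> norm h * \<bar>K\<bar> * 0"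
    using w T(2) by (intro tendsto_intros LIMSEQ_power_zero) (simp add: divide_simps)
  ultimately have "cmod (D h) \<le> norm h * \<bar>K\<bar> * 0"
    using LIMSEQ_le_const by blast
  then show ?thesis by simp
qed

lemma norm_tuple_le: "norm (tuple n f) \<le> (\<Sum>i\<in>multi_indices n. norm (f i))"
proof -
  have "norm (tuple n f) = L2_set (\<lambda>i. norm (component (tuple n f) i)) (multi_indices n)"
    by (rule norm_family_superset) (simp_all add: support_tuple)
  also have "\<dots> = L2_set (\<lambda>i. norm (f i)) (multi_indices n)"
    by (rule L2_set_cong) (simp_all add: component_tuple)
  also have "\<dots> \<le> (\<Sum>i\<in>multi_indices n. norm (f i))" by (rule L2_set_le_sum) simp
  finally show ?thesis .
qed

lemma bounded_clinear_tuple: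
  assumes "\<And>i. i \<in> multi_indices n \<Longrightarrow> bounded_clinear (F i)"
  shows "bounded_clinear (\<lambda>h. tuple n (\<lambda>i. F i h))"
proof -
  have "\<exists>K. \<forall>h. norm (F i h) \<le> norm h * K" if "i \<in> multi_indices n" for i
    using bounded_clinear_bound[OF assms[OF that]] by metis
  then obtain K where K: "\<And>i h. i \<in> multi_indices n \<Longrightarrow> norm (F i h) \<le> norm h * K i" by metis
  show ?thesis
  proof (rule bounded_clinearI)
    show "clinear (\<lambda>h. tuple n (\<lambda>i. F i h))"
      using assms[THEN bounded_clinear_clinear]
      by (auto simp: clinear_def component_tuple component_add component_scaleC
          complex_vector.scale_zero_right intro!: family_eqI)
    fix h
    have "norm (tuple n (\<lambda>i. F i h)) \<le> (\<Sum>i\<in>multi_indices n. norm (F i h))" by (rule norm_tuple_le)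
    also have "\<dots> \<le> (\<Sum>i\<in>multi_indices n. norm h * K i)" by (intro sum_mono K)
    finally show "norm (tuple n (\<lambda>i. F i h)) \<le> norm h * (\<Sum>i\<in>multi_indices n. K i)"
      by (simp add: sum_distrib_left)
  qed
qed

lemma bounded_clinear_compose_proj:
  assumes "clinear F" "fin_dim S" shows "bounded_clinear (F \<circ> proj S)"
proof (rule bounded_clinearI)
  show "clinear (F \<circ> proj S)" by (intro clinear_compose assms clinear_proj)
  fix v
  have "norm ((F \<circ> proj S) v) \<le> (\<Sum>i<length (onb S). norm (cinner v (onb S ! i) *\<^sub>C F (onb S ! i)))"
    by (simp add: proj_expand[OF assms(2)] clinear_sum[OF assms(1)] clinear_scaleC[OF assms(1)] norm_sum)
  also have "\<dots> \<le> (\<Sum>i<length (onb S). norm v * (norm (onb S ! i) * norm (F (onb S ! i))))"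
    unfolding norm_scaleC mult.assoc[symmetric] by (intro sum_mono mult_right_mono cauchy_schwarz) simp
  finally show "norm ((F \<circ> proj S) v) \<le> norm v * (\<Sum>i<length (onb S). norm (onb S ! i) * norm (F (onb S ! i)))"
    by (simp add: sum_distrib_left)
qed

section \<open>The transformed colligation on the principal subspace\<close>

locale vessel_pencil = irreducible_pencil \<sigma>1 \<sigma>2 \<gamma>
  for \<sigma>1 \<sigma>2 \<gamma> :: "'e::complex_inner \<Rightarrow> 'e" +
  fixes A1 A2 :: "'h::complex_hilbert \<Rightarrow> 'h" and \<Phi> :: "'h \<Rightarrow> 'e"
  assumes bounded: "bounded_clinear A1" "bounded_clinear A2" "bounded_clinear \<Phi>"
    and commute: "A1 (A2 h) = A2 (A1 h)"
    and colligation: "cadjoint \<Phi> (\<sigma>1 (\<Phi> h)) = (1 / \<i>) *\<^sub>C (A1 h - cadjoint A1 h)"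
      "cadjoint \<Phi> (\<sigma>2 (\<Phi> h)) = (1 / \<i>) *\<^sub>C (A2 h - cadjoint A2 h)"
    and linkage: "\<gamma> (\<Phi> h) = \<sigma>1 (\<Phi> (cadjoint A2 h)) - \<sigma>2 (\<Phi> (cadjoint A1 h))"
begin

abbreviation "T1 \<equiv> cadjoint A1"
abbreviation "T2 \<equiv> cadjoint A2"

lemma bounded_T: "bounded_clinear T1" "bounded_clinear T2"
  by (simp_all add: bounded_clinear_cadjoint bounded)

lemmas clinear_T = bounded_T[THEN bounded_clinear_clinear]

lemma clinear_\<Phi>: "clinear \<Phi>"
  using bounded(3) by (rule bounded_clinear_clinear)

lemma T_commute: "T1 (T2 h) = T2 (T1 h)"
  by (rule cadjoint_commute[OF bounded(1,2) commute])

definition T_power :: "nat \<Rightarrow> nat \<Rightarrow> 'h \<Rightarrow> 'h" where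
  "T_power i j u = (T1 ^^ i) ((T2 ^^ j) u)"

lemma T_power_Suc: "T_power (Suc i) j u = T1 (T_power i j u)" "T_power i (Suc j) u = T2 (T_power i j u)"
  by (simp_all add: T_power_def funpow_commute[of T2 T1, OF T_commute[symmetric]])

lemma T_power_commute:
  assumes "clinear N" "\<And>u. N (T1 u) = T1 (N u)" "\<And>u. N (T2 u) = T2 (N u)"
  shows "T_power i j (N u) = N (T_power i j u)"
  by (simp add: T_power_def funpow_commute[of N T1, OF assms(2)] funpow_commute[of N T2, OF assms(3)])

lemma op_poly_X:
  "total_degree p \<le> n \<Longrightarrow> op_poly p T1 T2 u = (\<Sum>a\<in>triangle n. coeff2 p a *\<^sub>R T_power (fst a) (snd a) u)"
  by (simp add: op_poly_triangle T_power_def)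

text \<open>The family that \<open>\<Phi>'\<close> produces, before the inverse of \<open>p\<^sub>0(T\<^sub>1, T\<^sub>2)\<close> is applied to the argument; it
  lies in the principal subspace, so projecting it there does not change it.\<close>

definition \<Psi> :: "nat \<Rightarrow> 'h \<Rightarrow> (multi_index, 'e) family" where
  "\<Psi> n u = tuple n (\<lambda>i. \<Phi> (T_power (fst (snd i)) (snd (snd i)) u))"

lemma component_\<Psi>: "(i0, i1, i2) \<in> multi_indices n \<Longrightarrow> component (\<Psi> n u) (i0, i1, i2) = \<Phi> (T_power i1 i2 u)"
  by (simp add: \<Psi>_def component_tuple)

lemma bounded_clinear_\<Psi>: "bounded_clinear (\<Psi> n)"
proof -
  have "bounded_clinear (\<Phi> \<circ> (T_power i j))" for i j
  proof -
    have "T_power i j = (T1 ^^ i) \<circ> (T2 ^^ j)" by (simp add: T_power_def fun_eq_iff)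
    then show ?thesis
      by (simp only:) (intro bounded_clinear_compose bounded bounded_clinear_funpow bounded_T)
  qed
  then show ?thesis unfolding \<Psi>_def[abs_def] by (intro bounded_clinear_tuple) (simp add: o_def)
qed

text \<open>The input linkage condition, applied to \<open>T_power i j u\<close>, is the recursion that defines the principal
  subspace.\<close>

lemma \<Psi>_in_V: "\<Psi> n u \<in> V n"
  unfolding in_V_iff
proof (intro conjI ballI)
  show "support (\<Psi> n u) \<subseteq> multi_indices n" unfolding \<Psi>_def by (rule support_tuple)
  fix k assume k: "k \<in> multi_indices (n - 1)"
  obtain k0 k1 k2 where k_eq: "k = (k0, k1, k2)" by (cases k)
  then have "(k0, Suc k1, k2) \<in> multi_indices n" "(k0, k1, Suc k2) \<in> multi_indices n"
    "(Suc k0, k1, k2) \<in> multi_indices n" using k by (simp_all add: multi_indices_Suc)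
  then show "relation (\<Psi> n u) k = 0"
    by (simp add: k_eq relation_def component_\<Psi> T_power_Suc linkage)
qed

lemma cinner_coeffs_\<Phi>:
  "cinner (\<sigma>1 (\<Phi> u)) (\<Phi> v) = \<i> * (cinner (T1 u) v - cinner u (T1 v))"
  "cinner (\<sigma>2 (\<Phi> u)) (\<Phi> v) = \<i> * (cinner (T2 u) v - cinner u (T2 v))"
  "cinner (\<gamma> (\<Phi> u)) (\<Phi> v) = \<i> * (cinner (T1 u) (T2 v) - cinner (T2 u) (T1 v))"
proof -
  show 1: "cinner (\<sigma>1 (\<Phi> u)) (\<Phi> v) = \<i> * (cinner (T1 u) v - cinner u (T1 v))" for u v
    using cinner_cadjoint'[OF bounded(3), of "\<sigma>1 (\<Phi> u)" v]
    by (simp add: colligation cinner_linear_simps cinner_cadjoint[OF bounded(1)] algebra_simps)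
  show 2: "cinner (\<sigma>2 (\<Phi> u)) (\<Phi> v) = \<i> * (cinner (T2 u) v - cinner u (T2 v))" for u v
    using cinner_cadjoint'[OF bounded(3), of "\<sigma>2 (\<Phi> u)" v]
    by (simp add: colligation cinner_linear_simps cinner_cadjoint[OF bounded(2)] algebra_simps)
  show "cinner (\<gamma> (\<Phi> u)) (\<Phi> v) = \<i> * (cinner (T1 u) (T2 v) - cinner (T2 u) (T1 v))"
    by (simp add: linkage cinner_diff_left 1 2 T_commute algebra_simps)
qed

text \<open>Both arguments of the form are monomials in the adjoints applied to vectors, so the
  coefficients of the vessel become differences of moments.\<close>

lemma cinner_bezout_\<Psi>_\<Psi>:
  assumes bez: "is_bezout_matrices n (homogenize n p) (homogenize n q) \<beta>"
    and deg: "total_degree p \<le> n" "total_degree q \<le> n"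
  shows "cinner (B n \<beta> (\<Psi> n u)) (\<Psi> n v) =
    \<i> * (cinner (op_poly p T1 T2 u) (op_poly q T1 T2 v) - cinner (op_poly q T1 T2 u) (op_poly p T1 T2 v))"
proof -
  obtain b10 b20 b12 where \<beta>: "\<beta> = (b10, b20, b12)" by (cases \<beta>)
  note bez' = bez[unfolded \<beta>]
  define \<mu> where "\<mu> a1 a2 c1 c2 = \<i> * cinner (T_power a1 a2 u) (T_power c1 c2 v)" for a1 a2 c1 c2
  have "cinner (B n \<beta> (\<Psi> n u)) (\<Psi> n v) =
    (\<Sum>i\<in>multi_indices n. \<Sum>j\<in>multi_indices n. case (i, j) of ((_, i1, i2), (_, j1, j2)) \<Rightarrow>
      b12 i j * (\<mu> (Suc i1) i2 j1 (Suc j2) - \<mu> i1 (Suc i2) (Suc j1) j2)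
      + b10 i j * (\<mu> (Suc i1) i2 j1 j2 - \<mu> i1 i2 (Suc j1) j2)
      + b20 i j * (\<mu> i1 (Suc i2) j1 j2 - \<mu> i1 i2 j1 (Suc j2)))"
    unfolding \<beta> cinner_bezout_operator[OF bez']
    by (intro sum.cong refl)
       (auto simp: component_\<Psi> cinner_coeffs_\<Phi> \<mu>_def T_power_Suc right_diff_distrib split: prod.splits)
  also have "\<dots> = (\<Sum>a\<in>triangle n. \<Sum>b\<in>triangle n.
      complex_of_real (coeff2 p a * coeff2 q b - coeff2 q a * coeff2 p b) * \<mu> (fst a) (snd a) (fst b) (snd b))"
    by (rule bezout_moments[OF bez'])
  also have "\<dots> = \<i> * (cinner (op_poly p T1 T2 u) (op_poly q T1 T2 v) - cinner (op_poly q T1 T2 u) (op_poly p T1 T2 v))"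
    unfolding op_poly_X[OF deg(1)] op_poly_X[OF deg(2)] cinner_sum_left
    unfolding cinner_sum_right cinner_scaleR_left cinner_scaleR_right
      sum_subtractf[symmetric] sum_distrib_left
    by (intro sum.cong refl) (simp add: \<mu>_def algebra_simps)
  finally show ?thesis .
qed

text \<open>The functional \<open>\<xi>\<close> plays the role of the factor \<open>c\<close>: the pairings of \<open>\<sigma>\<^sub>1 \<Phi> (N u)\<close>, \<open>\<sigma>\<^sub>2 \<Phi> (N u)\<close>,
  \<open>\<gamma> \<Phi> (N u)\<close> with \<open>f\<close> are \<open>\<xi>\<close> applied to the entries of the cross product of \<open>(1, T\<^sub>1, T\<^sub>2)\<close> with the conjugate of \<open>y\<close>. It is
  used with \<open>N = T\<^sub>k - cnj y\<^sub>k\<close>, for which \<open>\<xi>\<close> is the pairing of \<open>\<sigma>\<^sub>k \<Phi>\<close> with \<open>f\<close>.\<close>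

lemma cinner_bezout_\<Psi>_vandermonde:
  assumes bez: "is_bezout_matrices n (homogenize n p) (homogenize n q) \<beta>"
    and deg: "total_degree p \<le> n" "total_degree q \<le> n"
    and \<xi>: "\<And>u v. \<xi> (u + v) = \<xi> u + \<xi> v" "\<And>r u. \<xi> (r *\<^sub>R u) = complex_of_real r * \<xi> u"
    and N: "clinear N" "\<And>u. N (T1 u) = T1 (N u)" "\<And>u. N (T2 u) = T2 (N u)"
    and pair: "\<And>u. cinner (\<sigma>1 (\<Phi> (N u))) f = \<xi> (T1 u) - cnj y1 * \<xi> u"
      "\<And>u. cinner (\<sigma>2 (\<Phi> (N u))) f = \<xi> (T2 u) - cnj y2 * \<xi> u"
      "\<And>u. cinner (\<gamma> (\<Phi> (N u))) f = cnj y2 * \<xi> (T1 u) - cnj y1 * \<xi> (T2 u)"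
  shows "cinner (B n \<beta> (\<Psi> n (N u))) (vandermonde n (1, y1, y2) f) =
    \<xi> (op_poly p T1 T2 u) * homogenize n q (1, cnj y1, cnj y2)
      - \<xi> (op_poly q T1 T2 u) * homogenize n p (1, cnj y1, cnj y2)"
proof -
  obtain b10 b20 b12 where \<beta>: "\<beta> = (b10, b20, b12)" by (cases \<beta>)
  note bez' = bez[unfolded \<beta>]
  have \<xi>0: "\<xi> 0 = 0" using \<xi>(2)[of 0 0] by simp
  have \<xi>_sum: "\<xi> (\<Sum>a\<in>A. g a) = (\<Sum>a\<in>A. \<xi> (g a))" for A :: "(nat \<times> nat) set" and g
    by (induction A rule: infinite_finite_induct) (simp_all add: \<xi> \<xi>0)
  define \<mu> where "\<mu> a1 a2 c1 c2 = \<xi> (T_power a1 a2 u) * (cnj y1 ^ c1 * cnj y2 ^ c2)" for a1 a2 c1 c2 :: nat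
  have "cinner (B n \<beta> (\<Psi> n (N u))) (vandermonde n (1, y1, y2) f) =
    (\<Sum>i\<in>multi_indices n. \<Sum>j\<in>multi_indices n. case (i, j) of ((_, i1, i2), (_, j1, j2)) \<Rightarrow>
      b12 i j * (\<mu> (Suc i1) i2 j1 (Suc j2) - \<mu> i1 (Suc i2) (Suc j1) j2)
      + b10 i j * (\<mu> (Suc i1) i2 j1 j2 - \<mu> i1 i2 (Suc j1) j2)
      + b20 i j * (\<mu> i1 (Suc i2) j1 j2 - \<mu> i1 i2 j1 (Suc j2)))"
    unfolding \<beta> cinner_bezout_operator[OF bez']
  proof (intro sum.cong refl)
    fix i j assume ij: "i \<in> multi_indices n" "j \<in> multi_indices n"
    obtain i0 i1 i2 j0 j1 j2 where [simp]: "i = (i0, i1, i2)" "j = (j0, j1, j2)" by (cases i; cases j)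
    show "b12 i j * cinner (\<gamma> (component (\<Psi> n (N u)) i)) (component (vandermonde n (1, y1, y2) f) j)
      + b10 i j * cinner (\<sigma>1 (component (\<Psi> n (N u)) i)) (component (vandermonde n (1, y1, y2) f) j)
      + b20 i j * cinner (\<sigma>2 (component (\<Psi> n (N u)) i)) (component (vandermonde n (1, y1, y2) f) j) =
      (case (i, j) of ((_, i1, i2), (_, j1, j2)) \<Rightarrow>
      b12 i j * (\<mu> (Suc i1) i2 j1 (Suc j2) - \<mu> i1 (Suc i2) (Suc j1) j2)
      + b10 i j * (\<mu> (Suc i1) i2 j1 j2 - \<mu> i1 i2 (Suc j1) j2)
      + b20 i j * (\<mu> i1 (Suc i2) j1 j2 - \<mu> i1 i2 j1 (Suc j2)))"
      using ij
      by (simp add: component_\<Psi> component_vandermonde T_power_commute[OF N] cinner_scaleC_right pair \<mu>_def T_power_Suc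
          monomial_def algebra_simps)
  qed
  also have "\<dots> = (\<Sum>a\<in>triangle n. \<Sum>b\<in>triangle n.
      complex_of_real (coeff2 p a * coeff2 q b - coeff2 q a * coeff2 p b) * \<mu> (fst a) (snd a) (fst b) (snd b))"
    by (rule bezout_moments[OF bez'])
  also have "\<dots> = \<xi> (op_poly p T1 T2 u) * homogenize n q (1, cnj y1, cnj y2)
      - \<xi> (op_poly q T1 T2 u) * homogenize n p (1, cnj y1, cnj y2)"
    unfolding op_poly_X[OF deg(1)] op_poly_X[OF deg(2)] \<xi>_sum \<xi>(2) homogenize_1 sum_product
      sum_subtractf[symmetric]
    by (intro sum.cong refl) (simp add: \<mu>_def algebra_simps)
  finally show ?thesis .
qed

end

section \<open>Assembling a vessel\<close>

lemma selfadjoint_onD: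
  assumes "selfadjoint_on E T" "u \<in> E"
  shows "T u \<in> E" "v \<in> E \<Longrightarrow> T (u + v) = T u + T v" "T (c *\<^sub>C u) = c *\<^sub>C T u"
    "v \<in> E \<Longrightarrow> cinner (T u) v = cinner u (T v)"
  using assms unfolding selfadjoint_on_def by blast+

lemma selfadjoint_on_diff:
  assumes "selfadjoint_on E T" "csubspace E" "u \<in> E" "v \<in> E" shows "T (u - v) = T u - T v"
proof -
  have "T (u - v + v) = T (u - v) + T v"
    using assms by (intro selfadjoint_onD(2)) (auto intro: complex_vector.subspace_diff)
  then show ?thesis by (simp add: algebra_simps)
qed

text \<open>Substituting the colligation conditions into the formula for \<open>\<gamma>out\<close> turns the input linkage
  into the output linkage, and the correction term in \<open>\<gamma>out\<close> is selfadjoint because it is \<open>\<i>\<close> times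
  the difference of an operator and its adjoint.\<close>

lemma commutative_vesselI:
  fixes A1 A2 :: "'h::complex_hilbert \<Rightarrow> 'h" and \<Phi> :: "'h \<Rightarrow> 'e::complex_inner"
  assumes bounded: "bounded_clinear A1" "bounded_clinear A2" "bounded_clinear \<Phi>"
    and comm: "\<And>h. A1 (A2 h) = A2 (A1 h)"
    and E: "fin_dim E" "\<And>h. \<Phi> h \<in> E"
    and sa: "selfadjoint_on E \<sigma>1" "selfadjoint_on E \<sigma>2" "selfadjoint_on E \<gamma>in"
    and col: "\<And>h k. cinner (\<sigma>1 (\<Phi> h)) (\<Phi> k) = (1 / \<i>) * cinner (A1 h - cadjoint A1 h) k"
      "\<And>h k. cinner (\<sigma>2 (\<Phi> h)) (\<Phi> k) = (1 / \<i>) * cinner (A2 h - cadjoint A2 h) k"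
    and link: "\<And>h. \<gamma>in (\<Phi> h) = \<sigma>1 (\<Phi> (cadjoint A2 h)) - \<sigma>2 (\<Phi> (cadjoint A1 h))"
    and out: "\<And>e. e \<in> E \<Longrightarrow> \<gamma>out e = \<gamma>in e
        + \<i> *\<^sub>C (\<sigma>1 (\<Phi> (cadjoint \<Phi> (\<sigma>2 e))) - \<sigma>2 (\<Phi> (cadjoint \<Phi> (\<sigma>1 e))))"
  shows "commutative_vessel A1 A2 \<Phi> E \<sigma>1 \<sigma>2 \<gamma>in \<gamma>out"
proof -
  have sub: "csubspace E" using E(1) by (rule fin_dim_csubspace)
  note in_E = complex_vector.subspace_add[OF sub] complex_vector.subspace_scale[OF sub]
    complex_vector.subspace_diff[OF sub]
  have lin\<Phi>: "clinear \<Phi>" "clinear (cadjoint \<Phi>)"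
    using bounded(3) by (auto intro: bounded_clinear_clinear bounded_clinear_cadjoint)
  define Y where "Y e = \<Phi> (cadjoint \<Phi> e)" for e
  have Y: "Y e \<in> E" "Y (u + v) = Y u + Y v" "Y (c *\<^sub>C u) = c *\<^sub>C Y u" "cinner (Y u) v = cinner u (Y v)"
    for e u v c
    by (simp_all add: Y_def E(2) clinear_add[OF lin\<Phi>(1)] clinear_add[OF lin\<Phi>(2)] clinear_scaleC[OF lin\<Phi>(1)]
        clinear_scaleC[OF lin\<Phi>(2)] cinner_cadjoint[OF bounded(3)] cinner_cadjoint'[OF bounded(3)])
  note s = selfadjoint_onD[OF sa(1)] selfadjoint_onD[OF sa(2)] selfadjoint_onD[OF sa(3)]
  note s_diff = selfadjoint_on_diff[OF sa(1) sub] selfadjoint_on_diff[OF sa(2) sub]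
  have out': "\<gamma>out e = \<gamma>in e + \<i> *\<^sub>C (\<sigma>1 (Y (\<sigma>2 e)) - \<sigma>2 (Y (\<sigma>1 e)))" if "e \<in> E" for e
    using out[OF that] by (simp add: Y_def)
  have sa_out: "selfadjoint_on E \<gamma>out"
    unfolding selfadjoint_on_def
  proof (intro conjI ballI allI)
    fix u v assume u: "u \<in> E" and v: "v \<in> E"
    have uv: "u + v \<in> E" using u v by (rule in_E)
    show "\<gamma>out u \<in> E" using u by (simp add: out' s Y in_E)
    show "\<gamma>out (u + v) = \<gamma>out u + \<gamma>out v"
      using u v uv by (simp add: out' s Y scaleC_add_right complex_vector.scale_right_diff_distrib)
    show "cinner (\<gamma>out u) v = cinner u (\<gamma>out v)"
      using u v by (simp add: out' s Y cinner_linear_simps algebra_simps)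
  next
    fix c u assume u: "u \<in> E"
    have cu: "c *\<^sub>C u \<in> E" using u by (rule in_E)
    show "\<gamma>out (c *\<^sub>C u) = c *\<^sub>C \<gamma>out u"
      using u cu
      by (simp add: out' s Y scaleC_add_right complex_vector.scale_right_diff_distrib scaleC_scaleC mult.commute)
  qed
  have col': "cadjoint \<Phi> (\<sigma>1 (\<Phi> h)) = (1 / \<i>) *\<^sub>C (A1 h - cadjoint A1 h)"
    "cadjoint \<Phi> (\<sigma>2 (\<Phi> h)) = (1 / \<i>) *\<^sub>C (A2 h - cadjoint A2 h)" for h
    by (rule cinner_ext; simp add: cinner_cadjoint'[OF bounded(3)] col cinner_scaleC_left cinner_minus_left)+
  have link_out: "\<gamma>out (\<Phi> h) = \<sigma>1 (\<Phi> (A2 h)) - \<sigma>2 (\<Phi> (A1 h))" for h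
  proof -
    have "\<i> *\<^sub>C \<sigma>1 (Y (\<sigma>2 (\<Phi> h))) = \<sigma>1 (\<Phi> (A2 h)) - \<sigma>1 (\<Phi> (cadjoint A2 h))"
      "\<i> *\<^sub>C \<sigma>2 (Y (\<sigma>1 (\<Phi> h))) = \<sigma>2 (\<Phi> (A1 h)) - \<sigma>2 (\<Phi> (cadjoint A1 h))"
      unfolding Y_def col' clinear_scaleC[OF lin\<Phi>(1)] clinear_diff[OF lin\<Phi>(1)]
        selfadjoint_onD(3)[OF sa(1) in_E(3)[OF E(2) E(2)]] selfadjoint_onD(3)[OF sa(2) in_E(3)[OF E(2) E(2)]]
        scaleC_scaleC s_diff(1)[OF E(2) E(2)] s_diff(2)[OF E(2) E(2)]
      by (simp_all add: scaleC_one)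
    then show ?thesis
      by (simp add: out'[OF E(2)] link complex_vector.scale_right_diff_distrib)
  qed
  show ?thesis
    unfolding commutative_vessel_def
    using bounded comm E sa sa_out col' link link_out out by (auto simp: fun_eq_iff)
qed

section \<open>Splitting off a subspace annihilated by selfadjoint operators\<close>

context
  fixes V U :: "'a::complex_inner set"
  assumes V: "fin_dim V" and U: "csubspace U" "U \<subseteq> V"
begin

abbreviation (input) "W \<equiv> orthogonal_complement_in V U"

lemma fin_dim_orthogonal_complement: "fin_dim W"
proof (rule fin_dim_subset[OF V])
  show "csubspace W"
    using fin_dim_csubspace[OF V]
    by (intro complex_vector.subspaceI)
       (auto simp: orthogonal_complement_in_def cinner_linear_simps
         intro: complex_vector.subspace_0 complex_vector.subspace_add complex_vector.subspace_scale)
qed (auto simp: orthogonal_complement_in_def)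

text \<open>The difference is the orthogonal projection of \<open>v\<close> onto \<open>U\<close>.\<close>

lemma diff_proj_orthogonal_complement:
  assumes v: "v \<in> V" shows "v - proj W v \<in> U"
proof -
  have fU: "fin_dim U" by (rule fin_dim_subset[OF V U])
  have "proj W v = v - proj U v"
  proof (rule proj_eqI[OF fin_dim_csubspace[OF fin_dim_orthogonal_complement]])
    have "v - proj U v \<in> V"
      using v U(2) proj_in[OF fU] fin_dim_csubspace[OF V] complex_vector.subspace_diff by blast
    then show "v - proj U v \<in> W"
      by (simp add: orthogonal_complement_in_def cinner_diff_left cinner_proj_left[OF fU])
    fix s assume "s \<in> W"
    then have "cinner s (proj U v) = 0" using proj_in[OF fU] by (simp add: orthogonal_complement_in_def)
    then show "cinner (v - (v - proj U v)) s = 0" by (subst cinner_commute) simp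
  qed
  then show ?thesis using proj_in[OF fU] by simp
qed

text \<open>A selfadjoint operator that annihilates \<open>U\<close> has its range in the complement \<open>W\<close> of \<open>U\<close>, so on
  \<open>W\<close> its compression is the operator itself, and projecting an argument onto \<open>W\<close> changes nothing.\<close>

lemma annihilated_subspace_reduces:
  assumes T: "selfadjoint_on V T" "clinear T" "\<forall>u\<in>U. T u = 0"
  shows "v \<in> V \<Longrightarrow> T v \<in> W" "v \<in> V \<Longrightarrow> T (proj W v) = T v"
    "compression W T w = T (proj W w)" "clinear (compression W T)" "selfadjoint_on W (compression W T)"
proof -
  have W: "fin_dim W" "W \<subseteq> V"
    using fin_dim_orthogonal_complement by (auto simp: orthogonal_complement_in_def)
  show 1: "T v \<in> W" if v: "v \<in> V" for v
    using T(1,3) U(2) v unfolding selfadjoint_on_def orthogonal_complement_in_def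
    by (auto simp: cinner_zero_right)
  show "T (proj W v) = T v" if v: "v \<in> V"
    using bspec[OF T(3) diff_proj_orthogonal_complement[OF v]] by (simp add: clinear_diff[OF T(2)])
  show 2: "compression W T w = T (proj W w)" for w
    using 1 proj_in[OF W(1)] W(2) by (auto simp: compression_def intro!: proj_fixed W)
  show 3: "clinear (compression W T)"
    unfolding compression_def by (intro clinear_compose clinear_proj W T)
  have "compression W T u = T u" if "u \<in> W" for u
    unfolding 2 by (simp add: proj_fixed W that)
  then show "selfadjoint_on W (compression W T)"
    using T(1) 1 subsetD[OF W(2)] unfolding selfadjoint_on_def
    by (auto simp: clinear_add[OF 3] clinear_scaleC[OF 3])
qed

end

section \<open>The transformed vessel\<close>

context irreducible_pencil
begin

text \<open>At a common zero of the two polynomials every pairing with a generic Vandermonde vector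
  vanishes.\<close>

lemma compression_basepoint:
  assumes bez: "is_bezout_matrices n p q \<beta>" and x: "(x0, x1, x2) \<noteq> (0, 0, 0)"
    and e: "P (x0, x1, x2) e = 0" and zero: "p (x0, x1, x2) = 0" "q (x0, x1, x2) = 0"
  shows "compression (V n) (B n \<beta>) (vandermonde n (x0, x1, x2) e) = 0"
proof (rule vandermonde_complete_generic[OF compression_V(2)[OF clinear_bezout_operator] infinite_curve order_refl x])
  fix y1 y2 f assume f: "P (1, y1, y2) f = 0" and ind: "x1 \<noteq> x0 * cnj y1 \<or> x2 \<noteq> x0 * cnj y2"
  show "cinner (compression (V n) (B n \<beta>) (vandermonde n (x0, x1, x2) e)) (vandermonde n (1, y1, y2) f) = 0"
    using vandermonde_pairing[OF e f ind] bez zero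
    by (simp add: compression_V(3)[OF clinear_bezout_operator] vandermonde_in_V e f) (metis diff_self mult_zero_left mult_zero_right)
qed

text \<open>Paired with a generic Vandermonde vector at \<open>y\<close>, the combination is a multiple of the
  alternating expression in \<open>P0\<close>, \<open>P1\<close>, \<open>P2\<close> at the arguments \<open>x\<close>, \<open>x\<close> and the conjugate of \<open>y\<close>.\<close>

lemma compression_kernel:
  assumes bez: "is_bezout_matrices n P1 P0 \<beta>1" "is_bezout_matrices n P2 P0 \<beta>2" "is_bezout_matrices n P1 P2 \<beta>3"
    and e: "P (1, x1, x2) e = 0"
    and z: "P0 (1, x1, x2) * z1 = P1 (1, x1, x2)" "P0 (1, x1, x2) * z2 = P2 (1, x1, x2)"
  shows "z1 *\<^sub>C compression (V n) (B n \<beta>2) (vandermonde n (1, x1, x2) e)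
    - z2 *\<^sub>C compression (V n) (B n \<beta>1) (vandermonde n (1, x1, x2) e)
    + compression (V n) (B n \<beta>3) (vandermonde n (1, x1, x2) e) = 0" (is "?l = 0")
proof (rule vandermonde_complete_generic[of ?l n, OF _ infinite_curve order_refl, of 1 x1 x2])
  show "?l \<in> V n"
    by (intro complex_vector.subspace_add complex_vector.subspace_diff complex_vector.subspace_scale
        csubspace_V compression_V clinear_bezout_operator)
  fix y1 y2 f assume f: "P (1, y1, y2) f = 0" and ind: "x1 \<noteq> 1 * cnj y1 \<or> x2 \<noteq> 1 * cnj y2"
  obtain c where c: "\<And>n p q \<beta>. is_bezout_matrices n p q \<beta> \<Longrightarrow>
      cinner (B n \<beta> (vandermonde n (1, x1, x2) e)) (vandermonde n (1, y1, y2) f) =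
        c * (p (1, x1, x2) * q (1, cnj y1, cnj y2) - q (1, x1, x2) * p (1, cnj y1, cnj y2))"
    using vandermonde_pairing[OF e f ind] by metis
  show "cinner ?l (vandermonde n (1, y1, y2) f) = 0"
    unfolding cinner_linear_simps
      compression_V(3)[OF clinear_bezout_operator vandermonde_in_V[OF e] vandermonde_in_V[OF f]]
      bez[THEN c] z[symmetric]
    by (simp add: algebra_simps)
qed simp

text \<open>A polynomial function on \<open>\<complex>\<^sup>2\<close> that vanishes everywhere is the zero polynomial, which is not
  irreducible.\<close>

lemma curve_neq_UNIV: "curve \<noteq> UNIV"
proof
  assume "curve = UNIV"
  then have zero: "eval2 (discriminant_poly UNIV \<sigma>1 \<sigma>2 \<gamma>) (y1, y2) = 0" for y1 y2
    unfolding curve_eq by blast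
  let ?F = "discriminant_poly UNIV \<sigma>1 \<sigma>2 \<gamma>"
  have "poly (coeff ?F k) y1 = 0" for k y1
  proof -
    have "map_poly (\<lambda>c. poly c y1) ?F = 0"
      using zero[of y1] poly_all_0_iff_0 unfolding eval2_conv_map_poly by blast
    then have "coeff (map_poly (\<lambda>c. poly c y1) ?F) k = 0" by simp
    then show ?thesis by (simp add: coeff_map_poly)
  qed
  then have "coeff ?F k = 0" for k using poly_all_0_iff_0 by blast
  then have "?F = 0" by (simp add: poly_eq_iff)
  then show False using irreducible_affine by simp
qed

text \<open>Completeness for \<open>n = 1\<close>, where the principal subspace is \<open>E\<close>: the kernels at the points of an
  infinite subset of the curve span \<open>E\<close>.\<close>

lemma kernels_complete:
  assumes Z: "infinite Z" "Z \<subseteq> curve"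
    and orth: "\<And>y1 y2 f. (y1, y2) \<in> Z \<Longrightarrow> P (1, y1, y2) f = 0 \<Longrightarrow> cinner v f = 0"
  shows "v = 0"
proof -
  have M: "multi_indices (Suc 0) = {(0, 0, 0)}" "multi_indices 0 = {}" by (auto simp: multi_indices_def)
  have "tuple 1 (\<lambda>_. v) = 0"
  proof (rule vandermonde_complete[OF _ Z])
    show "tuple 1 (\<lambda>_. v) \<in> V 1" using support_tuple[of "Suc 0"] by (simp add: in_V_iff M)
    fix y1 y2 f assume "(y1, y2) \<in> Z" "P (1, y1, y2) f = 0"
    then have "cinner v f = 0" by (rule orth)
    then show "cinner (tuple 1 (\<lambda>_. v)) (vandermonde 1 (1, y1, y2) f) = 0"
      by (simp add: cinner_tuple_left M component_vandermonde monomial_def scaleC_one)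
  qed
  then have "component (tuple 1 (\<lambda>_. v)) (0, 0, 0) = 0" by (simp add: component_zero)
  then show ?thesis by (simp add: component_tuple M)
qed

end

locale transformed_vessel = vessel_pencil \<sigma>1 \<sigma>2 \<gamma> A1 A2 \<Phi>
  for \<sigma>1 \<sigma>2 \<gamma> :: "'e::complex_inner \<Rightarrow> 'e"
    and A1 A2 :: "'h::complex_hilbert \<Rightarrow> 'h" and \<Phi> :: "'h \<Rightarrow> 'e" +
  fixes p0 p1 p2 :: "real poly poly" and n :: nat and \<beta>\<sigma>1 \<beta>\<sigma>2 \<beta>\<gamma> :: bezout_matrices
  assumes invertible: "boundedly_invertible (op_poly p0 A1 A2)"
    and degree: "total_degree p0 \<le> n" "total_degree p1 \<le> n" "total_degree p2 \<le> n"
    and bezout: "is_bezout_matrices n (homogenize n p1) (homogenize n p0) \<beta>\<sigma>1"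
      "is_bezout_matrices n (homogenize n p2) (homogenize n p0) \<beta>\<sigma>2"
      "is_bezout_matrices n (homogenize n p1) (homogenize n p2) \<beta>\<gamma>"
begin

definition S :: "'h \<Rightarrow> 'h" where "S = the_inv (op_poly p0 A1 A2)"

abbreviation "S' \<equiv> cadjoint S"
abbreviation "R p \<equiv> op_poly p T1 T2"
abbreviation "A1' \<equiv> S \<circ> op_poly p1 A1 A2"
abbreviation "A2' \<equiv> S \<circ> op_poly p2 A1 A2"
abbreviation "\<Phi>' h \<equiv> \<Psi> n (S' h)"
abbreviation "\<sigma>1' \<equiv> compression (V n) (B n \<beta>\<sigma>1)"
abbreviation "\<sigma>2' \<equiv> compression (V n) (B n \<beta>\<sigma>2)"
abbreviation "\<gamma>' \<equiv> compression (V n) (B n \<beta>\<gamma>)"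

lemma S: "bounded_clinear S" "S (op_poly p0 A1 A2 h) = h" "op_poly p0 A1 A2 (S h) = h"
proof -
  obtain S0 where S0: "bounded_clinear S0" "S0 \<circ> op_poly p0 A1 A2 = id" "op_poly p0 A1 A2 \<circ> S0 = id"
    using invertible unfolding boundedly_invertible_def by blast
  then have eq: "S = S0" unfolding S_def by (intro the_inv_eqI)
  show "bounded_clinear S" "S (op_poly p0 A1 A2 h) = h" "op_poly p0 A1 A2 (S h) = h"
    unfolding eq using S0 by (auto simp: fun_eq_iff)
qed

lemma bounded_op_poly: "bounded_clinear (op_poly p A1 A2)" "bounded_clinear (R p)"
  by (intro bounded_clinear_op_poly bounded bounded_T)+

lemma op_poly_A: "op_poly p A1 A2 (A1 h) = A1 (op_poly p A1 A2 h)"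
  "op_poly p A1 A2 (A2 h) = A2 (op_poly p A1 A2 h)"
  using op_poly_commute[of A1 A1 A2] op_poly_commute[of A2 A1 A2] bounded(1,2) commute
  by (auto simp: bounded_clinear_clinear)

lemma S_commute:
  assumes "\<And>h. op_poly p0 A1 A2 (T h) = T (op_poly p0 A1 A2 h)" shows "S (T h) = T (S h)"
  by (metis S(2,3) assms)

lemma S_A: "S (A1 h) = A1 (S h)" "S (A2 h) = A2 (S h)"
  by (intro S_commute op_poly_A)+

lemma S_op_poly: "S (op_poly p A1 A2 h) = op_poly p A1 A2 (S h)"
  by (intro op_poly_commute bounded_clinear_clinear S S_A)

lemma op_poly_op_poly: "op_poly p A1 A2 (op_poly q A1 A2 h) = op_poly q A1 A2 (op_poly p A1 A2 h)"
  by (intro op_poly_commute bounded_clinear_clinear bounded_op_poly op_poly_A)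

lemma A'_commute: "A1' (A2' h) = A2' (A1' h)"
  by (simp add: S_op_poly op_poly_op_poly)

lemma bounded_A': "bounded_clinear A1'" "bounded_clinear A2'"
  by (intro bounded_clinear_compose S bounded_op_poly)+

lemma S'_T: "S' (T1 h) = T1 (S' h)" "S' (T2 h) = T2 (S' h)"
  by (intro cadjoint_commute S bounded S_A)+

lemma clinear_S': "clinear S'"
  by (intro bounded_clinear_clinear bounded_clinear_cadjoint S)

lemma R_commute:
  assumes "clinear N" "\<And>u. N (T1 u) = T1 (N u)" "\<And>u. N (T2 u) = T2 (N u)"
  shows "N (R p u) = R p (N u)"
  by (rule op_poly_commute) (fact assms)+

lemma R_S': "R p (S' h) = S' (R p h)"
  by (rule R_commute[OF clinear_S' S'_T, symmetric])

lemma R_R: "R p (R q h) = R q (R p h)"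
proof (rule R_commute[OF bounded_clinear_clinear[OF bounded_op_poly(2)]])
  show "R p (T1 u) = T1 (R p u)" "R p (T2 u) = T2 (R p u)" for u
    by (rule R_commute[symmetric]; simp add: clinear_T T_commute)+
qed

lemma S'_R: "S' (R p0 h) = h"
proof (rule cinner_ext_right)
  fix k
  have "cinner k (S' (R p0 h)) = cinner (op_poly p0 A1 A2 (S k)) h"
    by (simp add: cinner_cadjoint[OF S(1), symmetric] cinner_op_poly_cadjoint[OF bounded(1,2) commute])
  then show "cinner k (S' (R p0 h)) = cinner k h" by (simp add: S)
qed

lemma R_S'_id: "R p0 (S' h) = h"
  by (simp add: R_S' S'_R)

text \<open>Adjoints of inverses are inverses of adjoints, and the adjoint of \<open>p\<^sub>0(A\<^sub>1, A\<^sub>2)\<close> is \<open>p\<^sub>0(T\<^sub>1, T\<^sub>2)\<close> because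
  \<open>p\<^sub>0\<close> is real.\<close>

lemma the_inv_R: "the_inv (op_poly p0 T1 T2) = S'"
  by (rule the_inv_eqI) (auto simp: fun_eq_iff S'_R R_S'_id)

lemma cadjoint_A': "cadjoint A1' h = S' (R p1 h)" "cadjoint A2' h = S' (R p2 h)"
proof -
  have "cinner (S (op_poly p A1 A2 k)) h = cinner k (S' (R p h))" for p k
    by (simp add: cinner_cadjoint[OF S(1)] cinner_op_poly_cadjoint[OF bounded(1,2) commute] R_S')
  then show "cadjoint A1' h = S' (R p1 h)" "cadjoint A2' h = S' (R p2 h)"
    by (auto intro!: cadjoint_eqI bounded_A')
qed

lemma bounded_\<Phi>': "bounded_clinear (\<lambda>h. \<Phi>' h)"
  using bounded_clinear_compose[OF bounded_clinear_\<Psi>[of n] bounded_clinear_cadjoint[OF S(1)]] by (simp add: o_def)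

lemmas clinear_coeffs' =
  compression_V(1)[OF clinear_bezout_operator[where n = n and \<beta> = \<beta>\<sigma>1], where n = n]
  compression_V(1)[OF clinear_bezout_operator[where n = n and \<beta> = \<beta>\<sigma>2], where n = n]
  compression_V(1)[OF clinear_bezout_operator[where n = n and \<beta> = \<beta>\<gamma>], where n = n]

lemma selfadjoint': "selfadjoint_on (V n) \<sigma>1'" "selfadjoint_on (V n) \<sigma>2'" "selfadjoint_on (V n) \<gamma>'"
  by (rule selfadjoint_compression[OF bezout(1)] selfadjoint_compression[OF bezout(2)]
      selfadjoint_compression[OF bezout(3)]; rule homogenize_cnj)+

text \<open>In the form computed above \<open>p\<^sub>0(T\<^sub>1, T\<^sub>2)\<close> cancels the inverse in \<open>\<Phi>'\<close>.\<close>

lemma colligation':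
  "cinner (\<sigma>1' (\<Phi>' h)) (\<Phi>' k) = (1 / \<i>) * cinner (A1' h - cadjoint A1' h) k"
  "cinner (\<sigma>2' (\<Phi>' h)) (\<Phi>' k) = (1 / \<i>) * cinner (A2' h - cadjoint A2' h) k"
proof -
  have *: "cinner (compression (V n) (B n \<beta>) (\<Phi>' h)) (\<Phi>' k) =
      (1 / \<i>) * cinner (S (op_poly p A1 A2 h) - S' (R p h)) k"
    if "is_bezout_matrices n (homogenize n p) (homogenize n p0) \<beta>" "total_degree p \<le> n" for p \<beta>
  proof -
    have "cinner (compression (V n) (B n \<beta>) (\<Phi>' h)) (\<Phi>' k) = cinner (B n \<beta> (\<Phi>' h)) (\<Phi>' k)"
      by (rule compression_V(3)[OF clinear_bezout_operator \<Psi>_in_V \<Psi>_in_V])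
    also have "\<dots> = \<i> * (cinner (S' (R p h)) k - cinner h (S' (R p k)))"
      by (simp add: cinner_bezout_\<Psi>_\<Psi>[OF that(1) that(2) degree(1)] R_S' S'_R)
    also have "cinner h (S' (R p k)) = cinner (S (op_poly p A1 A2 h)) k"
      by (simp add: cinner_cadjoint[OF S(1)] cinner_op_poly_cadjoint[OF bounded(1,2) commute] R_S')
    finally show ?thesis by (simp add: cinner_diff_left algebra_simps)
  qed
  show "cinner (\<sigma>1' (\<Phi>' h)) (\<Phi>' k) = (1 / \<i>) * cinner (A1' h - cadjoint A1' h) k"
    using *[OF bezout(1) degree(2)] by (simp add: cadjoint_A')
  show "cinner (\<sigma>2' (\<Phi>' h)) (\<Phi>' k) = (1 / \<i>) * cinner (A2' h - cadjoint A2' h) k"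
    using *[OF bezout(2) degree(3)] by (simp add: cadjoint_A')
qed

definition defect :: "'h \<Rightarrow> (multi_index, 'e) family" where
  "defect h = \<gamma>' (\<Phi>' h) - (\<sigma>1' (\<Phi>' (cadjoint A2' h)) - \<sigma>2' (\<Phi>' (cadjoint A1' h)))"

lemma bounded_defect: "bounded_clinear defect"
proof -
  have C: "bounded_clinear (compression (V n) (B n \<beta>))" for \<beta>
    unfolding compression_def comp_assoc
    by (intro bounded_clinear_compose bounded_clinear_proj fin_dim_V bounded_clinear_compose_proj
        clinear_bezout_operator)
  have 1: "bounded_clinear (\<lambda>h. compression (V n) (B n \<beta>) (\<Phi>' (F h)))" if "bounded_clinear F" for \<beta> F
    using bounded_clinear_compose[OF C[of \<beta>] bounded_clinear_compose[OF bounded_\<Phi>' that]] by (simp add: o_def)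
  have 2: "bounded_clinear (\<lambda>h. compression (V n) (B n \<beta>) (\<Phi>' h))" for \<beta>
    using bounded_clinear_compose[OF C[of \<beta>] bounded_\<Phi>'] by (simp add: o_def)
  show ?thesis
    unfolding defect_def[abs_def]
    by (intro bounded_clinear_diff 1 2 bounded_clinear_cadjoint bounded_A')
qed

lemma defect_in_V: "defect h \<in> V n"
  unfolding defect_def
  by (intro complex_vector.subspace_diff csubspace_V compression_V clinear_bezout_operator)

text \<open>The three terms of the defect give the alternating expression in \<open>p\<^sub>0\<close>, \<open>p\<^sub>1\<close>, \<open>p\<^sub>2\<close> at the
  arguments \<open>T\<close>, \<open>T\<close> and the conjugate of \<open>y\<close>, which vanishes.\<close>

lemma cinner_defect_eq_0:
  assumes f: "P (1, y1, y2) f = 0"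
    and \<xi>: "\<And>u v. \<xi> (u + v) = \<xi> u + \<xi> v" "\<And>r u. \<xi> (r *\<^sub>R u) = complex_of_real r * \<xi> u"
    and N: "clinear N" "\<And>u. N (T1 u) = T1 (N u)" "\<And>u. N (T2 u) = T2 (N u)" "\<And>u. N (S' u) = S' (N u)"
    and pair: "\<And>u. cinner (\<sigma>1 (\<Phi> (N u))) f = \<xi> (T1 u) - cnj y1 * \<xi> u"
      "\<And>u. cinner (\<sigma>2 (\<Phi> (N u))) f = \<xi> (T2 u) - cnj y2 * \<xi> u"
      "\<And>u. cinner (\<gamma> (\<Phi> (N u))) f = cnj y2 * \<xi> (T1 u) - cnj y1 * \<xi> (T2 u)"
  shows "cinner (defect (N h)) (vandermonde n (1, y1, y2) f) = 0"
proof -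
  note pairing = cinner_bezout_\<Psi>_vandermonde[OF _ _ _ \<xi> N(1-3) pair]
  note C = compression_V(3)[OF clinear_bezout_operator \<Psi>_in_V vandermonde_in_V[OF f]]
  have NR: "N (R p u) = R p (N u)" for p u by (rule R_commute[OF N(1-3)])
  show ?thesis
    unfolding defect_def cinner_diff_left C cadjoint_A' N(4)[symmetric] NR[symmetric]
      pairing[OF bezout(1) degree(2,1)] pairing[OF bezout(2) degree(3,1)] pairing[OF bezout(3) degree(2,3)]
    by (simp add: R_S' S'_R R_R[of p1 p2] algebra_simps)
qed

text \<open>The defect paired with a Vandermonde vector at \<open>y\<close> is a bounded functional that is an
  eigenfunctional of both adjoints; it vanishes once \<open>y\<close> lies outside a bidisk.\<close>

lemma linkage': "\<gamma>' (\<Phi>' h) = \<sigma>1' (\<Phi>' (cadjoint A2' h)) - \<sigma>2' (\<Phi>' (cadjoint A1' h))"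
proof -
  obtain K1 where K1: "K1 > 0" "\<And>h. norm (T1 h) \<le> norm h * K1"
    using bounded_clinear_bound[OF bounded_T(1)] by metis
  obtain K2 where K2: "K2 > 0" "\<And>h. norm (T2 h) \<le> norm h * K2"
    using bounded_clinear_bound[OF bounded_T(2)] by metis
  obtain K where K: "\<And>h. norm (defect h) \<le> norm h * K"
    using bounded_clinear_bound[OF bounded_defect] by metis
  let ?Z = "{(y1, y2). eval2 (discriminant_poly UNIV \<sigma>1 \<sigma>2 \<gamma>) (y1, y2) = 0 \<and>
    (max K1 K2 < cmod y1 \<or> max K1 K2 < cmod y2)}"
  have "defect h = 0"
  proof (rule vandermonde_complete[OF defect_in_V affine_curve_unbounded[OF irreducible_affine, of "max K1 K2"]])
    show "?Z \<subseteq> curve" by (auto simp: curve_eq)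
    fix y1 y2 f assume y: "(y1, y2) \<in> ?Z" and f: "P (1, y1, y2) f = 0"
    let ?v = "vandermonde n (1, y1, y2) f"
    define D where "D h = cinner (defect h) ?v" for h
    define s1 where "s1 u = cinner (\<sigma>1 (\<Phi> u)) f" for u
    define s2 where "s2 u = cinner (\<sigma>2 (\<Phi> u)) f" for u
    define g where "g u = cinner (\<gamma> (\<Phi> u)) f" for u
    note lin = clinear_add[OF clinear_\<Phi>] clinear_diff[OF clinear_\<Phi>] clinear_scaleC[OF clinear_\<Phi>]
      clinear_scaleR[OF clinear_\<Phi>] coeffs_linear clinear_coeffs[THEN clinear_scaleR]
      cinner_linear_simps cinner_scaleR_left
    have add: "s1 (u + v) = s1 u + s1 v" "s2 (u + v) = s2 u + s2 v" "g (u + v) = g u + g v" for u v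
      by (simp_all add: s1_def s2_def g_def lin)
    have diff: "s1 (u - v) = s1 u - s1 v" "s2 (u - v) = s2 u - s2 v" "g (u - v) = g u - g v" for u v
      by (simp_all add: s1_def s2_def g_def lin)
    have scale: "s1 (c *\<^sub>C u) = c * s1 u" "s2 (c *\<^sub>C u) = c * s2 u" "g (c *\<^sub>C u) = c * g u" for c u
      by (simp_all add: s1_def s2_def g_def lin)
    have scaleR: "s1 (r *\<^sub>R u) = complex_of_real r * s1 u" "s2 (r *\<^sub>R u) = complex_of_real r * s2 u" for r u
      by (simp_all add: s1_def s2_def lin)
    have g_link: "g u = s1 (T2 u) - s2 (T1 u)" for u
      by (simp add: s1_def s2_def g_def linkage cinner_diff_left)
    have g_ker: "g u = cnj y2 * s1 u - cnj y1 * s2 u" for u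
    proof -
      have "cinner (\<Phi> u) (P (1, y1, y2) f) = 0" using f by (simp add: cinner_zero_right)
      then show ?thesis
        by (simp add: s1_def s2_def g_def pencil_def cinner_linear_simps cinner_coeffs algebra_simps)
    qed
    have s2_T1: "s2 (T1 u) = s1 (T2 u) - cnj y2 * s1 u + cnj y1 * s2 u" for u
      using g_link[of u] g_ker[of u] by (simp add: algebra_simps)
    have linN: "clinear (\<lambda>u. T u - c *\<^sub>C u)" if "clinear T" for T :: "'h \<Rightarrow> 'h" and c
      using that by (simp add: clinear_def scaleC_add_right scaleC_scaleC
          complex_vector.scale_right_diff_distrib mult.commute)
    have D_diff: "D (u - v) = D u - D v" and D_scale: "D (c *\<^sub>C u) = c * D u" for u v c
      using bounded_clinear_clinear[OF bounded_defect]
      by (simp_all add: D_def clinear_diff clinear_scaleC cinner_diff_left cinner_scaleC_left)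
    note lT = clinear_diff[OF clinear_T(1)] clinear_diff[OF clinear_T(2)] clinear_scaleC[OF clinear_T(1)]
      clinear_scaleC[OF clinear_T(2)] clinear_diff[OF clinear_S'] clinear_scaleC[OF clinear_S']
    have "D (T1 h - cnj y1 *\<^sub>C h) = 0" for h
      unfolding D_def
    proof (rule cinner_defect_eq_0[OF f, where \<xi> = s1 and N = "\<lambda>h. T1 h - cnj y1 *\<^sub>C h"])
      show "cinner (\<gamma> (\<Phi> (T1 u - cnj y1 *\<^sub>C u))) f = cnj y2 * s1 (T1 u) - cnj y1 * s1 (T2 u)" for u
        unfolding g_def[symmetric] g_ker diff scale s2_T1 by (simp add: algebra_simps)
      show "cinner (\<sigma>2 (\<Phi> (T1 u - cnj y1 *\<^sub>C u))) f = s1 (T2 u) - cnj y2 * s1 u" for u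
        unfolding s2_def[symmetric] diff scale s2_T1 by (simp add: algebra_simps)
      show "cinner (\<sigma>1 (\<Phi> (T1 u - cnj y1 *\<^sub>C u))) f = s1 (T1 u) - cnj y1 * s1 u" for u
        unfolding s1_def[symmetric] diff scale by simp
    qed (simp_all add: add scaleR linN clinear_T lT T_commute S'_T)
    then have D1: "D (T1 h) = cnj y1 * D h" for h
      by (simp add: D_diff D_scale)
    have "D (T2 h - cnj y2 *\<^sub>C h) = 0" for h
      unfolding D_def
    proof (rule cinner_defect_eq_0[OF f, where \<xi> = s2 and N = "\<lambda>h. T2 h - cnj y2 *\<^sub>C h"])
      show "cinner (\<gamma> (\<Phi> (T2 u - cnj y2 *\<^sub>C u))) f = cnj y2 * s2 (T1 u) - cnj y1 * s2 (T2 u)" for u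
        unfolding g_def[symmetric] g_ker diff scale s2_T1 by (simp add: algebra_simps)
      show "cinner (\<sigma>1 (\<Phi> (T2 u - cnj y2 *\<^sub>C u))) f = s2 (T1 u) - cnj y1 * s2 u" for u
        unfolding s1_def[symmetric] diff scale s2_T1 by (simp add: algebra_simps)
      show "cinner (\<sigma>2 (\<Phi> (T2 u - cnj y2 *\<^sub>C u))) f = s2 (T2 u) - cnj y2 * s2 u" for u
        unfolding s2_def[symmetric] diff scale by simp
    qed (simp_all add: add scaleR linN clinear_T lT T_commute S'_T)
    then have D2: "D (T2 h) = cnj y2 * D h" for h
      by (simp add: D_diff D_scale)
    have D_bound: "cmod (D h) \<le> norm h * (K * norm ?v)" for h
    proof -
      have "cmod (D h) \<le> norm (defect h) * norm ?v" unfolding D_def by (rule cauchy_schwarz)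
      also have "\<dots> \<le> (norm h * K) * norm ?v" by (intro mult_right_mono K) simp
      finally show ?thesis by (simp add: mult.assoc)
    qed
    consider "K1 < cmod (cnj y1)" | "K2 < cmod (cnj y2)" using y by auto
    then have "D h = 0"
    proof cases
      case 1
      then show ?thesis using functional_eq_0[OF D_bound K1(2) _ D1] K1(1) by simp
    next
      case 2
      then show ?thesis using functional_eq_0[OF D_bound K2(2) _ D2] K2(1) by simp
    qed
    then show "cinner (defect h) ?v = 0" by (simp add: D_def)
  qed
  then show ?thesis by (simp add: defect_def)
qed

end

section \<open>Removing the basepoints\<close>

context transformed_vessel
begin

definition basepoint_span :: "(multi_index, 'e) family set" where
  "basepoint_span = cspan (basepoint_vectors n \<sigma>1 \<sigma>2 \<gamma> (homogenize n p0) (homogenize n p1) (homogenize n p2))"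

abbreviation "E'' \<equiv> orthogonal_complement_in (V n) basepoint_span"
abbreviation "\<sigma>1'' \<equiv> compression E'' \<sigma>1'"
abbreviation "\<sigma>2'' \<equiv> compression E'' \<sigma>2'"
abbreviation "\<gamma>'' \<equiv> compression E'' \<gamma>'"

text \<open>Each operator vanishes on the generators by the pairing formula at a basepoint.\<close>

lemma basepoint_span: "csubspace basepoint_span" "basepoint_span \<subseteq> V n"
  "\<forall>u\<in>basepoint_span. \<sigma>1' u = 0" "\<forall>u\<in>basepoint_span. \<sigma>2' u = 0" "\<forall>u\<in>basepoint_span. \<gamma>' u = 0"
proof -
  let ?B = "basepoint_vectors n \<sigma>1 \<sigma>2 \<gamma> (homogenize n p0) (homogenize n p1) (homogenize n p2)"
  show "csubspace basepoint_span" unfolding basepoint_span_def by simp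
  show "basepoint_span \<subseteq> V n"
    unfolding basepoint_span_def
    by (rule complex_vector.span_minimal[OF _ csubspace_V]) (auto simp: basepoint_vectors_def vandermonde_in_V)
  have kill: "compression (V n) (B n \<beta>) u = 0"
    if B: "\<And>u. u \<in> ?B \<Longrightarrow> compression (V n) (B n \<beta>) u = 0" and u: "u \<in> basepoint_span" for u \<beta>
  proof -
    have "clinear (compression (V n) (B n \<beta>))" by (rule compression_V(1)[OF clinear_bezout_operator])
    then have "csubspace {u. compression (V n) (B n \<beta>) u = 0}"
      by (intro complex_vector.subspaceI)
         (auto simp: clinear_add clinear_scaleC clinear_zero complex_vector.scale_zero_right)
    then have "cspan ?B \<subseteq> {u. compression (V n) (B n \<beta>) u = 0}"
      using B by (intro complex_vector.span_minimal) auto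
    then show ?thesis using u by (auto simp: basepoint_span_def)
  qed
  have base: "compression (V n) (B n \<beta>) u = 0"
    if bez: "is_bezout_matrices n p q \<beta>" and u: "u \<in> ?B" "p \<in> homogenize n ` {p0, p1, p2}" "q \<in> homogenize n ` {p0, p1, p2}"
    for u \<beta> p q
  proof -
    obtain x e where "u = vandermonde n x e" "x \<in> projective_curve \<sigma>1 \<sigma>2 \<gamma>" "P x e = 0" "p x = 0" "q x = 0"
      using u by (auto simp: basepoint_vectors_def)
    then show ?thesis
      using compression_basepoint[OF bez] by (cases x) (auto simp: projective_curve_def)
  qed
  show "\<forall>u\<in>basepoint_span. \<sigma>1' u = 0" by (rule ballI, rule kill[OF base[OF bezout(1)]]) auto
  show "\<forall>u\<in>basepoint_span. \<sigma>2' u = 0" by (rule ballI, rule kill[OF base[OF bezout(2)]]) auto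
  show "\<forall>u\<in>basepoint_span. \<gamma>' u = 0" by (rule ballI, rule kill[OF base[OF bezout(3)]]) auto
qed

lemmas fin_dim_E'' = fin_dim_orthogonal_complement[OF fin_dim_V basepoint_span(1,2)]
lemmas reduced1 = annihilated_subspace_reduces[OF fin_dim_V basepoint_span(1,2) selfadjoint'(1) clinear_coeffs'(1) basepoint_span(3)]
lemmas reduced2 = annihilated_subspace_reduces[OF fin_dim_V basepoint_span(1,2) selfadjoint'(2) clinear_coeffs'(2) basepoint_span(4)]
lemmas reduced3 = annihilated_subspace_reduces[OF fin_dim_V basepoint_span(1,2) selfadjoint'(3) clinear_coeffs'(3) basepoint_span(5)]

lemma E''_subset: "E'' \<subseteq> V n"
  by (auto simp: orthogonal_complement_in_def)

lemma proj_V_E'': "proj E'' v \<in> V n"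
  using proj_in[OF fin_dim_E''] E''_subset by blast

definition \<gamma>out' :: "(multi_index, 'e) family \<Rightarrow> (multi_index, 'e) family" where
  "\<gamma>out' w = \<gamma>' w + \<i> *\<^sub>C (\<sigma>1' (\<Phi>' (cadjoint (\<lambda>h. \<Phi>' h) (\<sigma>2' w)))
     - \<sigma>2' (\<Phi>' (cadjoint (\<lambda>h. \<Phi>' h) (\<sigma>1' w))))"

text \<open>The range of \<open>\<Phi>'\<close> meets the coefficients only through its projection to \<open>E''\<close>, so every
  condition for \<open>\<Phi>''\<close> is the one for \<open>\<Phi>'\<close>.\<close>

lemma reduced_vessel:
  "commutative_vessel A1' A2' (proj E'' \<circ> (\<lambda>h. \<Phi>' h)) E'' \<sigma>1'' \<sigma>2'' \<gamma>'' (compression E'' \<gamma>out')"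
proof (rule commutative_vesselI[OF bounded_A' _ A'_commute fin_dim_E''])
  let ?\<Phi> = "proj E'' \<circ> (\<lambda>h. \<Phi>' h)"
  show bd: "bounded_clinear ?\<Phi>"
    by (intro bounded_clinear_compose bounded_clinear_proj fin_dim_E'' bounded_\<Phi>')
  show in_E: "?\<Phi> h \<in> E''" for h by (simp add: proj_in[OF fin_dim_E''])
  show "selfadjoint_on E'' \<sigma>1''" "selfadjoint_on E'' \<sigma>2''" "selfadjoint_on E'' \<gamma>''"
    by (rule reduced1(5) reduced2(5) reduced3(5))+
  have on_\<Phi>: "\<sigma>1'' (?\<Phi> h) = \<sigma>1' (\<Phi>' h)" "\<sigma>2'' (?\<Phi> h) = \<sigma>2' (\<Phi>' h)" "\<gamma>'' (?\<Phi> h) = \<gamma>' (\<Phi>' h)" for h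
    unfolding reduced1(3) reduced2(3) reduced3(3) o_def
    by (simp_all add: reduced1(2) reduced2(2) reduced3(2) \<Psi>_in_V proj_V_E'')
  have out_E: "\<sigma>1' (\<Phi>' h) \<in> E''" "\<sigma>2' (\<Phi>' h) \<in> E''" for h
    by (rule reduced1(1)[OF \<Psi>_in_V] reduced2(1)[OF \<Psi>_in_V])+
  show "cinner (\<sigma>1'' (?\<Phi> h)) (?\<Phi> k) = (1 / \<i>) * cinner (A1' h - cadjoint A1' h) k"
    "cinner (\<sigma>2'' (?\<Phi> h)) (?\<Phi> k) = (1 / \<i>) * cinner (A2' h - cadjoint A2' h) k" for h k
    unfolding on_\<Phi> using out_E[of h] colligation'[of h k]
    by (simp_all add: cinner_proj_right[OF fin_dim_E''])
  show "\<gamma>'' (?\<Phi> h) = \<sigma>1'' (?\<Phi> (cadjoint A2' h)) - \<sigma>2'' (?\<Phi> (cadjoint A1' h))" for h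
    unfolding on_\<Phi> by (rule linkage')
  fix e assume e: "e \<in> E''"
  then have eV: "e \<in> V n" using E''_subset by blast
  have pe: "proj E'' e = e" by (rule proj_fixed[OF fin_dim_E'' e])
  have adj: "cadjoint ?\<Phi> w = cadjoint (\<lambda>h. \<Phi>' h) w" if w: "w \<in> E''" for w
    by (rule cadjoint_eqI[OF bd])
       (simp add: cinner_proj_left[OF fin_dim_E'' w] cinner_cadjoint[OF bounded_\<Phi>', symmetric])
  have on_e: "\<sigma>1'' e = \<sigma>1' e" "\<sigma>2'' e = \<sigma>2' e" "\<gamma>'' e = \<gamma>' e"
    unfolding reduced1(3) reduced2(3) reduced3(3) by (simp_all add: pe)
  have se: "\<sigma>1' e \<in> E''" "\<sigma>2' e \<in> E''" "\<gamma>' e \<in> E''"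
    using eV by (rule reduced1(1) reduced2(1) reduced3(1))+
  have "\<gamma>out' e \<in> E''"
    unfolding \<gamma>out'_def using fin_dim_csubspace[OF fin_dim_E'']
    by (intro complex_vector.subspace_add complex_vector.subspace_scale complex_vector.subspace_diff se out_E)
  then have "compression E'' \<gamma>out' e = \<gamma>out' e"
    by (simp add: compression_def pe proj_fixed[OF fin_dim_E''])
  then show "compression E'' \<gamma>out' e = \<gamma>'' e
      + \<i> *\<^sub>C (\<sigma>1'' (?\<Phi> (cadjoint ?\<Phi> (\<sigma>2'' e))) - \<sigma>2'' (?\<Phi> (cadjoint ?\<Phi> (\<sigma>1'' e))))"
    unfolding on_\<Phi> unfolding on_e adj[OF se(1)] adj[OF se(2)] \<gamma>out'_def .
qed

section \<open>The discriminant variety of the transformed vessel\<close>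

context
  fixes C' :: "(complex \<times> complex) set"
  assumes birational: "birational_isomorphism curve C' (complexify p0) (complexify p1) (complexify p2)"
begin

abbreviation "r \<equiv> quotient_map (complexify p0) (complexify p1) (complexify p2)"

text \<open>Away from finitely many points the rational inverse is a genuine left inverse of \<open>r\<close>, so \<open>r\<close> is
  injective there.\<close>

lemma good_points:
  obtains G where "G \<subseteq> curve" "finite (curve - G)" "inj_on r G"
    "\<And>x. x \<in> G \<Longrightarrow> r x \<in> C'" "\<And>x. x \<in> G \<Longrightarrow> eval2 (complexify p0) x \<noteq> 0"
proof -
  obtain q0 q1 q2 where
    q: "rational_left_inverse curve (complexify p0) (complexify p1) (complexify p2) q0 q1 q2"
    using birational unfolding birational_isomorphism_def by blast
  define G where "G = {x \<in> curve. eval2 (complexify p0) x \<noteq> 0 \<and> eval2 q0 (r x) \<noteq> 0 \<and> quotient_map q0 q1 q2 (r x) = x}"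
  have "curve - G = {x \<in> curve. \<not> (eval2 (complexify p0) x \<noteq> 0 \<and> eval2 q0 (r x) \<noteq> 0 \<and> quotient_map q0 q1 q2 (r x) = x)}"
    by (auto simp: G_def)
  then have "finite (curve - G)" using q by (simp add: rational_left_inverse_def)
  moreover have "inj_on r G" by (rule inj_on_inverseI[of _ "quotient_map q0 q1 q2"]) (simp add: G_def)
  moreover have "r x \<in> C'" if "x \<in> G" for x
    using birational that unfolding birational_isomorphism_def rational_mapping_def by (simp add: G_def)
  ultimately show thesis by (intro that) (auto simp: G_def)
qed

text \<open>If the basepoint vectors spanned everything, all coefficients would vanish, so the factors \<open>c\<close>
  in the pairing formula would vanish at pairs of points that \<open>r\<close> separates, and a kernel vector
  would be annihilated by \<open>\<sigma>\<^sub>1\<close>, \<open>\<sigma>\<^sub>2\<close> and \<open>\<gamma>\<close>.\<close>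

lemma E''_nonzero: "\<exists>u\<in>E''. u \<noteq> 0"
proof (rule ccontr)
  assume "\<not> (\<exists>u\<in>E''. u \<noteq> 0)"
  then have "proj E'' v = 0" for v using proj_in[OF fin_dim_E''] by blast
  then have zero: "\<sigma>1' v = 0" "\<sigma>2' v = 0" if "v \<in> V n" for v
    using reduced1(2)[OF that] reduced2(2)[OF that] by (simp_all add: clinear_coeffs'[THEN clinear_zero])
  obtain G where G: "G \<subseteq> curve" "finite (curve - G)" "inj_on r G" "\<And>x. x \<in> G \<Longrightarrow> eval2 (complexify p0) x \<noteq> 0"
    using good_points by metis
  have "infinite G" using G(1,2) infinite_curve by (metis Diff_infinite_finite Diff_Diff_Int Int_absorb1 finite_Diff2)
  then obtain x1 x2 where x: "(x1, x2) \<in> G" by (metis finite.emptyI ex_in_conv surj_pair)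
  then obtain e where e: "e \<noteq> 0" "P (1, x1, x2) e = 0" using G(1) curve_iff by blast
  define Z where "Z = (\<lambda>(y1, y2). (cnj y1, cnj y2)) ` (G - {(x1, x2)})"
  have Z: "infinite Z"
    unfolding Z_def using \<open>infinite G\<close> by (subst finite_image_iff) (auto simp: inj_on_def)
  have Z_curve: "Z \<subseteq> curve" using G(1) cnj_curve by (auto simp: Z_def)
  have "cinner (\<sigma>1 e) f = 0 \<and> cinner (\<sigma>2 e) f = 0 \<and> cinner (\<gamma> e) f = 0"
    if y: "(y1, y2) \<in> Z" and f: "P (1, y1, y2) f = 0" for y1 y2 f
  proof -
    have y': "(cnj y1, cnj y2) \<in> G" "(cnj y1, cnj y2) \<noteq> (x1, x2)" using y by (auto simp: Z_def)
    then have ind: "x1 \<noteq> 1 * cnj y1 \<or> x2 \<noteq> 1 * cnj y2" by auto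
    obtain c where c: "cinner (\<gamma> e) f = c * (x1 * cnj y2 - x2 * cnj y1)"
      "cinner (\<sigma>2 e) f = c * (x2 - 1 * cnj y2)" "cinner (\<sigma>1 e) f = c * (x1 - 1 * cnj y1)"
      "\<And>n p q \<beta>. is_bezout_matrices n p q \<beta> \<Longrightarrow>
        cinner (B n \<beta> (vandermonde n (1, x1, x2) e)) (vandermonde n (1, y1, y2) f) =
          c * (p (1, x1, x2) * q (1, cnj y1, cnj y2) - q (1, x1, x2) * p (1, cnj y1, cnj y2))"
      using vandermonde_pairing[OF e(2) f ind] by metis
    have 1: "c * (homogenize n p1 (1, x1, x2) * homogenize n p0 (1, cnj y1, cnj y2)
        - homogenize n p0 (1, x1, x2) * homogenize n p1 (1, cnj y1, cnj y2)) = 0"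
      using c(4)[OF bezout(1)] zero(1)[OF vandermonde_in_V[OF e(2)]]
        compression_V(3)[OF clinear_bezout_operator[where n = n and \<beta> = \<beta>\<sigma>1]
          vandermonde_in_V[OF e(2), where n = n] vandermonde_in_V[OF f, where n = n]]
      by (simp add: cinner_zero_left)
    have 2: "c * (homogenize n p2 (1, x1, x2) * homogenize n p0 (1, cnj y1, cnj y2)
        - homogenize n p0 (1, x1, x2) * homogenize n p2 (1, cnj y1, cnj y2)) = 0"
      using c(4)[OF bezout(2)] zero(2)[OF vandermonde_in_V[OF e(2)]]
        compression_V(3)[OF clinear_bezout_operator[where n = n and \<beta> = \<beta>\<sigma>2]
          vandermonde_in_V[OF e(2), where n = n] vandermonde_in_V[OF f, where n = n]]
      by (simp add: cinner_zero_left)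
    have "c = 0"
    proof (rule ccontr)
      assume c0: "c \<noteq> 0"
      have nz: "homogenize n p0 (1, x1, x2) \<noteq> 0" "homogenize n p0 (1, cnj y1, cnj y2) \<noteq> 0"
        using G(4)[OF x] G(4)[OF y'(1)] eval2_complexify[OF degree(1)] by simp_all
      have "r (x1, x2) = r (cnj y1, cnj y2)"
        using 1 2 c0 nz unfolding quotient_map_def eval2_complexify[OF degree(1)]
          eval2_complexify[OF degree(2)] eval2_complexify[OF degree(3)]
        by (simp add: field_simps)
      then show False using G(3) x y' by (metis inj_onD)
    qed
    then show ?thesis using c by simp
  qed
  then have "\<sigma>1 e = 0" "\<sigma>2 e = 0" "\<gamma> e = 0"
    by (auto intro!: kernels_complete[OF Z Z_curve])
  then have "P (1, y1, y2) e = 0" for y1 y2 by (simp add: pencil_def complex_vector.scale_zero_right)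
  then have "(y1, y2) \<in> curve" for y1 y2 using e(1) curve_iff by blast
  then have "curve = UNIV" by auto
  then show False using curve_neq_UNIV by blast
qed

text \<open>A nonzero vector of \<open>E''\<close> pairs nontrivially with Vandermonde vectors at all but finitely many
  points \<open>x\<close>; the projection of such a Vandermonde vector is a kernel vector at \<open>r x\<close>. Vanishing
  at infinitely many points of an irreducible curve, the discriminant polynomial is divisible by the
  equation of the curve.\<close>

lemma curve_subset_discriminant_variety:
  assumes "irreducible_plane_curve C'"
  shows "C' \<subseteq> discriminant_variety E'' \<sigma>1'' \<sigma>2'' \<gamma>''"
proof -
  obtain F where F: "Factorial_Ring.irreducible F" "C' = {y. eval2 F y = 0}"
    using assms unfolding irreducible_plane_curve_def by blast
  obtain G where G: "G \<subseteq> curve" "finite (curve - G)" "inj_on r G" "\<And>x. x \<in> G \<Longrightarrow> r x \<in> C'"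
    "\<And>x. x \<in> G \<Longrightarrow> eval2 (complexify p0) x \<noteq> 0"
    using good_points by metis
  obtain u where u: "u \<in> E''" "u \<noteq> 0" using E''_nonzero by blast
  define Z where "Z = {(x1, x2). (x1, x2) \<in> curve \<and> (\<forall>e. P (1, x1, x2) e = 0 \<longrightarrow> cinner u (vandermonde n (1, x1, x2) e) = 0)}"
  have "finite Z"
  proof (rule ccontr)
    assume "infinite Z"
    then have "u = 0"
      using u(1) E''_subset by (intro vandermonde_complete[of u n Z]) (auto simp: Z_def)
    then show False using u(2) by simp
  qed
  then have "finite (curve - (G - Z))"
    using G(2) by (rule_tac finite_subset[of _ "(curve - G) \<union> Z"]) auto
  then have inf: "infinite (G - Z)" using infinite_curve by (metis Diff_infinite_finite finite_Diff2)
  have "F dvd discriminant_poly E'' \<sigma>1'' \<sigma>2'' \<gamma>''"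
  proof (rule irreducible_dvd_if_vanishes[OF F(1), of "r ` (G - Z)"])
    show "infinite (r ` (G - Z))"
      using inf G(3) by (subst finite_image_iff) (auto intro: inj_on_subset)
    fix z assume "z \<in> r ` (G - Z)"
    then obtain x1 x2 where x: "(x1, x2) \<in> G - Z" and z: "z = r (x1, x2)" by auto
    show "eval2 F z = 0" using G(4) x F(2) z by auto
    obtain e where e: "P (1, x1, x2) e = 0" "cinner u (vandermonde n (1, x1, x2) e) \<noteq> 0"
      using x G(1) by (auto simp: Z_def)
    let ?v = "vandermonde n (1, x1, x2) e"
    have vV: "?v \<in> V n" by (rule vandermonde_in_V[OF e(1)])
    obtain z1 z2 where z12: "z = (z1, z2)" by (cases z)
    have "homogenize n p0 (1, x1, x2) \<noteq> 0"
      using G(5) x eval2_complexify[OF degree(1)] by (metis DiffD1)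
    then have z_eq: "homogenize n p0 (1, x1, x2) * z1 = homogenize n p1 (1, x1, x2)"
      "homogenize n p0 (1, x1, x2) * z2 = homogenize n p2 (1, x1, x2)"
      using z z12 unfolding quotient_map_def eval2_complexify[OF degree(1)]
        eval2_complexify[OF degree(2)] eval2_complexify[OF degree(3)] by simp_all
    have "op_det E'' (pencil \<sigma>1'' \<sigma>2'' \<gamma>'' (1, z1, z2)) = 0"
    proof (subst op_det_eq_0_iff[OF fin_dim_E''])
      show "clinear (pencil \<sigma>1'' \<sigma>2'' \<gamma>'' (1, z1, z2))"
        by (intro clinear_pencil reduced1(4) reduced2(4) reduced3(4))
      show "pencil \<sigma>1'' \<sigma>2'' \<gamma>'' (1, z1, z2) s \<in> E''" for s
        unfolding pencil_1 compression_def o_def using fin_dim_csubspace[OF fin_dim_E'']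
        by (intro complex_vector.subspace_add complex_vector.subspace_scale
            complex_vector.subspace_diff proj_in fin_dim_E'')
      have "\<sigma>1'' (proj E'' ?v) = \<sigma>1' ?v" "\<sigma>2'' (proj E'' ?v) = \<sigma>2' ?v" "\<gamma>'' (proj E'' ?v) = \<gamma>' ?v"
        unfolding reduced1(3) reduced2(3) reduced3(3)
        using vV by (simp_all add: reduced1(2) reduced2(2) reduced3(2) proj_V_E'')
      then have "pencil \<sigma>1'' \<sigma>2'' \<gamma>'' (1, z1, z2) (proj E'' ?v) = 0"
        unfolding pencil_1 using compression_kernel[OF bezout e(1) z_eq] by simp
      moreover have "proj E'' ?v \<noteq> 0"
        using cinner_proj_right[OF fin_dim_E'' u(1), of ?v] e(2) by (auto simp: cinner_zero_right)
      ultimately show "\<exists>e\<in>E''. e \<noteq> 0 \<and> pencil \<sigma>1'' \<sigma>2'' \<gamma>'' (1, z1, z2) e = 0"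
        using proj_in[OF fin_dim_E''] by blast
    qed
    then show "eval2 (discriminant_poly E'' \<sigma>1'' \<sigma>2'' \<gamma>'') z = 0"
      by (simp add: z12 eval2_discriminant_poly)
  qed
  then obtain Q where "discriminant_poly E'' \<sigma>1'' \<sigma>2'' \<gamma>'' = F * Q" by (elim dvdE)
  then show ?thesis
    unfolding discriminant_variety_eq F(2) by (auto simp: eval2_def)
qed

end

end

section \<open>Vessels of birational images of the discriminant curve\<close>

theorem theorem3p3:
  fixes A1 A2 :: "'h::complex_hilbert \<Rightarrow> 'h"
    and \<Phi> :: "'h \<Rightarrow> 'e::complex_inner"
    and \<sigma>1 \<sigma>2 \<gamma>in \<gamma>out :: "'e \<Rightarrow> 'e"
    and p0 p1 p2 :: "real poly poly"
    and C' :: "(complex \<times> complex) set"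
    and \<beta>\<sigma>1 \<beta>\<sigma>2 \<beta>\<gamma> :: bezout_matrices
    and A1' A2' :: "'h \<Rightarrow> 'h"
    and n :: nat
    and P0 P1 P2 :: "complex \<times> complex \<times> complex \<Rightarrow> complex"
    and C :: "(complex \<times> complex) set"
    and E' E'' :: "(multi_index, 'e) family set"
    and \<Phi>' \<Phi>'' :: "'h \<Rightarrow> (multi_index, 'e) family"
    and \<sigma>1' \<sigma>2' \<gamma>in' \<gamma>out' \<sigma>1'' \<sigma>2'' \<gamma>in'' \<gamma>out'' ::
      "(multi_index, 'e) family \<Rightarrow> (multi_index, 'e) family"
  assumes vessel: "commutative_vessel A1 A2 \<Phi> UNIV \<sigma>1 \<sigma>2 \<gamma>in \<gamma>out"
    and irreducible_affine: "Factorial_Ring.irreducible (discriminant_poly UNIV \<sigma>1 \<sigma>2 \<gamma>in)"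
    and irreducible_homogeneous:
      "Factorial_Ring.irreducible (homogeneous_discriminant_poly UNIV \<sigma>1 \<sigma>2 \<gamma>in)"
    and "C = discriminant_variety UNIV \<sigma>1 \<sigma>2 \<gamma>in"
    and invertible: "boundedly_invertible (op_poly p0 A1 A2)"
    and "A1' = the_inv (op_poly p0 A1 A2) \<circ> op_poly p1 A1 A2"
    and "A2' = the_inv (op_poly p0 A1 A2) \<circ> op_poly p2 A1 A2"
    and curve: "irreducible_plane_curve C'"
    and birational:
      "birational_isomorphism C C' (complexify p0) (complexify p1) (complexify p2)"
    and "n = Max {total_degree p0, total_degree p1, total_degree p2}"
    and "P0 = homogenize n p0"
    and "P1 = homogenize n p1"
    and "P2 = homogenize n p2"
    and bezout_P1_P0: "is_bezout_matrices n P1 P0 \<beta>\<sigma>1"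
    and bezout_P2_P0: "is_bezout_matrices n P2 P0 \<beta>\<sigma>2"
    and bezout_P1_P2: "is_bezout_matrices n P1 P2 \<beta>\<gamma>"
    and "E' = principal_subspace n \<sigma>1 \<sigma>2 \<gamma>in"
    and "\<Phi>' = (\<lambda>h. proj E' (tuple n (\<lambda>(i0, i1, i2).
           \<Phi> ((cadjoint A1 ^^ i1) ((cadjoint A2 ^^ i2)
              (the_inv (op_poly p0 (cadjoint A1) (cadjoint A2)) h))))))"
    and "\<sigma>1' = compression E' (bezout_operator n \<sigma>1 \<sigma>2 \<gamma>in \<beta>\<sigma>1)"
    and "\<sigma>2' = compression E' (bezout_operator n \<sigma>1 \<sigma>2 \<gamma>in \<beta>\<sigma>2)"
    and "\<gamma>in' = compression E' (bezout_operator n \<sigma>1 \<sigma>2 \<gamma>in \<beta>\<gamma>)"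
    and "\<gamma>out' = (\<lambda>w. \<gamma>in' w
           + \<i> *\<^sub>C (\<sigma>1' (\<Phi>' (cadjoint \<Phi>' (\<sigma>2' w))) - \<sigma>2' (\<Phi>' (cadjoint \<Phi>' (\<sigma>1' w)))))"
    and "E'' = orthogonal_complement_in E' (cspan (basepoint_vectors n \<sigma>1 \<sigma>2 \<gamma>in P0 P1 P2))"
    and "\<Phi>'' = proj E'' \<circ> \<Phi>'"
    and "\<sigma>1'' = compression E'' \<sigma>1'"
    and "\<sigma>2'' = compression E'' \<sigma>2'"
    and "\<gamma>in'' = compression E'' \<gamma>in'"
    and "\<gamma>out'' = compression E'' \<gamma>out'"
  shows "commutative_vessel A1' A2' \<Phi>'' E'' \<sigma>1'' \<sigma>2'' \<gamma>in'' \<gamma>out'' \<and>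
         C' \<subseteq> discriminant_variety E'' \<sigma>1'' \<sigma>2'' \<gamma>in''"
proof -
  have vessel': "bounded_clinear A1" "bounded_clinear A2" "bounded_clinear \<Phi>" "\<And>h. A1 (A2 h) = A2 (A1 h)"
    "fin_dim (UNIV :: 'e set)" "selfadjoint_on UNIV \<sigma>1" "selfadjoint_on UNIV \<sigma>2" "selfadjoint_on UNIV \<gamma>in"
    "\<And>h. cadjoint \<Phi> (\<sigma>1 (\<Phi> h)) = (1 / \<i>) *\<^sub>C (A1 h - cadjoint A1 h)"
    "\<And>h. cadjoint \<Phi> (\<sigma>2 (\<Phi> h)) = (1 / \<i>) *\<^sub>C (A2 h - cadjoint A2 h)"
    "\<And>h. \<gamma>in (\<Phi> h) = \<sigma>1 (\<Phi> (cadjoint A2 h)) - \<sigma>2 (\<Phi> (cadjoint A1 h))"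
    using vessel unfolding commutative_vessel_def by (auto simp: fun_eq_iff)
  interpret transformed_vessel \<sigma>1 \<sigma>2 \<gamma>in A1 A2 \<Phi> p0 p1 p2 n \<beta>\<sigma>1 \<beta>\<sigma>2 \<beta>\<gamma>
    by unfold_locales
       (use vessel' irreducible_affine irreducible_homogeneous invertible bezout_P1_P0 bezout_P2_P0 bezout_P1_P2
         in \<open>simp_all add: \<open>n = _\<close> \<open>P0 = _\<close> \<open>P1 = _\<close> \<open>P2 = _\<close>\<close>)
  have C: "C = curve"
    unfolding \<open>C = _\<close> discriminant_variety_eq curve_eq ..
  have A': "A1' = S \<circ> op_poly p1 A1 A2" "A2' = S \<circ> op_poly p2 A1 A2"
    unfolding \<open>A1' = _\<close> \<open>A2' = _\<close> S_def by (rule refl)+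
  have \<Phi>': "\<Phi>' = (\<lambda>h. \<Psi> n (cadjoint S h))"
  proof
    fix h
    have eq: "(\<lambda>(i0, i1, i2). \<Phi> ((cadjoint A1 ^^ i1) ((cadjoint A2 ^^ i2)
              (the_inv (op_poly p0 (cadjoint A1) (cadjoint A2)) h)))) =
          (\<lambda>i. \<Phi> (T_power (fst (snd i)) (snd (snd i)) (cadjoint S h)))"
      by (auto simp: T_power_def the_inv_R)
    show "\<Phi>' h = \<Psi> n (cadjoint S h)"
      unfolding \<open>\<Phi>' = _\<close> \<open>E' = _\<close> eq \<Psi>_def[symmetric]
      by (rule proj_fixed[OF fin_dim_V \<Psi>_in_V])
  qed
  have E'': "E'' = orthogonal_complement_in (V n) basepoint_span"
    unfolding \<open>E'' = _\<close> \<open>E' = _\<close> \<open>P0 = _\<close> \<open>P1 = _\<close> \<open>P2 = _\<close> basepoint_span_def ..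
  have coeffs: "\<sigma>1' = compression (V n) (B n \<beta>\<sigma>1)" "\<sigma>2' = compression (V n) (B n \<beta>\<sigma>2)"
    "\<gamma>in' = compression (V n) (B n \<beta>\<gamma>)"
    unfolding \<open>\<sigma>1' = _\<close> \<open>\<sigma>2' = _\<close> \<open>\<gamma>in' = _\<close> \<open>E' = _\<close> by (rule refl)+
  have out: "\<gamma>out' = transformed_vessel.\<gamma>out' \<sigma>1 \<sigma>2 \<gamma>in A1 A2 \<Phi> p0 n \<beta>\<sigma>1 \<beta>\<sigma>2 \<beta>\<gamma>"
    unfolding \<open>\<gamma>out' = _\<close> \<gamma>out'_def coeffs \<Phi>' ..
  show ?thesis
  proof
    show "commutative_vessel A1' A2' \<Phi>'' E'' \<sigma>1'' \<sigma>2'' \<gamma>in'' \<gamma>out''"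
      unfolding \<open>\<Phi>'' = _\<close> \<open>\<sigma>1'' = _\<close> \<open>\<sigma>2'' = _\<close> \<open>\<gamma>in'' = _\<close> \<open>\<gamma>out'' = _\<close> out A' \<Phi>' E'' coeffs
      by (rule reduced_vessel)
    show "C' \<subseteq> discriminant_variety E'' \<sigma>1'' \<sigma>2'' \<gamma>in''"
      unfolding \<open>\<sigma>1'' = _\<close> \<open>\<sigma>2'' = _\<close> \<open>\<gamma>in'' = _\<close> E'' coeffs
      by (rule curve_subset_discriminant_variety[OF birational[unfolded C] curve])
  qed
qed

end
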